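(* Let $\mathbb K$ be an algebraically closed field of characteristic zero, $n\ge 3$ and $R=\mathbb K[x_1,\ldots,x_n]$. Let $g=x_1^{r_1}x_2^{r_2}\cdots x_{n-1}^{r_{n-1}}-x_n^d\in R$, with $r_1+\cdots+r_{n-1}=d$ and $r_i\neq 0$ for $i=2,\ldots,n-1$, and let $h:=x_{i_1}\cdots x_{i_{n-2}}$, where $\{i_1,\ldots,i_{n-2}\}\subset\{1,\ldots,n-1\}$. Then: (i) $g$ is a nonfree divisor. (ii) $f:=gh$ is a free divisor of linear type.
   Context: The exponents $r_1,\ldots,r_{n-1}$ are nonnegative integers, and $i_1,\ldots,i_{n-2}$ are $n-2$ distinct indices. For a squarefree polynomial $F\in R$, let $D_F=\{\theta\in{\rm Der}(R):\theta(F)\in\langle F\rangle\}$, where ${\rm Der}(R)$ is the $R$-module of derivations on $R$; $F$ (or $V(F)$) is a free divisor if $D_F$ is a free $R$-module. For a homogeneous squarefree $F$ defining a non-smooth hypersurface, this is equivalent to the gradient ideal $J_F$ (generated by all partial derivatives of $F$) being a perfect ideal of codimension $2$. A divisor $F$ is of linear type if its gradient ideal $J_F$ is of linear type, i.e. the canonical surjection from the symmetric algebra of $J_F$ to its Rees algebra is an isomorphism.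
   Formalization: Part (i) is stated without the case n = 3, r_1 = 0, where it is false: there g = x_2^d − x_3^d is a free divisor (basis ∂_1, x_2∂_2 + x_3∂_3, x_3^{d−1}∂_2 + x_2^{d−1}∂_3); part (ii) is stated in full. *)

theory Defs
  imports
    "HOL-Library.Poly_Mapping"
    "HOL-Library.Function_Algebras"
    "HOL-Computational_Algebra.Computational_Algebra"
    "HOL-Algebra.QuotRing"
begin

section \<open>Polynomial rings\<close>

text \<open>Polynomials in indeterminates indexed by the type \<open>'i\<close>: an element of the inner type
  \<open>'i \<Rightarrow>\<^sub>0 nat\<close> is the exponent vector of a monomial.\<close>

type_synonym ('i, 'a) mpoly = "('i \<Rightarrow>\<^sub>0 nat) \<Rightarrow>\<^sub>0 'a"

definition Const :: "'a::comm_ring_1 \<Rightarrow> ('i, 'a) mpoly" where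
  "Const c = Poly_Mapping.single 0 c"

definition Var :: "'i \<Rightarrow> ('i, 'a::comm_ring_1) mpoly" where
  "Var i = Poly_Mapping.single (Poly_Mapping.single i 1) 1"

definition partial_deriv :: "'i \<Rightarrow> ('i, 'a::comm_ring_1) mpoly \<Rightarrow> ('i, 'a) mpoly" where
  "partial_deriv i p =
     (\<Sum>\<mu>\<in>Poly_Mapping.keys p.
        Poly_Mapping.single (\<mu> - Poly_Mapping.single i 1)
          (of_nat (Poly_Mapping.lookup \<mu> i) * Poly_Mapping.lookup p \<mu>))"


section \<open>Modules and ideals\<close>

definition free_module :: "('r::comm_ring_1 \<Rightarrow> 'm::ab_group_add \<Rightarrow> 'm) \<Rightarrow> 'm set \<Rightarrow> bool" where
  "free_module scale M \<longleftrightarrow> (\<exists>B. \<not> module.dependent scale B \<and> module.span scale B = M)"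

lemma module_ring: "module ((*) :: 'r::comm_ring_1 \<Rightarrow> 'r \<Rightarrow> 'r)"
  by unfold_locales (auto simp: algebra_simps)

definition ideal_gen :: "'r::comm_ring_1 set \<Rightarrow> 'r set" where
  "ideal_gen S = module.span (*) S"

definition ideal_power :: "'r::comm_ring_1 set \<Rightarrow> nat \<Rightarrow> 'r set" where
  "ideal_power J k = ideal_gen {\<Prod>i<k. u i | u. \<forall>i<k. u i \<in> J}"


section \<open>Derivations and free divisors\<close>

text \<open>Derivations are linear over the coefficient field. They form a module over the polynomial
  ring, whose additive group structure is the pointwise one on functions.\<close>

definition derivations :: "(('i, 'a::comm_ring_1) mpoly \<Rightarrow> ('i, 'a) mpoly) set" where
  "derivations = {\<theta>.
     (\<forall>p q. \<theta> (p + q) = \<theta> p + \<theta> q) \<and>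
     (\<forall>c p. \<theta> (Const c * p) = Const c * \<theta> p) \<and>
     (\<forall>p q. \<theta> (p * q) = p * \<theta> q + q * \<theta> p)}"

definition der_scale ::
    "('i, 'a::comm_ring_1) mpoly \<Rightarrow> (('i, 'a) mpoly \<Rightarrow> ('i, 'a) mpoly)
      \<Rightarrow> ('i, 'a) mpoly \<Rightarrow> ('i, 'a) mpoly" where
  "der_scale a \<theta> = (\<lambda>p. a * \<theta> p)"

lemma module_der_scale: "module der_scale"
  by unfold_locales (auto simp: der_scale_def fun_eq_iff algebra_simps)

definition log_derivations ::
    "('i, 'a::comm_ring_1) mpoly \<Rightarrow> (('i, 'a) mpoly \<Rightarrow> ('i, 'a) mpoly) set" where
  "log_derivations F = {\<theta> \<in> derivations. \<theta> F \<in> ideal_gen {F}}"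

lemma subspace_log_derivations: "module.subspace der_scale (log_derivations F)"
proof -
  note span = module.span_zero[OF module_ring] module.span_add[OF module_ring]
    module.span_scale[OF module_ring]
  show ?thesis
    unfolding module.subspace_def[OF module_der_scale] log_derivations_def derivations_def
      ideal_gen_def
    by (auto simp: der_scale_def algebra_simps intro: span)
qed

definition free_divisor :: "('i, 'a::comm_ring_1) mpoly \<Rightarrow> bool" where
  "free_divisor F \<longleftrightarrow> squarefree F \<and> free_module der_scale (log_derivations F)"

definition nonfree_divisor :: "('i, 'a::comm_ring_1) mpoly \<Rightarrow> bool" where
  "nonfree_divisor F \<longleftrightarrow> squarefree F \<and> \<not> free_module der_scale (log_derivations F)"

definition gradient_ideal :: "('i, 'a::comm_ring_1) mpoly \<Rightarrow> ('i, 'a) mpoly set" where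
  "gradient_ideal F = ideal_gen (range (\<lambda>i. partial_deriv i F))"


section \<open>Symmetric algebra, Rees algebra and linear type\<close>

definition ring_on :: "'a::comm_ring_1 set \<Rightarrow> 'a ring" where
  "ring_on C = \<lparr>carrier = C, monoid.mult = (*), one = 1, ring.zero = 0, add = (+)\<rparr>"

text \<open>The symmetric algebra of a submodule \<open>M\<close> is presented as the polynomial ring with one
  indeterminate for every element of \<open>M\<close>, modulo the relations that make the map
  \<open>m \<mapsto> Var m\<close> linear.\<close>

definition free_algebra :: "'m set \<Rightarrow> ('m, 'r::comm_ring_1) mpoly ring" where
  "free_algebra M =
     ring_on {p. \<forall>\<mu>\<in>Poly_Mapping.keys p. Poly_Mapping.keys \<mu> \<subseteq> M}"

definition linearity_relations ::
    "('r::comm_ring_1 \<Rightarrow> 'm::ab_group_add \<Rightarrow> 'm) \<Rightarrow> 'm set \<Rightarrow> ('m, 'r) mpoly set" where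
  "linearity_relations scale M =
     {Var (x + y) - Var x - Var y | x y. x \<in> M \<and> y \<in> M} \<union>
     {Var (scale a x) - Const a * Var x | a x. x \<in> M}"

definition sym_algebra ::
    "('r::comm_ring_1 \<Rightarrow> 'm::ab_group_add \<Rightarrow> 'm) \<Rightarrow> 'm set \<Rightarrow> ('m, 'r) mpoly set ring" where
  "sym_algebra scale M =
     free_algebra M Quot (Idl\<^bsub>free_algebra M\<^esub> (linearity_relations scale M))"

text \<open>The Rees algebra of \<open>J\<close> is the direct sum of the \<open>J\<^sup>k t\<^sup>k\<close> inside the ring of univariate
  polynomials in \<open>t\<close>.\<close>

definition rees_algebra :: "'r::comm_ring_1 set \<Rightarrow> 'r poly ring" where
  "rees_algebra J = ring_on {p. \<forall>k. coeff p k \<in> ideal_power J k}"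

text \<open>The homomorphism of algebras given by \<open>Var m \<mapsto> m t\<close>, and the map it induces on cosets.
  It is constant on the cosets that form the symmetric algebra of an ideal, so that
  \<open>the_elem\<close> picks its value.\<close>

definition rees_eval :: "('r, 'r::comm_ring_1) mpoly \<Rightarrow> 'r poly" where
  "rees_eval p =
     (\<Sum>\<mu>\<in>Poly_Mapping.keys p.
        [:Poly_Mapping.lookup p \<mu>:] *
        (\<Prod>m\<in>Poly_Mapping.keys \<mu>. monom m 1 ^ Poly_Mapping.lookup \<mu> m))"

definition sym_to_rees :: "('r, 'r::comm_ring_1) mpoly set \<Rightarrow> 'r poly" where
  "sym_to_rees A = the_elem (rees_eval ` A)"

definition linear_type_ideal :: "'r::comm_ring_1 set \<Rightarrow> bool" where
  "linear_type_ideal J \<longleftrightarrow> sym_to_rees \<in> ring_iso (sym_algebra (*) J) (rees_algebra J)"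

definition linear_type_divisor :: "('i, 'a::comm_ring_1) mpoly \<Rightarrow> bool" where
  "linear_type_divisor F \<longleftrightarrow> linear_type_ideal (gradient_ideal F)"

end

theory Submission
  imports Defs
begin

text \<open>Write \<open>z\<close> for the last indeterminate, \<open>M\<close> for the monomial in the others, so that
  \<open>g = M - z\<^sup>d\<close>, write \<open>S\<close> for the set of indices of the factors of \<open>h\<close>, and \<open>m\<close> for the one
  index other than \<open>z\<close> outside \<open>S\<close>.

  \<^emph>\<open>Why \<open>g\<close> is not free.\<close> The derivations have rank \<open>n\<close>, so a basis of the module \<open>D\<close> of
  logarithmic derivations of \<open>g\<close> has at most \<open>n\<close> elements
  (\<open>independent_derivations_card\<close>). On the other hand \<open>D\<close> needs at least \<open>n + 1\<close> generators.
  Comparing coefficients in \<open>\<theta>(g) = c g\<close> shows that certain low monomials never occur in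
  \<open>\<theta>(x\<^sub>k)\<close> and \<open>\<theta>(z)\<close>; hence the functionals that read off a coefficient directly above them
  vanish on the product of \<open>D\<close> with the maximal ideal of the origin (\<open>probe_scale\<close>). There
  are \<open>n + 1\<close> of them: one for each of the \<open>n - 1\<close> diagonal derivations
  \<open>x\<^sub>k \<partial>\<^sub>k + (r\<^sub>k/d) z \<partial>\<^sub>z\<close> (for \<open>r\<^sub>k = 0\<close>, \<open>\<partial>\<^sub>k\<close> itself), and one each for two derivations of the form
  \<open>d z\<^sup>d\<^sup>-\<^sup>1 \<partial>\<^sub>k + (\<partial>\<^sub>k M) \<partial>\<^sub>z\<close>. For the latter, two exponents \<open>r\<^sub>k\<close> must be nonzero.

  \<^emph>\<open>Why \<open>f = g h\<close> is free.\<close> The factors of \<open>h\<close> are primes that do not divide the rest of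
  \<open>f\<close>, so a derivation is logarithmic for \<open>f\<close> iff it is for \<open>g\<close> and for every factor of
  \<open>h\<close> (\<open>log_derivations_mult_prime\<close>). This splits off the diagonal derivations with index in
  \<open>S\<close> and leaves a single equation between \<open>\<theta>(x\<^sub>m)\<close> and \<open>\<theta>(z)\<close>, whose solutions are
  free of rank two (\<open>basis_generates\<close>).

  \<^emph>\<open>Why \<open>f\<close> is of linear type.\<close> Put \<open>\<xi> = x\<^sub>m\<close>, or \<open>\<xi> = 1\<close> if \<open>x\<^sub>m\<close> does not occur in \<open>M\<close>,
  and \<open>N = M/\<xi>\<close>. The gradient ideal is generated by \<open>F\<^sub>j = \<partial>\<^sub>j f\<close> for \<open>j \<in> S\<close>, \<open>F\<^sub>m = h N\<close> and
  \<open>F\<^sub>z = h z\<^sup>d\<^sup>-\<^sup>1\<close>, which satisfy the linear equations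
  \<open>x\<^sub>j T\<^sub>j = (r\<^sub>j + 1) \<xi> T\<^sub>m - z T\<^sub>z\<close> and \<open>z\<^sup>d\<^sup>-\<^sup>1 T\<^sub>m = N T\<^sub>z\<close>. Where \<open>z\<close> and the \<open>x\<^sub>j\<close> are
  invertible, they express every \<open>T\<close> through \<open>T\<^sub>z\<close>, and no nonzero polynomial in \<open>T\<^sub>z\<close> alone
  vanishes at \<open>F\<^sub>z\<close>. So all equations of the Rees algebra follow from these linear ones
  (\<open>blowup_map_kernel\<close>) provided that \<open>z\<^sup>d\<^sup>-\<^sup>1\<close> and the \<open>x\<^sub>j\<close> are not zero divisors modulo the linear
  equations. The latter rests on two facts: members of a regular sequence may be exchanged
  (\<open>nzd_swap\<close>), and \<open>a t\<^sup>e - b\<close> is regular modulo an ideal not involving the indeterminate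
  \<open>t\<close> as soon as \<open>a\<close> is (\<open>nzd_monic_in_var\<close>). Finally \<open>linear_type_idealI\<close> passes from the
  finitely many \<open>T\<close> to the symmetric algebra with one indeterminate for every element of
  the ideal.\<close>

section \<open>Ring maps and evaluation of polynomials\<close>

text \<open>All substitutions below are homomorphisms between whole types, so a predicate on functions
  is lighter than homomorphisms between carriers.\<close>

definition ring_map :: "('a::comm_ring_1 \<Rightarrow> 'b::comm_ring_1) \<Rightarrow> bool" where
  "ring_map h \<longleftrightarrow> h 1 = 1 \<and> (\<forall>a b. h (a + b) = h a + h b) \<and> (\<forall>a b. h (a * b) = h a * h b)"

lemma ring_mapI:
  assumes "h 1 = 1" "\<And>a b. h (a + b) = h a + h b" "\<And>a b. h (a * b) = h a * h b"
  shows "ring_map h"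
  using assms unfolding ring_map_def by blast

lemma ring_map_one: "ring_map h \<Longrightarrow> h 1 = 1"
  and ring_map_add: "ring_map h \<Longrightarrow> h (a + b) = h a + h b"
  and ring_map_mult: "ring_map h \<Longrightarrow> h (a * b) = h a * h b"
  by (simp_all add: ring_map_def)

lemma ring_map_zero: "ring_map h \<Longrightarrow> h 0 = 0"
  using ring_map_add[of h 0 0] by simp

lemma ring_map_uminus: "ring_map h \<Longrightarrow> h (- a) = - h a"
  using ring_map_add[of h a "- a"] by (simp add: ring_map_zero eq_neg_iff_add_eq_0 add.commute)

lemma ring_map_diff: "ring_map h \<Longrightarrow> h (a - b) = h a - h b"
  using ring_map_add[of h a "- b"] by (simp add: ring_map_uminus)

lemma ring_map_power: "ring_map h \<Longrightarrow> h (a ^ k) = h a ^ k"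
  by (induction k) (simp_all add: ring_map_one ring_map_mult)

lemma ring_map_sum: "ring_map h \<Longrightarrow> h (sum f A) = (\<Sum>x\<in>A. h (f x))"
  by (induction A rule: infinite_finite_induct) (simp_all add: ring_map_zero ring_map_add)

lemma ring_map_prod: "ring_map h \<Longrightarrow> h (prod f A) = (\<Prod>x\<in>A. h (f x))"
  by (induction A rule: infinite_finite_induct) (simp_all add: ring_map_one ring_map_mult)

lemmas ring_map_simps = ring_map_one ring_map_add ring_map_mult ring_map_zero ring_map_uminus
  ring_map_diff ring_map_power ring_map_sum ring_map_prod

lemma ring_map_Const: "ring_map (Const :: 'a::comm_ring_1 \<Rightarrow> ('i, 'a) mpoly)"
  by (rule ring_mapI) (simp_all add: Const_def single_add mult_single)

lemma ring_map_const_poly: "ring_map (\<lambda>c::'a::comm_ring_1. [:c:])"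
  by (rule ring_mapI) simp_all

lemma ring_map_comp: "ring_map h \<Longrightarrow> ring_map k \<Longrightarrow> ring_map (\<lambda>x. h (k x))"
  by (simp add: ring_map_def)

lemma ring_map_poly: "ring_map (\<lambda>p::'a::comm_ring_1 poly. poly p x)"
  by (rule ring_mapI) simp_all

lemma ring_map_map_poly:
  assumes h: "ring_map h"
  shows "ring_map (map_poly h)"
proof (rule ring_mapI)
  note [simp] = ring_map_simps[OF h]
  show "map_poly h 1 = 1"
    by (simp add: map_poly_1')
  show add: "map_poly h (p + q) = map_poly h p + map_poly h q" for p q
    by (rule poly_eqI) (simp add: coeff_map_poly)
  have smult: "map_poly h (smult c q) = smult (h c) (map_poly h q)" for c q
    by (rule poly_eqI) (simp add: coeff_map_poly)
  show "map_poly h (p * q) = map_poly h p * map_poly h q" for p q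
  proof (induction p)
    case (pCons a p)
    then show ?case
      by (simp add: add smult map_poly_pCons)
  qed simp
qed

lemma mpoly_eq_sum_single:
  "p = (\<Sum>\<mu>\<in>Poly_Mapping.keys p. Poly_Mapping.single \<mu> (Poly_Mapping.lookup p \<mu>))"
  by (rule poly_mapping_eqI)
    (simp add: lookup_sum lookup_single when_def not_in_keys_iff_lookup_eq_zero)

definition monomial_value :: "('i \<Rightarrow> 'b::comm_ring_1) \<Rightarrow> ('i \<Rightarrow>\<^sub>0 nat) \<Rightarrow> 'b" where
  "monomial_value \<alpha> \<mu> = (\<Prod>i\<in>Poly_Mapping.keys \<mu>. \<alpha> i ^ Poly_Mapping.lookup \<mu> i)"

text \<open>The map \<open>\<kappa>\<close> acts on coefficients, \<open>\<alpha>\<close> gives the values of the indeterminates.\<close>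

definition meval ::
    "('a::comm_ring_1 \<Rightarrow> 'b::comm_ring_1) \<Rightarrow> ('i \<Rightarrow> 'b) \<Rightarrow> ('i, 'a) mpoly \<Rightarrow> 'b" where
  "meval \<kappa> \<alpha> p =
     (\<Sum>\<mu>\<in>Poly_Mapping.keys p. \<kappa> (Poly_Mapping.lookup p \<mu>) * monomial_value \<alpha> \<mu>)"

lemma monomial_value_superset:
  assumes "finite A" "Poly_Mapping.keys \<mu> \<subseteq> A"
  shows "monomial_value \<alpha> \<mu> = (\<Prod>i\<in>A. \<alpha> i ^ Poly_Mapping.lookup \<mu> i)"
  unfolding monomial_value_def
  by (rule prod.mono_neutral_left) (use assms in \<open>auto simp: in_keys_iff\<close>)

lemma monomial_value_add:
  "monomial_value \<alpha> (\<mu> + \<nu>) = monomial_value \<alpha> \<mu> * monomial_value \<alpha> \<nu>"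
proof -
  let ?A = "Poly_Mapping.keys \<mu> \<union> Poly_Mapping.keys \<nu>"
  have "Poly_Mapping.keys (\<mu> + \<nu>) \<subseteq> ?A"
    by (rule keys_add)
  then show ?thesis
    by (simp add: monomial_value_superset[where A = ?A] lookup_add power_add prod.distrib)
qed

lemma monomial_value_zero [simp]: "monomial_value \<alpha> 0 = 1"
  by (simp add: monomial_value_def)

lemma monomial_value_single: "monomial_value \<alpha> (Poly_Mapping.single i k) = \<alpha> i ^ k"
  by (simp add: monomial_value_def)

lemma meval_superset:
  assumes "ring_map \<kappa>" "finite A" "Poly_Mapping.keys p \<subseteq> A"
  shows "meval \<kappa> \<alpha> p = (\<Sum>\<mu>\<in>A. \<kappa> (Poly_Mapping.lookup p \<mu>) * monomial_value \<alpha> \<mu>)"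
  unfolding meval_def
  by (rule sum.mono_neutral_left) (use assms in \<open>auto simp: in_keys_iff ring_map_zero\<close>)

lemma meval_single:
  "ring_map \<kappa> \<Longrightarrow> meval \<kappa> \<alpha> (Poly_Mapping.single \<mu> c) = \<kappa> c * monomial_value \<alpha> \<mu>"
  by (simp add: meval_superset[where A = "{\<mu>}"])

lemma meval_add:
  assumes "ring_map \<kappa>"
  shows "meval \<kappa> \<alpha> (p + q) = meval \<kappa> \<alpha> p + meval \<kappa> \<alpha> q"
proof -
  let ?A = "Poly_Mapping.keys p \<union> Poly_Mapping.keys q"
  have "Poly_Mapping.keys (p + q) \<subseteq> ?A"
    by (rule keys_add)
  then show ?thesis
    by (simp add: meval_superset[OF assms, where A = ?A] lookup_add ring_map_add[OF assms]
        distrib_right sum.distrib)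
qed

lemma meval_sum:
  assumes "ring_map \<kappa>"
  shows "meval \<kappa> \<alpha> (sum f A) = (\<Sum>x\<in>A. meval \<kappa> \<alpha> (f x))"
proof -
  have "meval \<kappa> \<alpha> 0 = 0"
    by (simp add: meval_def)
  then show ?thesis
    by (induction A rule: infinite_finite_induct) (simp_all add: meval_add[OF assms])
qed

lemma meval_Const [simp]: "ring_map \<kappa> \<Longrightarrow> meval \<kappa> \<alpha> (Const c) = \<kappa> c"
  by (simp add: Const_def meval_single)

lemma meval_Var [simp]: "ring_map \<kappa> \<Longrightarrow> meval \<kappa> \<alpha> (Var i) = \<alpha> i"
  by (simp add: Var_def meval_single monomial_value_single ring_map_one)

lemma ring_map_meval:
  fixes \<alpha> :: "'i \<Rightarrow> 'b::comm_ring_1" and \<kappa> :: "'a::comm_ring_1 \<Rightarrow> 'b"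
  assumes \<kappa>: "ring_map \<kappa>"
  shows "ring_map (meval \<kappa> \<alpha>)"
proof (rule ring_mapI)
  show "meval \<kappa> \<alpha> 1 = 1"
    using meval_Const[OF \<kappa>, of \<alpha> 1] by (simp add: ring_map_one[OF ring_map_Const] ring_map_one[OF \<kappa>])
  show "meval \<kappa> \<alpha> (p + q) = meval \<kappa> \<alpha> p + meval \<kappa> \<alpha> q" for p q
    by (rule meval_add[OF \<kappa>])
  fix p q :: "('i, 'a) mpoly"
  let ?s = "\<lambda>p \<mu>. Poly_Mapping.single \<mu> (Poly_Mapping.lookup p \<mu>)"
  have "p * q = (\<Sum>\<mu>\<in>Poly_Mapping.keys p. ?s p \<mu>) * (\<Sum>\<nu>\<in>Poly_Mapping.keys q. ?s q \<nu>)"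
    by (simp flip: mpoly_eq_sum_single)
  also have "meval \<kappa> \<alpha> \<dots> = meval \<kappa> \<alpha> p * meval \<kappa> \<alpha> q"
    unfolding sum_product
    by (simp add: meval_sum[OF \<kappa>] mult_single meval_single[OF \<kappa>] ring_map_mult[OF \<kappa>]
        monomial_value_add)
      (simp add: meval_def sum_product mult_ac)
  finally show "meval \<kappa> \<alpha> (p * q) = meval \<kappa> \<alpha> p * meval \<kappa> \<alpha> q" .
qed

lemma single_conv_monomial_value:
  "Poly_Mapping.single \<mu> c = Const c * monomial_value Var \<mu>"
proof -
  have pow: "Var i ^ k = (Poly_Mapping.single (Poly_Mapping.single i k) 1 :: ('a, 'b) mpoly)" for i k
    by (induction k) (simp_all add: Var_def mult_single flip: single_add)
  have prod: "(\<Prod>i\<in>A. Poly_Mapping.single (e i) 1) =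
      (Poly_Mapping.single (\<Sum>i\<in>A. e i) 1 :: ('a, 'b) mpoly)" for A :: "'a set" and e
    by (induction A rule: infinite_finite_induct) (simp_all add: mult_single)
  show ?thesis
    by (simp add: monomial_value_def pow prod Const_def mult_single
        flip: mpoly_eq_sum_single)
qed

lemma mpoly_induct [case_names Const Var add mult]:
  fixes p :: "('i, 'a::comm_ring_1) mpoly"
  assumes C: "\<And>c. P (Const c)"
    and V: "\<And>i. P (Var i)"
    and A: "\<And>p q. P p \<Longrightarrow> P q \<Longrightarrow> P (p + q)"
    and M: "\<And>p q. P p \<Longrightarrow> P q \<Longrightarrow> P (p * q)"
  shows "P p"
proof -
  have "0 = (Const 0 :: ('i, 'a) mpoly)" "1 = (Const 1 :: ('i, 'a) mpoly)"
    by (simp_all add: ring_map_simps[OF ring_map_Const])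
  then have P01: "P 0" "P 1"
    using C by metis+
  have sum: "P (sum f A)" if "\<And>x. x \<in> A \<Longrightarrow> P (f x)" for A and f :: "('i \<Rightarrow>\<^sub>0 nat) \<Rightarrow> ('i, 'a) mpoly"
    using that by (induction A rule: infinite_finite_induct) (simp_all add: P01 A)
  have pow: "P (Var i ^ k)" for i k
    by (induction k) (simp_all add: P01 M V)
  have prod: "P (\<Prod>i\<in>A. Var i ^ e i)" for A and e :: "'i \<Rightarrow> nat"
    by (induction A rule: infinite_finite_induct) (simp_all add: P01 M pow)
  have "P (Poly_Mapping.single \<mu> c)" for \<mu> c
    unfolding single_conv_monomial_value monomial_value_def by (intro M C prod)
  then have "P (\<Sum>\<mu>\<in>Poly_Mapping.keys p. Poly_Mapping.single \<mu> (Poly_Mapping.lookup p \<mu>))"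
    by (intro sum)
  then show ?thesis
    by (simp flip: mpoly_eq_sum_single)
qed

lemma ring_map_mpoly_eqI:
  assumes "ring_map h" "ring_map k"
    and "\<And>c. h (Const c) = k (Const c)" "\<And>i. h (Var i) = k (Var i)"
  shows "h p = k p"
  by (induction p rule: mpoly_induct) (simp_all add: assms ring_map_add ring_map_mult)

section \<open>Polynomials in one chosen indeterminate\<close>

text \<open>The isomorphism of a polynomial ring with the univariate polynomials in \<open>t\<close> over the
  others. The coefficients are kept in the full ring, where they happen not to involve
  \<open>t\<close>; this makes divisibility by \<open>Var t\<close> and leading coefficients in \<open>t\<close> accessible.\<close>

definition in_var :: "'i \<Rightarrow> ('i, 'a::comm_ring_1) mpoly \<Rightarrow> ('i, 'a) mpoly poly" where
  "in_var t = meval (\<lambda>c. [:Const c:]) (\<lambda>i. if i = t then monom 1 1 else [:Var i:])"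

lemma ring_map_Const_const_poly: "ring_map (\<lambda>c::'a::comm_ring_1. [:Const c :: ('i, 'a) mpoly:])"
  by (rule ring_map_comp[OF ring_map_const_poly ring_map_Const])

lemma ring_map_in_var: "ring_map (in_var t)"
  unfolding in_var_def by (rule ring_map_meval[OF ring_map_Const_const_poly])

lemmas in_var_simps [simp] = ring_map_simps[OF ring_map_in_var]

lemma in_var_Const [simp]: "in_var t (Const c) = [:Const c:]"
  by (simp add: in_var_def ring_map_Const_const_poly)

lemma in_var_Var: "in_var t (Var i) = (if i = t then monom 1 1 else [:Var i:])"
  by (simp add: in_var_def ring_map_Const_const_poly)

lemma poly_in_var: "poly (in_var t p) (Var t) = p"
proof (rule ring_map_mpoly_eqI[where h = "\<lambda>p. poly (in_var t p) (Var t)" and k = "\<lambda>p. p"])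
  show "ring_map (\<lambda>p. poly (in_var t p) (Var t))"
    by (rule ring_map_comp[OF ring_map_poly ring_map_in_var])
qed (simp_all add: ring_map_def in_var_Var poly_monom)

definition free_of :: "'i \<Rightarrow> ('i, 'a::comm_ring_1) mpoly \<Rightarrow> bool" where
  "free_of t p \<longleftrightarrow> in_var t p = [:p:]"

lemma free_of_simps [simp]:
  "free_of t (Const c)" "free_of t 0" "free_of t 1"
  "free_of t (Var i) \<longleftrightarrow> i \<noteq> t"
  "free_of t p \<Longrightarrow> free_of t q \<Longrightarrow> free_of t (p + q)"
  "free_of t p \<Longrightarrow> free_of t q \<Longrightarrow> free_of t (p - q)"
  "free_of t p \<Longrightarrow> free_of t q \<Longrightarrow> free_of t (p * q)"
  "free_of t p \<Longrightarrow> free_of t (- p)"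
  "free_of t p \<Longrightarrow> free_of t (p ^ k)"
proof -
  show "free_of t (Var i) \<longleftrightarrow> i \<noteq> t"
    by (auto simp: free_of_def in_var_Var monom_altdef)
  show "free_of t p \<Longrightarrow> free_of t (p ^ k)"
    by (induction k) (auto simp: free_of_def)
qed (auto simp: free_of_def ring_map_simps[OF ring_map_in_var])

lemma free_of_prod: "(\<And>x. x \<in> A \<Longrightarrow> free_of t (f x)) \<Longrightarrow> free_of t (prod f A)"
  by (induction A rule: infinite_finite_induct) simp_all

lemma in_var_free: "free_of t p \<Longrightarrow> in_var t p = [:p:]"
  by (simp add: free_of_def)

section \<open>Ideals and elements that are regular modulo an ideal\<close>

interpretation idl: module "(*) :: 'r::comm_ring_1 \<Rightarrow> 'r \<Rightarrow> 'r"
  by (rule module_ring)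

text \<open>For a ring acting on itself this rule is associativity read from right to left, so
  that together with \<open>mult.assoc\<close> it would rewrite forever.\<close>

declare idl.scale_scale [simp del]

lemma ideal_gen_base: "x \<in> S \<Longrightarrow> x \<in> ideal_gen S"
  and ideal_gen_zero: "0 \<in> ideal_gen S"
  and ideal_gen_add: "x \<in> ideal_gen S \<Longrightarrow> y \<in> ideal_gen S \<Longrightarrow> x + y \<in> ideal_gen S"
  and ideal_gen_diff: "x \<in> ideal_gen S \<Longrightarrow> y \<in> ideal_gen S \<Longrightarrow> x - y \<in> ideal_gen S"
  and ideal_gen_mult_left: "x \<in> ideal_gen S \<Longrightarrow> a * x \<in> ideal_gen S"
  and ideal_gen_mult_right: "x \<in> ideal_gen S \<Longrightarrow> x * a \<in> ideal_gen S"
  and ideal_gen_sum: "(\<And>i. i \<in> A \<Longrightarrow> f i \<in> ideal_gen S) \<Longrightarrow> sum f A \<in> ideal_gen S"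
  and ideal_gen_mono: "S \<subseteq> T \<Longrightarrow> ideal_gen S \<subseteq> ideal_gen T"
  and ideal_gen_least: "S \<subseteq> ideal_gen T \<Longrightarrow> ideal_gen S \<subseteq> ideal_gen T"
  for x y a :: "'r::comm_ring_1"
  unfolding ideal_gen_def
          apply (rule idl.span_base, assumption)
         apply (rule idl.span_zero)
        apply (rule idl.span_add, assumption+)
       apply (rule idl.span_diff, assumption+)
      apply (rule idl.span_scale, assumption)
     apply (subst mult.commute, rule idl.span_scale, assumption)
    apply (rule idl.span_sum, blast)
   apply (rule idl.span_mono, assumption)
  apply (rule idl.span_minimal[OF _ idl.subspace_span], assumption)
  done

lemma ideal_gen_insert: "x \<in> ideal_gen (insert a S) \<longleftrightarrow> (\<exists>k. x - k * a \<in> ideal_gen S)"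
  unfolding ideal_gen_def by (rule idl.span_insert[THEN eqset_imp_iff, simplified])

lemma ideal_gen_insertI: "x - k * a \<in> ideal_gen S \<Longrightarrow> x \<in> ideal_gen (insert a S)"
  unfolding ideal_gen_insert by (rule exI)

lemma ideal_gen_insertE:
  assumes "x \<in> ideal_gen (insert a S)"
  obtains k where "x - k * a \<in> ideal_gen S"
  using assms unfolding ideal_gen_insert by (rule exE)

lemma ideal_gen_singleton: "x \<in> ideal_gen {a} \<longleftrightarrow> a dvd x"
proof -
  have "x \<in> ideal_gen {a} \<longleftrightarrow> (\<exists>k. x - k * a \<in> ideal_gen {})"
    by (rule ideal_gen_insert)
  also have "\<dots> \<longleftrightarrow> a dvd x"
    by (simp add: ideal_gen_def dvd_def mult.commute)
  finally show ?thesis .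
qed

text \<open>Regularity of \<open>s\<close> modulo the ideal generated by \<open>G\<close>, in the weak sense: \<open>s\<close> is not a zero
  divisor on the quotient, which may be zero.\<close>

definition nzd :: "'r::comm_ring_1 \<Rightarrow> 'r set \<Rightarrow> bool" where
  "nzd s G \<longleftrightarrow> (\<forall>q. s * q \<in> ideal_gen G \<longrightarrow> q \<in> ideal_gen G)"

lemma nzdD: "nzd s G \<Longrightarrow> s * q \<in> ideal_gen G \<Longrightarrow> q \<in> ideal_gen G"
  by (simp add: nzd_def)

lemma nzd_cong:
  assumes "nzd s G" "s' - s \<in> ideal_gen G"
  shows "nzd s' G"
  unfolding nzd_def
proof safe
  fix q
  assume "s' * q \<in> ideal_gen G"
  from this ideal_gen_mult_right[OF assms(2)] have "s' * q - (s' - s) * q \<in> ideal_gen G"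
    by (rule ideal_gen_diff)
  then have "s * q \<in> ideal_gen G"
    by (simp add: left_diff_distrib)
  then show "q \<in> ideal_gen G"
    by (rule nzdD[OF assms(1)])
qed

lemma nzd_one: "nzd 1 G"
  by (simp add: nzd_def)

lemma nzd_mult: "nzd a G \<Longrightarrow> nzd b G \<Longrightarrow> nzd (a * b) G"
  unfolding nzd_def mult.assoc by blast

lemma nzd_power: "nzd a G \<Longrightarrow> nzd (a ^ k) G"
  by (induction k) (simp_all add: nzd_one nzd_mult)

lemma nzd_prod: "(\<And>x. x \<in> A \<Longrightarrow> nzd (f x) G) \<Longrightarrow> nzd (prod f A) G"
  by (induction A rule: infinite_finite_induct) (simp_all add: nzd_one nzd_mult)

lemma nzd_of_mult: "nzd (a * b) G \<Longrightarrow> nzd b G"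
  unfolding nzd_def mult.assoc by (intro allI impI) (erule allE, erule mp, erule ideal_gen_mult_left)

lemma nzd_dvd_one:
  assumes "a dvd 1"
  shows "nzd a G"
proof -
  obtain b where "1 = a * b"
    using assms by (elim dvdE)
  then have "nzd (b * a) G"
    by (simp add: mult.commute nzd_one)
  then show ?thesis
    by (rule nzd_of_mult)
qed

lemma nzd_uminus: "nzd a G \<Longrightarrow> nzd (- a) G"
  using nzd_of_mult[of "- 1" "- a" G] by simp

text \<open>Exchanging two members of a regular sequence. If \<open>v q = c a\<close> modulo \<open>G\<close>, then regularity
  of \<open>a\<close> modulo \<open>v\<close> gives \<open>c = k v\<close>, and cancelling \<open>v\<close> gives \<open>q = k a\<close>.\<close>

lemma nzd_swap:
  assumes v: "nzd v G" and a: "nzd a (insert v G)"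
  shows "nzd v (insert a G)"
  unfolding nzd_def
proof safe
  fix q
  assume "v * q \<in> ideal_gen (insert a G)"
  then obtain c where c: "v * q - c * a \<in> ideal_gen G"
    by (rule ideal_gen_insertE)
  have "a * c - q * v = - 1 * (v * q - c * a)"
    by (simp add: algebra_simps)
  also have "\<dots> \<in> ideal_gen G"
    by (rule ideal_gen_mult_left[OF c])
  finally have "a * c \<in> ideal_gen (insert v G)"
    by (rule ideal_gen_insertI)
  then have "c \<in> ideal_gen (insert v G)"
    by (rule nzdD[OF a])
  then obtain k where k: "c - k * v \<in> ideal_gen G"
    by (rule ideal_gen_insertE)
  have "v * (q - k * a) = (v * q - c * a) + (c - k * v) * a"
    by (simp add: algebra_simps)
  also have "\<dots> \<in> ideal_gen G"
    using c ideal_gen_mult_right[OF k] by (rule ideal_gen_add)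
  finally have "v * (q - k * a) \<in> ideal_gen G" .
  then have "q - k * a \<in> ideal_gen G"
    by (rule nzdD[OF v])
  then show "q \<in> ideal_gen (insert a G)"
    by (rule ideal_gen_insertI)
qed

text \<open>An ideal with generators that do not involve \<open>t\<close> is homogeneous for the degree in \<open>t\<close>.\<close>

lemma ideal_gen_coeff:
  assumes free: "\<And>g. g \<in> G \<Longrightarrow> free_of t g" and q: "q \<in> ideal_gen G"
  shows "coeff (in_var t q) k \<in> ideal_gen G"
  using q unfolding ideal_gen_def
proof (induction arbitrary: k rule: idl.span_induct_alt)
  case base
  then show ?case
    by (simp add: idl.span_zero)
next
  case (step c x y)
  have "in_var t (c * x) = smult x (in_var t c)"
    using free[OF step(1)] by (simp add: free_of_def mult.commute)
  then have "coeff (in_var t (c * x + y)) k = coeff (in_var t c) k * x + coeff (in_var t y) k"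
    by (simp del: ring_map_mult[OF ring_map_in_var] add: mult.commute)
  then show ?case
    by (simp add: step idl.span_add idl.span_scale idl.span_base
        del: ring_map_simps[OF ring_map_in_var])
qed

text \<open>Multiplication by \<open>a t\<^sup>e - b\<close> sends the coefficients \<open>q\<^sub>k\<close> of \<open>q\<close> to
  \<open>a q\<^sub>k - b q\<^bsub>k+e\<^esub>\<close> in degree \<open>k + e\<close>. If all of these lie in the ideal, then so do the \<open>q\<^sub>k\<close>, by
  descending induction on \<open>k\<close>, which starts above the degree of \<open>q\<close>.\<close>

lemma nzd_monic_in_var:
  assumes free: "\<And>g. g \<in> G \<Longrightarrow> free_of t g" "free_of t a" "free_of t b"
    and a: "nzd a G" and e: "e > 0"
  shows "nzd (a * Var t ^ e - b) G"
  unfolding nzd_def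
proof safe
  fix q
  assume "(a * Var t ^ e - b) * q \<in> ideal_gen G"
  note coeffs = ideal_gen_coeff[OF free(1) this]
  let ?p = "in_var t q"
  have "in_var t (a * Var t ^ e - b) = monom a e - [:b:]"
    using free(2,3) by (simp add: free_of_def in_var_Var monom_power smult_monom)
  then have "in_var t ((a * Var t ^ e - b) * q) = monom a e * ?p - smult b ?p"
    unfolding ring_map_mult[OF ring_map_in_var] by (simp add: left_diff_distrib)
  then have step: "a * coeff ?p k - b * coeff ?p (k + e) \<in> ideal_gen G" for k
    using coeffs[of "k + e"] by (simp add: coeff_monom_mult)
  have "coeff ?p k \<in> ideal_gen G" for k
  proof (induction "Polynomial.degree ?p + 1 - k" arbitrary: k rule: less_induct)
    case less
    have "coeff ?p (k + e) \<in> ideal_gen G"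
    proof (cases "k > Polynomial.degree ?p")
      case True
      then show ?thesis
        by (simp add: coeff_eq_0 ideal_gen_zero)
    qed (use less e in auto)
    from ideal_gen_add[OF step ideal_gen_mult_left[OF this], of k b] show ?case
      using nzdD[OF a] by simp
  qed
  then have "poly ?p (Var t) \<in> ideal_gen G"
    unfolding poly_altdef by (intro ideal_gen_sum ideal_gen_mult_right)
  then show "q \<in> ideal_gen G"
    by (simp add: poly_in_var)
qed

lemma nzd_Var:
  assumes "\<And>g. g \<in> G \<Longrightarrow> free_of t g"
  shows "nzd (Var t) G"
  using nzd_monic_in_var[of G t 1 0 1] assms by (simp add: nzd_one)

lemma Const_dvd_one: "c \<noteq> 0 \<Longrightarrow> Const c dvd (1 :: ('i, 'k::field) mpoly)"
  by (rule dvdI[of _ _ "Const (inverse c)"])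
    (simp flip: ring_map_mult[OF ring_map_Const] add: ring_map_one[OF ring_map_Const])

lemma nzd_Const: "c \<noteq> 0 \<Longrightarrow> nzd (Const c) (G :: ('i, 'k::field) mpoly set)"
  by (intro nzd_dvd_one Const_dvd_one)

section \<open>Partial derivatives and derivations\<close>

lemma partial_deriv_superset:
  assumes "finite A" "Poly_Mapping.keys p \<subseteq> A"
  shows "partial_deriv i p = (\<Sum>\<mu>\<in>A. Poly_Mapping.single (\<mu> - Poly_Mapping.single i 1)
          (of_nat (Poly_Mapping.lookup \<mu> i) * Poly_Mapping.lookup p \<mu>))"
  unfolding partial_deriv_def
  by (rule sum.mono_neutral_left) (use assms in \<open>auto simp: in_keys_iff\<close>)

lemma partial_deriv_single:
  "partial_deriv i (Poly_Mapping.single \<mu> c) =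
     Poly_Mapping.single (\<mu> - Poly_Mapping.single i 1) (of_nat (Poly_Mapping.lookup \<mu> i) * c)"
  by (simp add: partial_deriv_superset[where A = "{\<mu>}"])

lemma partial_deriv_add: "partial_deriv i (p + q) = partial_deriv i p + partial_deriv i q"
proof -
  let ?A = "Poly_Mapping.keys p \<union> Poly_Mapping.keys q"
  have "Poly_Mapping.keys (p + q) \<subseteq> ?A"
    by (rule keys_add)
  then show ?thesis
    by (simp add: partial_deriv_superset[where A = ?A] lookup_add algebra_simps single_add
        sum.distrib)
qed

lemma partial_deriv_sum: "partial_deriv i (sum f A) = (\<Sum>x\<in>A. partial_deriv i (f x))"
proof -
  have "partial_deriv i 0 = 0"
    by (simp add: partial_deriv_def)
  then show ?thesis
    by (induction A rule: infinite_finite_induct) (simp_all add: partial_deriv_add)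
qed

text \<open>The truncated subtraction of exponents is harmless: where it truncates, the coefficient is
  zero.\<close>

lemma partial_deriv_mult_single:
  fixes a b :: "'a::comm_ring_1" and i :: 'i
  defines "s \<equiv> Poly_Mapping.single"
  shows "partial_deriv i (s \<mu> a * s \<nu> b) =
    s \<mu> a * partial_deriv i (s \<nu> b) + s \<nu> b * partial_deriv i (s \<mu> a)"
proof -
  have shift: "s (\<mu> + (\<nu> - Poly_Mapping.single i 1)) (of_nat (Poly_Mapping.lookup \<nu> i) * c) =
      s (\<mu> + \<nu> - Poly_Mapping.single i 1) (of_nat (Poly_Mapping.lookup \<nu> i) * c)"
    for \<mu> \<nu> :: "'i \<Rightarrow>\<^sub>0 nat" and c :: 'a
  proof (cases "Poly_Mapping.lookup \<nu> i = 0")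
    case False
    then have "\<mu> + (\<nu> - Poly_Mapping.single i 1) = \<mu> + \<nu> - Poly_Mapping.single i 1"
      by (intro poly_mapping_eqI) (auto simp: lookup_add lookup_minus lookup_single when_def)
    then show ?thesis
      by simp
  qed (simp add: s_def)
  show ?thesis
    using shift[of \<mu> \<nu> "a * b"] shift[of \<nu> \<mu> "a * b"]
    by (simp add: s_def mult_single partial_deriv_single lookup_add algebra_simps flip: single_add)
qed

lemma partial_deriv_mult: "partial_deriv i (p * q) = p * partial_deriv i q + q * partial_deriv i p"
proof -
  let ?s = "\<lambda>p \<mu>. Poly_Mapping.single \<mu> (Poly_Mapping.lookup p \<mu>)"
  let ?p = "\<Sum>\<mu>\<in>Poly_Mapping.keys p. ?s p \<mu>" and ?q = "\<Sum>\<nu>\<in>Poly_Mapping.keys q. ?s q \<nu>"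
  have "partial_deriv i (?p * ?q) = ?p * partial_deriv i ?q + ?q * partial_deriv i ?p"
    unfolding sum_product partial_deriv_sum partial_deriv_mult_single sum.distrib
    by (subst (4) sum.swap) simp
  then show ?thesis
    by (simp flip: mpoly_eq_sum_single)
qed

lemma partial_deriv_Const [simp]: "partial_deriv i (Const c) = 0"
  by (simp add: Const_def partial_deriv_single)

lemma partial_deriv_Var: "partial_deriv i (Var j) = (if i = j then 1 else 0)"
  by (auto simp: Var_def partial_deriv_single lookup_single)

lemma partial_deriv_in_derivations: "partial_deriv i \<in> derivations"
  by (simp add: derivations_def partial_deriv_add partial_deriv_mult)

context
  fixes \<theta> :: "('i, 'a::comm_ring_1) mpoly \<Rightarrow> ('i, 'a) mpoly"
  assumes \<theta>: "\<theta> \<in> derivations"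
begin

lemma der_add: "\<theta> (p + q) = \<theta> p + \<theta> q"
  and der_mult: "\<theta> (p * q) = p * \<theta> q + q * \<theta> p"
  and der_Const_mult: "\<theta> (Const c * p) = Const c * \<theta> p"
  using \<theta> by (auto simp: derivations_def)

lemma der_Const: "\<theta> (Const c) = 0"
  using der_Const_mult[of c 1] der_mult[of 1 1] by simp

lemma der_one: "\<theta> 1 = 0"
  using der_mult[of 1 1] by simp

lemma der_diff: "\<theta> (p - q) = \<theta> p - \<theta> q"
  using der_add[of "p - q" q] by simp

lemma der_power: "\<theta> (p ^ k) = of_nat k * p ^ (k - 1) * \<theta> p"
proof (induction k)
  case (Suc k)
  then show ?case
    by (cases k) (simp_all add: der_mult algebra_simps)
qed (simp add: der_one)

end

lemma derivations_eqI:
  assumes "\<theta> \<in> derivations" "\<eta> \<in> derivations" "\<And>i. \<theta> (Var i) = \<eta> (Var i)"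
  shows "\<theta> = \<eta>"
proof
  fix p
  show "\<theta> p = \<eta> p"
    by (induction p rule: mpoly_induct)
      (simp_all add: assms der_add der_mult der_Const)
qed

lemma sum_apply: "sum f A x = (\<Sum>i\<in>A. f i x)" for f :: "'i \<Rightarrow> 'a \<Rightarrow> 'b::comm_monoid_add"
  by (induction A rule: infinite_finite_induct) simp_all

interpretation der: module der_scale
  by (rule module_der_scale)

lemma subspace_derivations: "der.subspace derivations"
  unfolding der.subspace_def derivations_def by (auto simp: der_scale_def algebra_simps)

text \<open>The derivation with prescribed values \<open>a i\<close> on the indeterminates.\<close>

definition vector_field :: "('i::finite \<Rightarrow> ('i, 'a::comm_ring_1) mpoly) \<Rightarrow> ('i, 'a) mpoly \<Rightarrow> ('i, 'a) mpoly"
  where "vector_field a = (\<lambda>p. \<Sum>i\<in>UNIV. a i * partial_deriv i p)"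

lemma vector_field_in_derivations: "vector_field a \<in> derivations"
proof -
  have "vector_field a = (\<Sum>i\<in>UNIV. der_scale (a i) (partial_deriv i))"
    by (rule ext) (simp add: vector_field_def der_scale_def sum_apply)
  also have "\<dots> \<in> derivations"
    by (intro der.subspace_sum der.subspace_scale subspace_derivations
        partial_deriv_in_derivations)
  finally show ?thesis .
qed

lemma vector_field_Var: "vector_field a (Var i) = a i"
  by (simp add: vector_field_def partial_deriv_Var if_distrib cong: if_cong)

section \<open>The symmetric algebra as a complete intersection\<close>

lemma of_nat_conv_Const: "(of_nat k :: ('i, 'a::comm_ring_1) mpoly) = Const (of_nat k)"
  by (simp add: Const_def)

lemma free_of_of_nat [simp]: "free_of t (of_nat k)"
  by (simp add: of_nat_conv_Const)

lemma nzd_of_nat: "k \<noteq> 0 \<Longrightarrow> nzd (of_nat k) (G :: ('i, 'k::field_char_0) mpoly set)"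
  by (simp add: of_nat_conv_Const nzd_Const)

text \<open>The index \<open>m\<close> may have exponent zero; in that case the hypersurface does not involve the
  indeterminate \<open>m\<close> at all.\<close>

locale toric_data =
  fixes z m :: "'n::{finite,linorder}" and S :: "'n set" and s :: "'n \<Rightarrow> nat" and d :: nat
  assumes notin: "z \<notin> S" "m \<notin> S" "z \<noteq> m" and cover: "UNIV = insert z (insert m S)"
    and s_z: "s z = 0" and sum_s: "sum s UNIV = d" and d_pos: "d > 0"
begin

lemma S_simps [simp]: "i \<in> S \<Longrightarrow> i \<noteq> z" "i \<in> S \<Longrightarrow> i \<noteq> m"
  "i \<in> S \<Longrightarrow> z \<noteq> i" "i \<in> S \<Longrightarrow> m \<noteq> i" "z \<noteq> m" "m \<noteq> z"
  using notin by auto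

lemma finite_S [simp]: "finite S"
  by (rule finite)

definition toric_mon :: "('n \<Rightarrow> 'b::comm_ring_1) \<Rightarrow> 'b" where
  "toric_mon w = (\<Prod>j\<in>UNIV. w j ^ s j)"

text \<open>For exponent zero the indeterminate \<open>m\<close> is replaced by \<open>1\<close>, so that \<open>pivot\<close> always
  divides the monomial. The case distinction on the exponent of \<open>m\<close> is thereby hidden from
  the linear equations of the gradient ideal. These definitions and the following ones take
  the values \<open>w\<close> of the indeterminates as a parameter, because they are used in several rings.\<close>

definition pivot :: "('n \<Rightarrow> 'b::comm_ring_1) \<Rightarrow> 'b" where
  "pivot w = (if s m = 0 then 1 else w m)"

definition cofactor :: "('n \<Rightarrow> 'b::comm_ring_1) \<Rightarrow> 'b" where
  "cofactor w = (\<Prod>j\<in>S. w j ^ s j) * w m ^ (s m - 1)"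

lemma mon_conv: "toric_mon w = (\<Prod>j\<in>S. w j ^ s j) * w m ^ s m"
  unfolding toric_mon_def cover by (simp add: notin s_z mult.commute)

lemma pivot_cofactor: "pivot w * cofactor w = toric_mon w"
  unfolding mon_conv by (cases "s m") (simp_all add: pivot_def cofactor_def mult_ac)

text \<open>The two families of linear equations between the generators of the gradient ideal:
  \<open>line\<close> comes from the diagonal derivations, and \<open>cross\<close> is the obvious equation between
  the two multiples \<open>h N\<close> and \<open>h z\<^sup>d\<^sup>-\<^sup>1\<close> of \<open>h\<close>.\<close>

definition line :: "('n \<Rightarrow> 'b::comm_ring_1) \<Rightarrow> ('n \<Rightarrow> 'b) \<Rightarrow> 'n \<Rightarrow> 'b" where
  "line w y j = w j * y j - (of_nat (s j + 1) * pivot w * y m - w z * y z)"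

definition cross :: "('n \<Rightarrow> 'b::comm_ring_1) \<Rightarrow> ('n \<Rightarrow> 'b) \<Rightarrow> 'b" where
  "cross w y = w z ^ (d - 1) * y m - cofactor w * y z"

text \<open>The ambient ring has an indeterminate \<open>X i\<close> for each coordinate and an indeterminate
  \<open>Y i\<close> for each generator of the gradient ideal.\<close>

abbreviation X :: "'n \<Rightarrow> ('n + 'n, 'k::field_char_0) mpoly" where
  "X i \<equiv> Var (Inl i)"

abbreviation Y :: "'n \<Rightarrow> ('n + 'n, 'k::field_char_0) mpoly" where
  "Y i \<equiv> Var (Inr i)"

abbreviation L :: "'n \<Rightarrow> ('n + 'n, 'k::field_char_0) mpoly" where
  "L \<equiv> line X Y"

lemma free_of_X_prod: "i \<in> S \<Longrightarrow> s i = 0 \<Longrightarrow> free_of (Inl i) (\<Prod>j\<in>S. X j ^ s j)"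
  by (rule free_of_prod) (metis free_of_simps(3,4,9) power_0 sum.inject(1))

lemma free_of_cofactor [simp]:
  "free_of (Inr i) (cofactor X)"
  "i \<in> S \<Longrightarrow> s i = 0 \<Longrightarrow> free_of (Inl i) (cofactor X)"
  unfolding cofactor_def
  by (auto intro!: free_of_simps(7,9) free_of_prod)[1] (simp add: free_of_X_prod)

lemma free_of_pivot [simp]: "i \<noteq> m \<Longrightarrow> free_of (Inl i) (pivot X)" "free_of (Inr i) (pivot X)"
  by (simp_all add: pivot_def)

lemma free_of_mon [simp]: "free_of (Inr i) (toric_mon X)" "free_of (Inl z) (toric_mon X)"
  unfolding mon_conv by (auto intro!: free_of_simps(7,9) free_of_prod)

lemma free_of_relations [simp]:
  "i \<in> S \<Longrightarrow> i \<noteq> j \<Longrightarrow> free_of (Inl i) (L j)"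
  "i \<in> S \<Longrightarrow> i \<noteq> j \<Longrightarrow> free_of (Inr i) (L j)"
  "i \<in> S \<Longrightarrow> s i = 0 \<Longrightarrow> free_of (Inl i) (cross X Y)"
  "i \<in> S \<Longrightarrow> free_of (Inr i) (cross X Y)"
  by (simp_all add: line_def cross_def)

text \<open>The equation \<open>L i\<close> is linear in \<open>Y i\<close> with coefficient \<open>X i\<close>. Since neither occurs in \<open>u\<close>,
  \<open>G\<close> or the other lines, \<open>L i\<close> is regular modulo \<open>u\<close> and all of these, and the exchange lemma
  lets \<open>u\<close> pass over it.\<close>

lemma nzd_union_lines:
  assumes "nzd u G" "T \<subseteq> S"
    and "\<And>i g. i \<in> T \<Longrightarrow> g \<in> insert u G \<Longrightarrow> free_of (Inl i) g \<and> free_of (Inr i) g"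
  shows "nzd u (G \<union> L ` T)"
proof -
  have "finite T"
    by simp
  then show ?thesis
    using assms(2,3)
  proof (induction T rule: finite_induct)
    case empty
    then show ?case
      using assms(1) by simp
  next
    case (insert i T)
    have IH: "nzd u (G \<union> L ` T)"
      using insert by auto
    have free: "free_of (Inl i) g \<and> free_of (Inr i) g" if "g \<in> insert u (G \<union> L ` T)" for g
      using that insert.prems insert.hyps by (auto intro!: free_of_relations(1,2))
    have "nzd (X i * Y i ^ 1 - (of_nat (s i + 1) * pivot X * Y m - X z * Y z))
        (insert u (G \<union> L ` T))"
      using insert.prems(1) free by (intro nzd_monic_in_var nzd_Var) (auto intro!: free_of_simps(5-7))
    then have "nzd (L i) (insert u (G \<union> L ` T))"
      by (simp add: line_def)
    then show ?case
      using nzd_swap[OF IH] by simp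
  qed
qed

lemma nzd_pivot: "(\<And>h. h \<in> H \<Longrightarrow> free_of (Inl m) h) \<Longrightarrow> nzd (pivot X) H"
  by (simp add: pivot_def nzd_one nzd_Var)

text \<open>Modulo \<open>X j\<close> the equation \<open>L j\<close> becomes a relation between \<open>Y m\<close> and \<open>Y z\<close> alone, to
  which one of the two following lemmas applies, depending on which of these is absent
  from \<open>H\<close>.\<close>

lemma L_cong:
  assumes "X j \<in> H" "nzd (of_nat (s j + 1) * pivot X * Y m - X z * Y z) H"
  shows "nzd (L j) H"
proof (rule nzd_cong[OF nzd_uminus[OF assms(2)]])
  have "X j * Y j \<in> ideal_gen H"
    by (intro ideal_gen_mult_right ideal_gen_base assms)
  then show "L j - - (of_nat (s j + 1) * pivot X * Y m - X z * Y z) \<in> ideal_gen H"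
    by (simp add: line_def)
qed

lemma nzd_L_pivot:
  assumes "X j \<in> H" "nzd (pivot X) H" "\<And>h. h \<in> H \<Longrightarrow> free_of (Inr m) h"
  shows "nzd (L j) H"
proof (rule L_cong[OF assms(1)])
  have "nzd (of_nat (s j + 1) * pivot X * Y m ^ 1 - X z * Y z) H"
    by (rule nzd_monic_in_var)
      (use assms in \<open>auto intro!: free_of_simps(5-9) nzd_mult nzd_of_nat simp del: of_nat_Suc\<close>)
  then show "nzd (of_nat (s j + 1) * pivot X * Y m - X z * Y z) H"
    by simp
qed

lemma nzd_L_last:
  assumes "X j \<in> H" "\<And>h. h \<in> H \<Longrightarrow> free_of (Inl z) h \<and> free_of (Inr z) h"
  shows "nzd (L j) H"
proof (rule L_cong[OF assms(1)])
  have "nzd (X z * Y z ^ 1 - of_nat (s j + 1) * pivot X * Y m) H"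
    by (rule nzd_monic_in_var) (use assms in \<open>auto intro!: free_of_simps(5-9) nzd_Var\<close>)
  from nzd_uminus[OF this] show "nzd (of_nat (s j + 1) * pivot X * Y m - X z * Y z) H"
    by simp
qed

lemma nzd_power_minus_mon:
  assumes "\<And>h. h \<in> H \<Longrightarrow> free_of (Inl z) h"
  shows "nzd (X z ^ d - toric_mon X) H"
  using nzd_monic_in_var[of H "Inl z" 1 "toric_mon X" d] assms d_pos by (simp add: nzd_one)

lemma insert_Un_image_remove: "j \<in> A \<Longrightarrow> insert (f j) B \<union> f ` (A - {j}) = B \<union> f ` A"
  by auto

lemma nzd_X_lines:
  assumes "j \<in> S"
  shows "nzd (X j) (L ` S)"
proof -
  have "nzd (X j) {L j}"
    by (rule nzd_swap[OF nzd_Var nzd_L_pivot[OF _ nzd_pivot]]) (use assms in auto)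
  then have "nzd (X j) ({L j} \<union> L ` (S - {j}))"
    by (rule nzd_union_lines) (use assms in auto)
  then show ?thesis
    by (simp only: insert_Un_image_remove[OF assms] Un_empty_left)
qed

lemma nzd_Xz_lines: "nzd (X z) (L ` S)"
proof -
  have "nzd (X z) ({} \<union> L ` S)"
    by (intro nzd_union_lines nzd_Var) auto
  then show ?thesis
    by simp
qed

lemma nzd_cofactor_lines:
  "nzd (cofactor X * Y z :: ('n + 'n, 'k::field_char_0) mpoly) (insert (X z) (L ` S))"
proof -
  have var: "nzd u (insert (X z) (L ` S))" if "u = X m \<or> u = Y z"
    for u :: "('n + 'n, 'k) mpoly"
  proof -
    have "nzd u {X z}"
      using that by (auto intro!: nzd_Var)
    then have "nzd u ({X z} \<union> L ` S)"
      by (rule nzd_union_lines) (use that in auto)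
    then show ?thesis
      by simp
  qed
  have "nzd (X j) (insert (X z) (L ` S))" if j: "j \<in> S" for j
  proof -
    have "nzd (X j) (insert (L j) {X z})"
      by (rule nzd_swap[OF nzd_Var nzd_L_pivot[OF _ nzd_pivot]]) (use j in auto)
    then have "nzd (X j) (insert (L j) {X z} \<union> L ` (S - {j}))"
      by (rule nzd_union_lines) (use j in auto)
    then show ?thesis
      by (simp only: insert_Un_image_remove[OF j]) simp
  qed
  then show ?thesis
    unfolding cofactor_def by (intro nzd_mult nzd_prod nzd_power) (simp_all add: var)
qed

text \<open>Adjoining the coordinates in \<open>A\<close> and one line \<open>L j\<close> with \<open>j \<in> A\<close> keeps the leading term
  \<open>z\<^sup>d\<^sup>-\<^sup>1 Y\<^sub>m\<close> of the crossing equation regular: modulo either factor, \<open>L j\<close> is a monomial up to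
  a unit, and it is regular. The index set \<open>A\<close> is needed with one element and with two.\<close>

lemma nzd_leading_lines:
  assumes "j \<in> A" "A \<subseteq> S" "T \<subseteq> S - A"
  shows "nzd (X z ^ (d - 1) * Y m :: ('n + 'n, 'k::field_char_0) mpoly)
    (insert (L j) (X ` A) \<union> L ` T)"
proof -
  have "nzd u (insert (L j) (X ` A) \<union> L ` T)" if u: "u = X z \<or> u = Y m"
    for u :: "('n + 'n, 'k) mpoly"
  proof (rule nzd_union_lines)
    have "nzd (L j) (insert u (X ` A))"
      using u
    proof
      assume "u = X z"
      then show ?thesis
        by (intro nzd_L_pivot[OF _ nzd_pivot]) (use assms notin in auto)
    next
      assume "u = Y m"
      then show ?thesis
        by (intro nzd_L_last) (use assms notin in auto)
    qed
    moreover have "nzd u (X ` A)"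
      using u assms notin by (force intro: nzd_Var)
    ultimately show "nzd u (insert (L j) (X ` A))"
      by (rule nzd_swap[rotated])
  qed (use assms u in \<open>auto intro!: free_of_relations(1,2)\<close>)
  then show ?thesis
    by (intro nzd_mult nzd_power) simp_all
qed

text \<open>If \<open>X i\<close> divides the cofactor, the crossing equation reduces to its leading term modulo
  \<open>X i\<close>.\<close>

lemma nzd_cross_of_leading:
  fixes H :: "('n + 'n, 'k::field_char_0) mpoly set"
  assumes "nzd (X z ^ (d - 1) * Y m) H" "X i \<in> H" "i \<in> S" "s i > 0"
  shows "nzd (cross X Y) H"
proof (rule nzd_cong[OF assms(1)])
  have "X i dvd (\<Prod>j\<in>S. X j ^ s j :: ('n + 'n, 'k) mpoly)"
    using assms(3,4) by (meson dvd_power dvd_prodI dvd_trans finite_S)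
  then have "X i dvd (cross X Y - X z ^ (d - 1) * Y m :: ('n + 'n, 'k) mpoly)"
    by (simp add: cross_def cofactor_def)
  then have "(cross X Y - X z ^ (d - 1) * Y m :: ('n + 'n, 'k) mpoly) \<in> ideal_gen {X i}"
    by (simp add: ideal_gen_singleton)
  then show "(cross X Y - X z ^ (d - 1) * Y m) \<in> ideal_gen H"
    using ideal_gen_mono[of "{X i}" H] assms(2) by auto
qed

text \<open>If the coordinate \<open>j\<close> does not occur in the monomial \<open>M\<close>, then modulo \<open>L j\<close> and \<open>X j\<close> the two
  equations say \<open>\<xi> Y\<^sub>m = z Y\<^sub>z\<close> and \<open>z\<^sup>d\<^sup>-\<^sup>1 Y\<^sub>m = N Y\<^sub>z\<close>. Eliminating \<open>Y\<^sub>m\<close> turns \<open>\<xi>\<close> times the crossing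
  equation into \<open>(z\<^sup>d - M) Y\<^sub>z\<close>, whose factors are visibly regular.\<close>

lemma nzd_cross_base:
  assumes j: "j \<in> S" "s j = 0"
  shows "nzd (cross X Y) (insert (L j) {X j} :: ('n + 'n, 'k::field_char_0) mpoly set)"
proof (rule nzd_of_mult, rule nzd_cong)
  let ?H = "insert (L j) {X j} :: ('n + 'n, 'k) mpoly set"
  have "nzd (pivot X) {X z ^ d - toric_mon X, X j :: ('n + 'n, 'k) mpoly}"
    unfolding pivot_def using j by (auto simp: nzd_one intro!: nzd_swap[OF nzd_Var nzd_power_minus_mon])
  then have "nzd (X z ^ d - toric_mon X) ?H"
    by (intro nzd_swap[OF nzd_power_minus_mon nzd_L_pivot]) (use j in \<open>auto intro!: free_of_simps(5-9)\<close>)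
  moreover have "nzd (Y z) ?H"
    by (rule nzd_swap[OF nzd_Var nzd_L_pivot[OF _ nzd_pivot]]) (use j in auto)
  ultimately show "nzd ((X z ^ d - toric_mon X) * Y z) ?H"
    by (rule nzd_mult)
  obtain e where d: "d = Suc e"
    using d_pos by (cases d) auto
  have "pivot X * cross X Y - (X z ^ d - toric_mon X) * Y z
      = X z ^ (d - 1) * (X j * Y j - L j)"
    unfolding cross_def line_def pivot_cofactor[symmetric] by (simp add: d j algebra_simps)
  also have "\<dots> \<in> ideal_gen ?H"
    by (intro ideal_gen_mult_left ideal_gen_diff ideal_gen_mult_right ideal_gen_base) auto
  finally show "pivot X * cross X Y - (X z ^ d - toric_mon X) * Y z \<in> ideal_gen ?H" .
qed

text \<open>If the coordinate \<open>j\<close> occurs in \<open>M\<close>, reduce to the leading term. Otherwise start from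
  \<open>nzd_cross_base\<close> and adjoin the other lines one at a time; a line \<open>L i\<close> whose coordinate
  occurs in \<open>M\<close>, and hence in the crossing equation, requires that \<open>X i\<close> be regular modulo that
  equation, which follows by exchange from the reduction to the leading term modulo \<open>X i\<close>.\<close>

lemma nzd_cross_lines:
  assumes j: "j \<in> S"
  shows "nzd (cross X Y :: ('n + 'n, 'k::field_char_0) mpoly) (insert (X j) (L ` S))"
proof -
  have "nzd (cross X Y :: ('n + 'n, 'k) mpoly) (insert (L j) {X j} \<union> L ` T)" if "T \<subseteq> S - {j}" for T
  proof (cases "s j = 0")
    case False
    then show ?thesis
      using nzd_leading_lines[of j "{j}" T] j that
      by (intro nzd_cross_of_leading[of _ j]) auto
  next
    case True
    have "finite T"
      by simp
    then show ?thesis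
      using that
    proof (induction T rule: finite_induct)
      case empty
      then show ?case
        using nzd_cross_base[OF j True] by simp
    next
      case (insert i T)
      let ?G = "insert (L j) {X j} \<union> L ` T :: ('n + 'n, 'k) mpoly set"
      have IH: "nzd (cross X Y) ?G"
        using insert by auto
      have G: "free_of (Inl i) g \<and> free_of (Inr i) g" if "g \<in> ?G" for g
        using that insert by (auto intro!: free_of_relations(1,2))
      have "nzd (X i) (insert (cross X Y) ?G)"
      proof (cases "s i = 0")
        case True
        then show ?thesis
          using G insert by (intro nzd_Var) auto
      next
        case False
        have "T \<subseteq> S - {i, j}"
          using insert by auto
        then have "nzd (X z ^ (d - 1) * Y m) (insert (L j) (X ` {i, j}) \<union> L ` T)"
          using insert j by (intro nzd_leading_lines) auto
        then have "nzd (X z ^ (d - 1) * Y m) (insert (X i) ?G)"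
          by (simp add: insert_commute)
        then have "nzd (cross X Y) (insert (X i) ?G)"
          by (rule nzd_cross_of_leading[of _ i]) (use False insert in auto)
        moreover have "nzd (X i) ?G"
          using G by (intro nzd_Var) auto
        ultimately show ?thesis
          by (rule nzd_swap[rotated])
      qed
      then have "nzd (X i * Y i ^ 1 - (of_nat (s i + 1) * pivot X * Y m - X z * Y z))
          (insert (cross X Y) ?G)"
        using insert.prems G by (intro nzd_monic_in_var) (auto intro!: free_of_simps(5-7))
      then have "nzd (L i) (insert (cross X Y) ?G)"
        by (simp add: line_def)
      from nzd_swap[OF IH this] show ?case
        by (simp add: insert_commute)
    qed
  qed
  from this[OF subset_refl] show ?thesis
    by (simp only: insert_Un_image_remove[OF j]) simp
qed

abbreviation relations :: "('n + 'n, 'k::field_char_0) mpoly set" where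
  "relations \<equiv> insert (cross X Y) (L ` S)"

lemma nzd_X_relations: "j \<in> S \<Longrightarrow> nzd (X j) relations"
  by (rule nzd_swap[OF nzd_X_lines nzd_cross_lines])

text \<open>For \<open>d \<ge> 2\<close> the crossing equation reduces to \<open>- N Y\<^sub>z\<close> modulo \<open>X z\<close>. For \<open>d = 1\<close> this fails, but
  the power is \<open>1\<close>.\<close>

lemma nzd_Xz_relations: "nzd (X z ^ (d - 1) :: ('n + 'n, 'k::field_char_0) mpoly) relations"
proof (cases "d = 1")
  case False
  then obtain e where e: "d - Suc 0 = Suc e"
    using d_pos by (cases "d - 1") auto
  have "nzd (cross X Y :: ('n + 'n, 'k) mpoly) (insert (X z) (L ` S))"
  proof (rule nzd_cong[OF nzd_uminus[OF nzd_cofactor_lines]])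
    have "X z * (X z ^ e * Y m) \<in> (ideal_gen (insert (X z) (L ` S)) :: ('n + 'n, 'k) mpoly set)"
      by (intro ideal_gen_mult_right ideal_gen_base) auto
    then show "(cross X Y :: ('n + 'n, 'k) mpoly) - - (cofactor X * Y z) \<in> ideal_gen (insert (X z) (L ` S))"
      by (simp add: cross_def e mult.assoc)
  qed
  then show ?thesis
    by (intro nzd_power nzd_swap[OF nzd_Xz_lines])
qed (simp add: nzd_one)

end

section \<open>Symmetric algebras and Rees algebras\<close>

lemma ring_on_simps [simp]:
  "carrier (ring_on C) = C" "x \<otimes>\<^bsub>ring_on C\<^esub> y = x * y" "x \<oplus>\<^bsub>ring_on C\<^esub> y = x + y"
  "\<one>\<^bsub>ring_on C\<^esub> = 1" "\<zero>\<^bsub>ring_on C\<^esub> = 0"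
  by (simp_all add: ring_on_def)

lemma cring_ring_on:
  fixes C :: "'a::comm_ring_1 set"
  assumes "1 \<in> C" "\<And>x y. x \<in> C \<Longrightarrow> y \<in> C \<Longrightarrow> x + y \<in> C"
    and "\<And>x y. x \<in> C \<Longrightarrow> y \<in> C \<Longrightarrow> x * y \<in> C" "\<And>x. x \<in> C \<Longrightarrow> - x \<in> C"
  shows "cring (ring_on C)"
proof (rule cringI)
  have zero: "0 \<in> C"
    using assms(2)[OF assms(1) assms(4)[OF assms(1)]] by simp
  show "abelian_group (ring_on C)"
  proof (rule abelian_groupI)
    show "\<exists>y\<in>carrier (ring_on C). y \<oplus>\<^bsub>ring_on C\<^esub> x = \<zero>\<^bsub>ring_on C\<^esub>"
      if "x \<in> carrier (ring_on C)" for x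
      using that assms(4) by (intro bexI[of _ "- x"]) auto
  qed (use assms zero in \<open>auto simp: algebra_simps\<close>)
  show "Group.comm_monoid (ring_on C)"
    by (rule comm_monoidI) (use assms in \<open>auto simp: algebra_simps\<close>)
qed (auto simp: algebra_simps)

definition over :: "'m set \<Rightarrow> ('m, 'r::comm_ring_1) mpoly set" where
  "over M = {p. \<forall>\<mu>\<in>Poly_Mapping.keys p. Poly_Mapping.keys \<mu> \<subseteq> M}"

lemma over_Const: "Const c \<in> over M"
  by (auto simp: over_def Const_def)

lemma over_Var: "i \<in> M \<Longrightarrow> Var i \<in> over M"
  by (auto simp: over_def Var_def)

lemma over_one: "1 \<in> over M"
  using over_Const[of 1 M] by (simp add: ring_map_one[OF ring_map_Const])

lemma over_add: "p \<in> over M \<Longrightarrow> q \<in> over M \<Longrightarrow> p + q \<in> over M"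
  unfolding over_def using keys_add[of p q] by blast

lemma over_mult:
  assumes "p \<in> over M" "q \<in> over M"
  shows "p * q \<in> over M"
  unfolding over_def
proof safe
  fix \<mu> i
  assume "\<mu> \<in> Poly_Mapping.keys (p * q)" and i: "i \<in> Poly_Mapping.keys \<mu>"
  then obtain \<alpha> \<beta> where "\<mu> = \<alpha> + \<beta>" "\<alpha> \<in> Poly_Mapping.keys p" "\<beta> \<in> Poly_Mapping.keys q"
    using keys_mult[of p q] by blast
  then show "i \<in> M"
    using assms i keys_add[of \<alpha> \<beta>] unfolding over_def by blast
qed

lemma over_uminus: "p \<in> over M \<Longrightarrow> - p \<in> over M"
  by (simp add: over_def in_keys_iff)

lemma over_diff: "p \<in> over M \<Longrightarrow> q \<in> over M \<Longrightarrow> p - q \<in> over M"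
  using over_add[OF _ over_uminus] by fastforce

lemma free_algebra_conv: "free_algebra M = ring_on (over M)"
  by (simp add: free_algebra_def over_def)

lemma cring_free_algebra: "cring (free_algebra M)"
  unfolding free_algebra_conv
  by (rule cring_ring_on) (simp_all add: over_one over_add over_mult over_uminus)

lemma over_induct [consumes 1, case_names Const Var add mult]:
  assumes p: "p \<in> over M"
    and C: "\<And>c. P (Const c)"
    and V: "\<And>i. i \<in> M \<Longrightarrow> P (Var i)"
    and A: "\<And>p q. P p \<Longrightarrow> P q \<Longrightarrow> P (p + q)"
    and M: "\<And>p q. P p \<Longrightarrow> P q \<Longrightarrow> P (p * q)"
  shows "P p"
proof -
  have P01: "P 0" "P 1"
    using C[of 0] C[of 1] by (simp_all add: ring_map_simps[OF ring_map_Const])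
  have sum: "P (sum f B)" if "\<And>x. x \<in> B \<Longrightarrow> P (f x)" for B and f :: "('a \<Rightarrow>\<^sub>0 nat) \<Rightarrow> ('a, 'b) mpoly"
    using that by (induction B rule: infinite_finite_induct) (simp_all add: P01 A)
  have pow: "P (Var i ^ k)" if "i \<in> M" for i k
    using that by (induction k) (simp_all add: P01 M V)
  have prod: "P (\<Prod>i\<in>B. Var i ^ e i)" if "B \<subseteq> M" for B and e :: "'a \<Rightarrow> nat"
    using that by (induction B rule: infinite_finite_induct) (simp_all add: P01 M pow)
  have "P (Poly_Mapping.single \<mu> c)" if "\<mu> \<in> Poly_Mapping.keys p" for \<mu> c
    unfolding single_conv_monomial_value monomial_value_def
    by (intro M C prod) (use p that in \<open>auto simp: over_def\<close>)
  then have "P (\<Sum>\<mu>\<in>Poly_Mapping.keys p. Poly_Mapping.single \<mu> (Poly_Mapping.lookup p \<mu>))"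
    by (intro sum) auto
  then show ?thesis
    by (simp flip: mpoly_eq_sum_single)
qed

text \<open>Products of elements of two ideals may be tested on generators.\<close>

lemma ideal_gen_mult_closed:
  assumes "\<And>a b. a \<in> A \<Longrightarrow> b \<in> B \<Longrightarrow> a * b \<in> ideal_gen C"
    and "x \<in> ideal_gen A" "y \<in> ideal_gen B"
  shows "x * y \<in> ideal_gen C"
proof -
  have "a * y \<in> ideal_gen C" if "a \<in> A" for a
    using assms(3) unfolding ideal_gen_def[of B]
  proof (induction rule: idl.span_induct_alt)
    case (step c u v)
    have "a * (c * u + v) = c * (a * u) + a * v"
      by (simp add: algebra_simps)
    also have "\<dots> \<in> ideal_gen C"
      by (intro ideal_gen_add ideal_gen_mult_left assms(1) step that)
    finally show ?case .
  qed (simp add: ideal_gen_zero)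
  note A = this
  show ?thesis
    using assms(2) unfolding ideal_gen_def[of A]
  proof (induction rule: idl.span_induct_alt)
    case (step c u v)
    have "(c * u + v) * y = c * (u * y) + v * y"
      by (simp add: algebra_simps)
    also have "\<dots> \<in> ideal_gen C"
      by (intro ideal_gen_add ideal_gen_mult_left A step)
    finally show ?case .
  qed (simp add: ideal_gen_zero)
qed

lemma ideal_power_zero: "x \<in> ideal_power J 0"
  using ideal_gen_mult_left[OF ideal_gen_base, of 1 "{1}" x] by (simp add: ideal_power_def)

lemma ideal_power_base: "(\<And>i. i < k \<Longrightarrow> u i \<in> J) \<Longrightarrow> (\<Prod>i<k. u i) \<in> ideal_power J k"
  unfolding ideal_power_def by (intro ideal_gen_base) blast

lemma ideal_power_mult:
  fixes J :: "'r::comm_ring_1 set"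
  assumes "x \<in> ideal_power J k" "y \<in> ideal_power J l"
  shows "x * y \<in> ideal_power J (k + l)"
  using assms unfolding ideal_power_def[of J k] ideal_power_def[of J l] ideal_power_def[of J "k + l"]
proof (rule ideal_gen_mult_closed[rotated])
  fix a b
  assume "a \<in> {\<Prod>i<k. u i | u. \<forall>i<k. u i \<in> J}" "b \<in> {\<Prod>i<l. u i | u. \<forall>i<l. u i \<in> J}"
  then obtain u v where a: "a = (\<Prod>i<k. u i)" "\<forall>i<k. u i \<in> J"
    and b: "b = (\<Prod>i<l. v i)" "\<forall>i<l. v i \<in> J"
    by blast
  define w where "w i = (if i < k then u i else v (i - k))" for i
  have "(\<Prod>i<k + l. w i) = (\<Prod>i<k. w i) * (\<Prod>i\<in>{k..<k + l}. w i)"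
    by (metis finite_atLeastLessThan finite_lessThan ivl_disj_int_one(2) ivl_disj_un_one(2)
        le_add1 lessThan_atLeast0 prod.union_disjoint)
  also have "(\<Prod>i<k. w i) = a"
    by (simp add: w_def a(1))
  also have "(\<Prod>i\<in>{k..<k + l}. w i) = (\<Prod>i\<in>{0..<l}. w (i + k))"
    using prod.shift_bounds_nat_ivl[of w 0 k l] by (simp add: add.commute)
  also have "\<dots> = b"
    by (simp add: w_def b(1) lessThan_atLeast0)
  finally have "a * b = (\<Prod>i<k + l. w i)"
    by simp
  moreover have "\<forall>i<k + l. w i \<in> J"
    using a(2) b(2) by (auto simp: w_def)
  ultimately show "a * b \<in> ideal_gen {\<Prod>i<k + l. u i | u. \<forall>i<k + l. u i \<in> J}"
    by (intro ideal_gen_base) blast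
qed

definition rees_set :: "'r::comm_ring_1 set \<Rightarrow> 'r poly set" where
  "rees_set J = {p. \<forall>k. coeff p k \<in> ideal_power J k}"

lemma rees_set_add: "p \<in> rees_set J \<Longrightarrow> q \<in> rees_set J \<Longrightarrow> p + q \<in> rees_set J"
  by (simp add: rees_set_def ideal_power_def ideal_gen_add)

lemma rees_set_mult:
  assumes "p \<in> rees_set J" "q \<in> rees_set J"
  shows "p * q \<in> rees_set J"
proof -
  have "coeff p i * coeff q (k - i) \<in> ideal_power J k" if "i \<le> k" for i k
    using ideal_power_mult[of "coeff p i" J i "coeff q (k - i)" "k - i"] assms that
    by (simp add: rees_set_def)
  then have "(\<Sum>i\<le>k. coeff p i * coeff q (k - i)) \<in> ideal_power J k" for k
    unfolding ideal_power_def by (intro ideal_gen_sum) simp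
  then show ?thesis
    by (simp add: rees_set_def coeff_mult)
qed

lemma rees_set_const: "[:a:] \<in> rees_set J"
proof -
  have "coeff [:a:] k \<in> ideal_power J k" for k
    by (cases k) (simp_all add: ideal_power_zero, simp add: ideal_power_def ideal_gen_zero)
  then show ?thesis
    by (simp add: rees_set_def)
qed

lemma rees_set_uminus: "p \<in> rees_set J \<Longrightarrow> - p \<in> rees_set J"
  using rees_set_mult[OF rees_set_const, of p J "- 1"] by simp

lemma rees_set_monom:
  assumes "a \<in> J"
  shows "monom a 1 \<in> rees_set J"
proof -
  have "a \<in> ideal_power J 1"
    using ideal_power_base[of 1 "\<lambda>_. a" J] assms by simp
  then show ?thesis
    by (auto simp: rees_set_def) (simp add: ideal_power_def ideal_gen_zero)
qed

lemma rees_algebra_conv: "rees_algebra J = ring_on (rees_set J)"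
  by (simp add: rees_algebra_def rees_set_def)

lemma cring_rees_algebra: "cring (rees_algebra J)"
  unfolding rees_algebra_conv using rees_set_const[of 1 J]
  by (intro cring_ring_on) (simp_all add: rees_set_add rees_set_mult rees_set_uminus one_pCons)

lemma rees_eval_conv: "rees_eval = meval (\<lambda>u. [:u:]) (\<lambda>m. monom m 1)"
  by (rule ext) (simp add: rees_eval_def meval_def monomial_value_def)

lemma ring_map_rees_eval: "ring_map rees_eval"
  unfolding rees_eval_conv by (rule ring_map_meval[OF ring_map_const_poly])

lemmas rees_eval_simps [simp] = ring_map_simps[OF ring_map_rees_eval]

lemma rees_eval_Const [simp]: "rees_eval (Const u) = [:u:]"
  and rees_eval_Var [simp]: "rees_eval (Var m) = monom m 1"
  by (simp_all add: rees_eval_conv ring_map_const_poly)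

lemma rees_eval_in_rees_set: "p \<in> over J \<Longrightarrow> rees_eval p \<in> rees_set J"
  by (induction rule: over_induct)
    (simp_all add: rees_set_const rees_set_monom[simplified] rees_set_add rees_set_mult)

text \<open>The image is closed under sums and contains \<open>c t\<^sup>k\<close> for every \<open>c\<close> in the \<open>k\<close>-th power of
  the ideal, because this is so for products of \<open>k\<close> elements of the ideal.\<close>

lemma rees_eval_surj:
  assumes q: "q \<in> rees_set J"
  shows "q \<in> rees_eval ` over J"
proof -
  let ?I = "rees_eval ` over J"
  have add: "p + q \<in> ?I" if p: "p \<in> ?I" and q: "q \<in> ?I" for p q
  proof -
    obtain a b where ab: "a \<in> over J" "b \<in> over J" "p = rees_eval a" "q = rees_eval b"
      using p q by blast
    show ?thesis
      by (rule image_eqI[of _ _ "a + b"]) (simp_all add: ab over_add)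
  qed
  have mult: "p * q \<in> ?I" if p: "p \<in> ?I" and q: "q \<in> ?I" for p q
  proof -
    obtain a b where ab: "a \<in> over J" "b \<in> over J" "p = rees_eval a" "q = rees_eval b"
      using p q by blast
    show ?thesis
      by (rule image_eqI[of _ _ "a * b"]) (simp_all add: ab over_mult)
  qed
  have const: "[:c:] \<in> ?I" for c
    using over_Const[of c J] by (metis imageI rees_eval_Const)
  have var: "monom a 1 \<in> ?I" if "a \<in> J" for a
    using over_Var[OF that] by (metis imageI rees_eval_Var)
  have "monom (\<Prod>i<k. u i) k \<in> ?I" if "\<forall>i<k. u i \<in> J" for u and k :: nat
    using that
  proof (induction k)
    case 0
    then show ?case
      using const[of 1] by (simp add: monom_0)
  next
    case (Suc k)
    have "monom (\<Prod>i<Suc k. u i) (Suc k) = monom (\<Prod>i<k. u i) k * monom (u k) 1"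
      by (simp add: mult_monom)
    then show ?case
      using Suc mult var by simp
  qed
  note gen = this
  have "monom c k \<in> ?I" if "c \<in> ideal_power J k" for c k
    using that unfolding ideal_power_def ideal_gen_def
  proof (induction rule: idl.span_induct_alt)
    case base
    then show ?case
      using const[of 0] by simp
  next
    case (step a x y)
    have "monom (a * x + y) k = [:a:] * monom x k + monom y k"
      by (simp add: smult_monom add_monom)
    also have "\<dots> \<in> ?I"
      using step gen by (intro add mult const) auto
    finally show ?case .
  qed
  then have "monom (coeff q k) k \<in> ?I" for k
    using q by (simp add: rees_set_def)
  then have "(\<Sum>k\<in>A. monom (coeff q k) k) \<in> ?I" for A
    by (induction A rule: infinite_finite_induct) (use const[of 0] add in simp_all)
  from this[of "{..Polynomial.degree q}"] show ?thesis
    by (simp add: poly_as_sum_of_monoms)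
qed

lemma rees_eval_linearity_relations:
  assumes "p \<in> linearity_relations (*) J"
  shows "rees_eval p = 0"
proof -
  consider x y where "p = Var (x + y) - Var x - Var y"
    | a x where "p = Var (a * x) - Const a * Var x"
    using assms unfolding linearity_relations_def by blast
  then show ?thesis
    by cases (auto intro!: poly_eqI)
qed

lemma sym_to_rees_conv: "sym_to_rees = (\<lambda>A. the_elem (rees_eval ` A))"
  by (rule ext) (simp add: sym_to_rees_def)

lemma ring_hom_rees_eval: "ring_hom_ring (free_algebra J) (rees_algebra J) rees_eval"
proof (rule ring_hom_ringI2)
  show "ring (free_algebra J)" "ring (rees_algebra J)"
    using cring_free_algebra cring_rees_algebra cring.axioms(1) by blast+
  show "rees_eval \<in> ring_hom (free_algebra J) (rees_algebra J)"
    unfolding free_algebra_conv rees_algebra_conv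
    by (rule ring_hom_memI) (simp_all add: rees_eval_in_rees_set)
qed

lemma ideal_gen_rangeE:
  fixes F :: "'g::finite \<Rightarrow> 'r::comm_ring_1"
  assumes "x \<in> ideal_gen (range F)"
  obtains a where "x = (\<Sum>j\<in>UNIV. a j * F j)"
proof -
  have "\<exists>a. x = (\<Sum>j\<in>UNIV. a j * F j)"
    using assms unfolding ideal_gen_def
  proof (induction rule: idl.span_induct_alt)
    case base
    show ?case
      by (rule exI[of _ "\<lambda>_. 0"]) simp
  next
    case (step c x y)
    then obtain i a where x: "x = F i" and y: "y = (\<Sum>j\<in>UNIV. a j * F j)"
      by blast
    have "c * x = (\<Sum>j\<in>UNIV. (if j = i then c else 0) * F j)"
      by (simp add: x if_distrib[of "\<lambda>t. t * F _"] cong: if_cong)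
    then have "c * x + y = (\<Sum>j\<in>UNIV. ((if j = i then c else 0) + a j) * F j)"
      by (simp add: y distrib_right sum.distrib)
    then show ?case
      by (intro exI[of _ "\<lambda>j. (if j = i then c else 0) + a j"])
  qed
  then show ?thesis
    using that by blast
qed

definition lift :: "('i, 'k::comm_ring_1) mpoly \<Rightarrow> ('i + 'g, 'k) mpoly" where
  "lift = meval Const (\<lambda>i. Var (Inl i))"

lemma ring_map_lift: "ring_map lift"
  unfolding lift_def by (rule ring_map_meval[OF ring_map_Const])

lemma lift_Const [simp]: "lift (Const c) = Const c"
  and lift_Var [simp]: "lift (Var i) = Var (Inl i)"
  by (simp_all add: lift_def ring_map_Const)

definition linear_form ::
    "('g::finite \<Rightarrow> ('i, 'k::comm_ring_1) mpoly) \<Rightarrow> ('i + 'g, 'k) mpoly" where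
  "linear_form a = (\<Sum>j\<in>UNIV. lift (a j) * Var (Inr j))"

text \<open>The homomorphism \<open>T\<^sub>j \<mapsto> F\<^sub>j t\<close> whose kernel consists of the equations of the Rees algebra
  with respect to the generators \<open>F\<close>.\<close>

definition blowup_map ::
    "('g \<Rightarrow> ('i, 'k::comm_ring_1) mpoly) \<Rightarrow> ('i + 'g, 'k) mpoly \<Rightarrow> ('i, 'k) mpoly poly" where
  "blowup_map F = meval (\<lambda>c. [:Const c:]) (case_sum (\<lambda>i. [:Var i:]) (\<lambda>j. monom (F j) 1))"

lemma ring_map_blowup_map: "ring_map (blowup_map F)"
  unfolding blowup_map_def by (rule ring_map_meval[OF ring_map_Const_const_poly])

lemma blowup_map_simps [simp]:
  "blowup_map F (Const c) = [:Const c:]"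
  "blowup_map F (Var (Inl i)) = [:Var i:]"
  "blowup_map F (Var (Inr j)) = monom (F j) 1"
  by (simp_all add: blowup_map_def ring_map_Const_const_poly)

text \<open>Linear type may be tested on finitely many generators. Modulo the linearity relations
  every element of the free algebra on the ideal is a polynomial in the indeterminates that
  belong to the generators \<open>F\<close>, because \<open>Var (\<Sum> a\<^sub>j F\<^sub>j)\<close> is congruent to \<open>\<Sum> a\<^sub>j Var F\<^sub>j\<close>. If such an
  element is sent to zero in the Rees algebra, then the polynomial is by hypothesis a
  combination of linear forms that vanish at \<open>F\<close>, and each of these is congruent to
  \<open>Var 0\<close>, which is a linearity relation. So the kernel is the ideal of the linearity
  relations, and the isomorphism theorem for rings applies.\<close>

theorem linear_type_idealI:
  fixes F :: "'g::finite \<Rightarrow> ('i, 'k::comm_ring_1) mpoly"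
  assumes ker: "\<And>P. blowup_map F P = 0 \<Longrightarrow>
      P \<in> ideal_gen {linear_form a | a. (\<Sum>j\<in>UNIV. a j * F j) = 0}"
  shows "linear_type_ideal (ideal_gen (range F))"
proof -
  define J where "J = ideal_gen (range F)"
  define I where "I = Idl\<^bsub>free_algebra J\<^esub> (linearity_relations (*) J)"
  interpret A: cring "free_algebra J"
    by (rule cring_free_algebra)
  interpret h: ring_hom_ring "free_algebra J" "rees_algebra J" rees_eval
    by (rule ring_hom_rees_eval)
  have J: "F j \<in> J" "0 \<in> J" "x \<in> J \<Longrightarrow> y \<in> J \<Longrightarrow> x + y \<in> J" "x \<in> J \<Longrightarrow> a * x \<in> J" for j x y a
    by (auto simp: J_def ideal_gen_base ideal_gen_zero ideal_gen_add ideal_gen_mult_left)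
  have carrier: "carrier (free_algebra J) = over J"
    by (simp add: free_algebra_conv)
  have rel_over: "linearity_relations (*) J \<subseteq> over J"
    by (auto simp: linearity_relations_def intro!: over_diff over_mult over_Const over_Var J)
  interpret I: ideal I "free_algebra J"
    unfolding I_def by (rule A.genideal_ideal) (simp add: carrier rel_over)
  have I_over: "p \<in> over J" if "p \<in> I" for p
    using I.Icarr[OF that] by (simp add: carrier)
  have I_add: "p + q \<in> I" if "p \<in> I" "q \<in> I" for p q
    using I.a_closed[OF that] by (simp add: free_algebra_conv)
  have I_mult: "p * q \<in> I" if "p \<in> over J" "q \<in> I" for p q
    using I.I_l_closed[OF that(2)] that(1) by (simp add: free_algebra_conv)
  have I_zero: "0 \<in> I"
    using I.zero_closed by (simp add: free_algebra_conv)
  have I_uminus: "- p \<in> I" if "p \<in> I" for p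
    using I_mult[OF over_uminus[OF over_one] that] by simp
  have I_diff: "p - q \<in> I" if "p \<in> I" "q \<in> I" for p q
    using I_add[OF that(1) I_uminus[OF that(2)]] by simp
  have I_rel: "p \<in> I" if "p \<in> linearity_relations (*) J" for p
    unfolding I_def using A.genideal_self[of "linearity_relations (*) J"] rel_over that
    by (auto simp: carrier)
  have I_Var_add: "Var (x + y) - Var x - Var y \<in> I" if "x \<in> J" "y \<in> J" for x y
    using that by (intro I_rel) (auto simp: linearity_relations_def)
  have I_Var_mult: "Var (a * x) - Const a * Var x \<in> I" if "x \<in> J" for a x
    using that by (intro I_rel) (auto simp: linearity_relations_def)
  have I_Var_zero: "Var 0 \<in> I"
    using I_Var_mult[OF J(2), of 0] by (simp add: ring_map_zero[OF ring_map_Const])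
  have kernel_conv: "a_kernel (free_algebra J) (rees_algebra J) rees_eval =
      {p \<in> over J. rees_eval p = 0}"
    unfolding a_kernel_def' carrier rees_algebra_conv ring_on_simps by (rule refl)
  have kernel_sub: "I \<subseteq> a_kernel (free_algebra J) (rees_algebra J) rees_eval"
    unfolding I_def
  proof (rule A.genideal_minimal[OF h.kernel_is_ideal])
    show "linearity_relations (*) J \<subseteq> a_kernel (free_algebra J) (rees_algebra J) rees_eval"
      unfolding kernel_conv using rel_over rees_eval_linearity_relations by blast
  qed
  \<comment> \<open>Substitution of the indeterminates attached to the generators for the \<open>T\<^sub>j\<close>.\<close>
  define \<Psi> :: "('i + 'g, 'k) mpoly \<Rightarrow> (('i, 'k) mpoly, ('i, 'k) mpoly) mpoly" where "\<Psi> = meval (\<lambda>c. Const (Const c)) (case_sum (\<lambda>i. Const (Var i)) (\<lambda>j. Var (F j)))"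
  have cc: "ring_map (\<lambda>c::'k. Const (Const c) :: (('i, 'k) mpoly, ('i, 'k) mpoly) mpoly)"
    by (rule ring_map_comp[OF ring_map_Const ring_map_Const])
  have \<Psi>: "ring_map \<Psi>"
    unfolding \<Psi>_def by (rule ring_map_meval[OF cc])
  have \<Psi>_simps: "\<Psi> (Const c) = Const (Const c)" "\<Psi> (Var (Inl i)) = Const (Var i)"
    "\<Psi> (Var (Inr j)) = Var (F j)" for c i j
    by (simp_all add: \<Psi>_def cc)
  have \<Psi>_over: "\<Psi> P \<in> over J" for P
  proof (induction P rule: mpoly_induct)
    case (Var i)
    then show ?case
      by (cases i) (simp_all add: \<Psi>_simps over_Const over_Var J)
  qed (simp_all add: \<Psi>_simps ring_map_simps[OF \<Psi>] over_Const over_add over_mult)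
  have \<Psi>_base: "\<Psi> (lift u) = Const u" for u
    by (rule ring_map_mpoly_eqI[where h = "\<lambda>u. \<Psi> (lift u)"])
      (simp_all add: ring_map_Const \<Psi>_simps ring_map_comp[OF \<Psi> ring_map_lift])
  have rees_\<Psi>: "rees_eval (\<Psi> P) = blowup_map F P" for P
  proof (rule ring_map_mpoly_eqI)
    show "ring_map (\<lambda>P. rees_eval (\<Psi> P))"
      by (rule ring_map_comp[OF ring_map_rees_eval \<Psi>])
    show "rees_eval (\<Psi> (Var i)) = blowup_map F (Var i)" for i
      by (cases i) (simp_all add: \<Psi>_simps)
  qed (simp_all add: ring_map_blowup_map \<Psi>_simps)
  have combo: "(\<Sum>j\<in>B. Const (a j) * Var (F j)) - Var (\<Sum>j\<in>B. a j * F j) \<in> I \<and>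
      (\<Sum>j\<in>B. a j * F j) \<in> J" if "finite B" for a B
    using that
  proof (induction B rule: finite_induct)
    case empty
    then show ?case
      using I_uminus[OF I_Var_zero] J(2) by simp
  next
    case (insert j B)
    let ?p = "\<Sum>j\<in>B. Const (a j) * Var (F j)" and ?x = "\<Sum>j\<in>B. a j * F j"
    have "(?p - Var ?x) - (Var (a j * F j + ?x) - Var (a j * F j) - Var ?x)
        - (Var (a j * F j) - Const (a j) * Var (F j)) \<in> I"
      by (rule I_diff[OF I_diff[OF conjunct1[OF insert.IH]
              I_Var_add[OF J(4)[OF J(1)] conjunct2[OF insert.IH]]] I_Var_mult[OF J(1)]])
    moreover have "a j * F j + ?x \<in> J"
      using insert.IH J by blast
    ultimately show ?case
      using insert.hyps by (simp add: algebra_simps)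
  qed
  have \<Psi>_linear: "\<Psi> (linear_form a) \<in> I" if "(\<Sum>j\<in>UNIV. a j * F j) = 0" for a
  proof -
    have "\<Psi> (linear_form a) = (\<Sum>j\<in>UNIV. Const (a j) * Var (F j))"
      by (simp add: linear_form_def ring_map_simps[OF \<Psi>] \<Psi>_base \<Psi>_simps)
    moreover have "(\<Sum>j\<in>UNIV. Const (a j) * Var (F j)) - Var 0 + Var 0 \<in> I"
      using combo[of UNIV a] I_Var_zero that by (intro I_add) simp_all
    ultimately show ?thesis
      by simp
  qed
  have \<Psi>_ker: "\<Psi> P \<in> I" if "blowup_map F P = 0" for P
    using ker[OF that] unfolding ideal_gen_def
  proof (induction rule: idl.span_induct_alt)
    case (step c x y)
    then show ?case
      using \<Psi>_linear by (auto simp: ring_map_simps[OF \<Psi>] intro!: I_add I_mult \<Psi>_over)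
  qed (simp add: ring_map_zero[OF \<Psi>] I_zero)
  have rep: "\<exists>P. p - \<Psi> P \<in> I" if "p \<in> over J" for p
    using that
  proof (induction rule: over_induct)
    case (Const c)
    show ?case
      using \<Psi>_base[of c] I_zero by (metis cancel_comm_monoid_add_class.diff_cancel)
  next
    case (Var x)
    then obtain a where a: "x = (\<Sum>j\<in>UNIV. a j * F j)"
      unfolding J_def by (rule ideal_gen_rangeE)
    have "- ((\<Sum>j\<in>UNIV. Const (a j) * Var (F j)) - Var x) \<in> I"
      using combo[of UNIV a] a by (intro I_uminus) simp
    moreover have "\<Psi> (linear_form a) = (\<Sum>j\<in>UNIV. Const (a j) * Var (F j))"
      by (simp add: linear_form_def ring_map_simps[OF \<Psi>] \<Psi>_base \<Psi>_simps)
    ultimately show ?case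
      by (intro exI[of _ "linear_form a"]) simp
  next
    case (add p q)
    then obtain P Q where "p - \<Psi> P \<in> I" "q - \<Psi> Q \<in> I"
      by blast
    from I_add[OF this] show ?case
      by (intro exI[of _ "P + Q"]) (simp add: ring_map_simps[OF \<Psi>] algebra_simps)
  next
    case (mult p q)
    then obtain P Q where P: "p - \<Psi> P \<in> I" and Q: "q - \<Psi> Q \<in> I"
      by blast
    have "\<Psi> Q + (q - \<Psi> Q) \<in> over J"
      by (intro over_add \<Psi>_over I_over Q)
    then have "q * (p - \<Psi> P) + \<Psi> P * (q - \<Psi> Q) \<in> I"
      by (intro I_add I_mult P Q \<Psi>_over) simp
    then show ?case
      by (intro exI[of _ "P * Q"]) (simp add: ring_map_simps[OF \<Psi>] algebra_simps)
  qed
  have "p \<in> I" if p: "p \<in> over J" "rees_eval p = 0" for p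
  proof -
    obtain P where P: "p - \<Psi> P \<in> I"
      using rep[OF p(1)] by blast
    then have "rees_eval (p - \<Psi> P) = 0"
      using kernel_sub unfolding kernel_conv by blast
    then have "\<Psi> P \<in> I"
      using p(2) by (intro \<Psi>_ker) (simp add: rees_\<Psi>)
    from I_add[OF P this] show ?thesis
      by simp
  qed
  then have "a_kernel (free_algebra J) (rees_algebra J) rees_eval = I"
    using kernel_sub unfolding kernel_conv by blast
  moreover have "(\<lambda>X. the_elem (rees_eval ` X)) \<in>
      ring_iso (free_algebra J Quot a_kernel (free_algebra J) (rees_algebra J) rees_eval)
        (rees_algebra J)"
    by (rule h.FactRing_iso_set)
      (auto simp: carrier rees_algebra_conv rees_eval_in_rees_set rees_eval_surj)
  ultimately show ?thesis
    by (simp add: linear_type_ideal_def sym_algebra_def I_def sym_to_rees_conv flip: J_def)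
qed

section \<open>The gradient ideal is of linear type\<close>

lemma ring_map_of_nat: "ring_map h \<Longrightarrow> h (of_nat k) = of_nat k"
  by (induction k) (simp_all add: ring_map_simps)

lemma Var_neq_zero [simp]: "Var i \<noteq> (0 :: ('i, 'a::comm_ring_1) mpoly)"
proof
  assume "Var i = (0 :: ('i, 'a) mpoly)"
  then have "Poly_Mapping.lookup (Var i :: ('i, 'a) mpoly) (Poly_Mapping.single i 1) = 0"
    by simp
  then show False
    by (simp add: Var_def)
qed

lemma partial_deriv_power:
  "partial_deriv i (p ^ k) = of_nat k * p ^ (k - 1) * partial_deriv i p"
  by (rule der_power[OF partial_deriv_in_derivations])

lemma partial_deriv_diff: "partial_deriv i (p - q) = partial_deriv i p - partial_deriv i q"
  by (rule der_diff[OF partial_deriv_in_derivations])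

lemma partial_deriv_one: "partial_deriv i 1 = 0"
  by (rule der_one[OF partial_deriv_in_derivations])

lemma partial_deriv_monomial_other:
  "i \<notin> A \<Longrightarrow> partial_deriv i (\<Prod>j\<in>A. Var j ^ e j) = 0"
  by (induction A rule: infinite_finite_induct)
    (auto simp: partial_deriv_mult partial_deriv_power partial_deriv_Var partial_deriv_one)

lemma partial_deriv_monomial:
  assumes "finite A" "i \<in> A"
  shows "partial_deriv i (\<Prod>j\<in>A. Var j ^ e j) =
    of_nat (e i) * Var i ^ (e i - 1) * (\<Prod>j\<in>A - {i}. Var j ^ e j)"
  by (simp add: prod.remove[OF assms] partial_deriv_mult partial_deriv_monomial_other
      partial_deriv_power partial_deriv_Var)

lemma Var_mult_partial_deriv_monomial:
  assumes "finite A" "i \<in> A"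
  shows "Var i * partial_deriv i (\<Prod>j\<in>A. Var j ^ e j) = of_nat (e i) * (\<Prod>j\<in>A. Var j ^ e j)"
  unfolding partial_deriv_monomial[OF assms] unfolding prod.remove[OF assms]
  by (cases "e i") (simp_all add: mult_ac)

context toric_data
begin

lemma ring_map_data:
  assumes h: "ring_map h"
  shows "h (toric_mon w) = toric_mon (\<lambda>i. h (w i))" "h (pivot w) = pivot (\<lambda>i. h (w i))"
    "h (cofactor w) = cofactor (\<lambda>i. h (w i))"
    "h (line w y j) = line (\<lambda>i. h (w i)) (\<lambda>i. h (y i)) j"
    "h (cross w y) = cross (\<lambda>i. h (w i)) (\<lambda>i. h (y i))"
  by (simp_all add: toric_mon_def pivot_def cofactor_def line_def cross_def ring_map_simps[OF h]
      ring_map_of_nat[OF h] del: of_nat_Suc)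

lemma mult_power_pred: "x * (a * x ^ (d - 1)) = a * x ^ d" for a x :: "'b::comm_ring_1"
  using d_pos by (cases d) (simp_all add: mult_ac)

lemma lift_data: "lift (toric_mon Var) = toric_mon X" "lift (pivot Var) = pivot X"
    "lift (cofactor Var) = cofactor X"
  by (simp_all add: ring_map_data[OF ring_map_lift])

text \<open>Polynomials in the single indeterminate \<open>Y z\<close> over the coordinate ring. They are the ones
  on which the blowup map is visibly injective.\<close>

definition from_last :: "('n, 'k::field_char_0) mpoly poly \<Rightarrow> ('n + 'n, 'k) mpoly" where
  "from_last u = poly (map_poly lift u) (Y z)"

lemma ring_map_from_last: "ring_map from_last"
  unfolding from_last_def[abs_def]
  by (rule ring_map_comp[OF ring_map_poly ring_map_map_poly[OF ring_map_lift]])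

lemma from_last_pCons: "from_last (pCons a u) = lift a + Y z * from_last u"
  by (simp add: from_last_def map_poly_pCons ring_map_zero[OF ring_map_lift])

lemma from_last_const: "from_last [:a:] = lift a"
  by (simp add: from_last_pCons ring_map_zero[OF ring_map_from_last])

lemma blowup_map_lift: "blowup_map F (lift u) = [:u:]"
  by (rule ring_map_mpoly_eqI[where h = "\<lambda>u. blowup_map F (lift u)" and k = "\<lambda>u. [:u:]"])
    (simp_all add: ring_map_comp[OF ring_map_blowup_map ring_map_lift] ring_map_const_poly)

lemma blowup_map_from_last: "blowup_map F (from_last u) = pcompose u (monom (F z) 1)"
  by (induction u)
    (simp_all add: from_last_pCons ring_map_simps[OF ring_map_blowup_map] blowup_map_lift
      pcompose_pCons ring_map_zero[OF ring_map_from_last])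

text \<open>After multiplication by a power of \<open>W = z\<^sup>d\<^sup>-\<^sup>1 \<Prod> x\<^sub>j\<close> the equations eliminate every \<open>Y\<close> except
  \<open>Y z\<close>. The resulting polynomial in \<open>Y z\<close> is sent to its value at \<open>F\<^sub>z t\<close>; if this
  vanishes then so does the polynomial, and \<open>W\<close> can be cancelled.\<close>

theorem blowup_map_kernel:
  fixes F :: "'n \<Rightarrow> ('n, 'k::field_char_0) mpoly"
  assumes Fz: "F z \<noteq> 0" and line: "\<And>j. j \<in> S \<Longrightarrow> line Var F j = 0" and cross: "cross Var F = 0"
    and P: "blowup_map F P = 0"
  shows "P \<in> ideal_gen relations"
proof -
  let ?I = "ideal_gen relations :: ('n + 'n, 'k) mpoly set"
  note hom = ring_map_simps[OF ring_map_from_last] ring_map_simps[OF ring_map_lift]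
  define w :: "('n, 'k) mpoly" where "w = (\<Prod>j\<in>S. Var j) * Var z ^ (d - 1)"
  define W :: "('n + 'n, 'k) mpoly" where "W = (\<Prod>j\<in>S. X j) * X z ^ (d - 1)"
  have lift_w: "lift w = W"
    by (simp add: w_def W_def hom)
  have nzd_W: "nzd (W ^ N) relations" for N
    unfolding W_def by (intro nzd_power nzd_mult nzd_prod nzd_X_relations nzd_Xz_relations)
  have L_in: "L j \<in> ?I" if "j \<in> S" for j
    using that by (intro ideal_gen_base) auto
  have cross_in: "cross X Y \<in> ?I"
    by (intro ideal_gen_base) auto
  have "\<exists>N u. W ^ N * Q - from_last u \<in> ?I" for Q
  proof (induction Q rule: mpoly_induct)
    case (Const c)
    show ?case
      by (rule exI[of _ 0], rule exI[of _ "[:Const c:]"]) (simp add: from_last_const ideal_gen_zero)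
  next
    case (Var v)
    show ?case
    proof (cases v)
      case (Inl i)
      then show ?thesis
        by (intro exI[of _ 0] exI[of _ "[:Var i:]"]) (simp add: from_last_const ideal_gen_zero)
    next
      case (Inr i)
      consider "i = z" | "i = m" | "i \<in> S"
        using cover by auto
      then show ?thesis
      proof cases
        case 1
        then show ?thesis
          using Inr by (intro exI[of _ 0] exI[of _ "[:0, 1:]"])
            (simp add: from_last_pCons ideal_gen_zero hom)
      next
        case 2
        let ?u = "[:0, (\<Prod>j\<in>S. Var j) * cofactor Var:] :: ('n, 'k) mpoly poly"
        have "W ^ 1 * Y m - from_last ?u = (\<Prod>j\<in>S. X j) * cross X Y"
          by (simp add: W_def from_last_pCons hom lift_data cross_def algebra_simps)
        also have "\<dots> \<in> ?I"
          by (intro ideal_gen_mult_left cross_in)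
        finally show ?thesis
          unfolding Inr 2 by blast
      next
        case 3
        \<comment> \<open>The line replaces \<open>x\<^sub>i Y\<^sub>i\<close> by a combination of \<open>Y\<^sub>m\<close> and \<open>Y\<^sub>z\<close>, and the power of \<open>z\<close> in
          \<open>W\<close> then allows the crossing equation to replace \<open>Y\<^sub>m\<close>.\<close>
        let ?c = "of_nat (s i + 1)"
        let ?r = "\<Prod>j\<in>S - {i}. X j :: ('n + 'n, 'k) mpoly"
        let ?u = "[:0, (\<Prod>j\<in>S - {i}. Var j) * (?c * toric_mon Var - Var z ^ d):] :: ('n, 'k) mpoly poly"
        have zd: "X z ^ d = (X z * X z ^ (d - 1) :: ('n + 'n, 'k) mpoly)"
          by (rule mult_power_pred[of "X z" 1, unfolded mult_1, symmetric])
        have u: "from_last ?u = ?r * (?c * toric_mon X - X z ^ d) * Y z"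
          by (simp add: from_last_pCons hom lift_data ring_map_of_nat[OF ring_map_lift]
              mult_ac del: of_nat_Suc)
        have "W ^ 1 * Y i - from_last ?u = (?r * X z ^ (d - 1)) * L i + (?c * pivot X * ?r) * cross X Y"
          unfolding u
          unfolding zd pivot_cofactor[symmetric] W_def line_def cross_def prod.remove[OF finite_S 3]
          by (simp add: algebra_simps del: of_nat_Suc)
        also have "\<dots> \<in> ?I"
          by (intro ideal_gen_add ideal_gen_mult_left cross_in L_in 3)
        finally show ?thesis
          unfolding Inr by blast
      qed
    qed
  next
    case (add p q)
    then obtain A u B v where A: "W ^ A * p - from_last u \<in> ?I" and B: "W ^ B * q - from_last v \<in> ?I"
      by blast
    have "W ^ (A + B) * (p + q) - from_last ([:w ^ B:] * u + [:w ^ A:] * v)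
        = W ^ B * (W ^ A * p - from_last u) + W ^ A * (W ^ B * q - from_last v)"
      unfolding ring_map_add[OF ring_map_from_last] ring_map_mult[OF ring_map_from_last]
        from_last_const by (simp add: hom lift_w power_add algebra_simps)
    also have "\<dots> \<in> ?I"
      by (intro ideal_gen_add ideal_gen_mult_left A B)
    finally show ?case
      by blast
  next
    case (mult p q)
    then obtain A u B v where A: "W ^ A * p - from_last u \<in> ?I" and B: "W ^ B * q - from_last v \<in> ?I"
      by blast
    have "W ^ (A + B) * (p * q) - from_last (u * v)
        = (W ^ A * p) * (W ^ B * q - from_last v) + from_last v * (W ^ A * p - from_last u)"
      by (simp add: hom power_add algebra_simps)
    also have "\<dots> \<in> ?I"
      by (intro ideal_gen_add ideal_gen_mult_left A B)
    finally show ?case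
      by blast
  qed
  then obtain N u where u: "W ^ N * P - from_last u \<in> ?I"
    by blast
  note bm = ring_map_simps[OF ring_map_blowup_map]
  have monoms: "blowup_map F (line X Y j) = monom (line Var F j) 1"
    "blowup_map F (cross X Y) = monom (cross Var F) 1" for j
  proof -
    have c: "pivot (\<lambda>i. [:Var i:]) = [:pivot Var:]" "cofactor (\<lambda>i. [:Var i:]) = [:cofactor Var:]"
      by (simp_all add: ring_map_data[OF ring_map_const_poly])
    have n: "of_nat k = [:of_nat k:]" for k
      by (rule of_nat_poly)
    show "blowup_map F (line X Y j) = monom (line Var F j) 1"
      "blowup_map F (cross X Y) = monom (cross Var F) 1"
      by (simp_all add: line_def cross_def bm ring_map_data(2,3)[OF ring_map_blowup_map]
          ring_map_of_nat[OF ring_map_blowup_map] c n smult_monom poly_const_pow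
          flip: diff_monom del: of_nat_Suc)
  qed
  have "blowup_map F Q = 0" if "Q \<in> ?I" for Q
    using that unfolding ideal_gen_def
    by (induction rule: idl.span_induct_alt) (auto simp: bm monoms line cross)
  then have "blowup_map F (W ^ N * P - from_last u) = 0"
    using u by blast
  then have "pcompose u (monom (F z) 1) = 0"
    using P by (simp add: bm blowup_map_from_last)
  then have "u = 0"
    by (rule pcompose_eq_0) (simp add: Fz degree_monom_eq)
  then have "W ^ N * P \<in> ?I"
    using u by (simp add: hom)
  then show ?thesis
    by (rule nzdD[OF nzd_W])
qed

text \<open>The coefficient vectors of the equations, which exhibit them as linear forms.\<close>

definition line_coeff :: "'n \<Rightarrow> 'n \<Rightarrow> ('n, 'k::field_char_0) mpoly" where
  "line_coeff j = (\<lambda>_. 0)(j := Var j, m := - (of_nat (s j + 1) * pivot Var), z := Var z)"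

definition cross_coeff :: "'n \<Rightarrow> ('n, 'k::field_char_0) mpoly" where
  "cross_coeff = (\<lambda>_. 0)(m := Var z ^ (d - 1), z := - cofactor Var)"

lemma sum_line_coeff:
  assumes h: "ring_map h" and j: "j \<in> S"
  shows "(\<Sum>i\<in>UNIV. h (line_coeff j i) * y i) = line (\<lambda>i. h (Var i)) y j"
proof -
  have "(\<Sum>i\<in>UNIV. h (line_coeff j i) * y i) = (\<Sum>i\<in>{j, m, z}. h (line_coeff j i) * y i)"
    by (rule sum.mono_neutral_right) (auto simp: line_coeff_def ring_map_zero[OF h])
  then show ?thesis
    using j by (simp add: line_coeff_def line_def ring_map_simps[OF h] ring_map_data[OF h]
        ring_map_of_nat[OF h] algebra_simps)
qed

lemma sum_cross_coeff:
  assumes h: "ring_map h"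
  shows "(\<Sum>i\<in>UNIV. h (cross_coeff i) * y i) = cross (\<lambda>i. h (Var i)) y"
proof -
  have "(\<Sum>i\<in>UNIV. h (cross_coeff i) * y i) = (\<Sum>i\<in>{m, z}. h (cross_coeff i) * y i)"
    by (rule sum.mono_neutral_right) (auto simp: cross_coeff_def ring_map_zero[OF h])
  then show ?thesis
    by (simp add: cross_coeff_def cross_def ring_map_simps[OF h] ring_map_data[OF h])
qed

definition boundary :: "('n, 'k::field_char_0) mpoly" where
  "boundary = (\<Prod>j\<in>S. Var j)"

definition hypersurface :: "('n, 'k::field_char_0) mpoly" where
  "hypersurface = toric_mon Var - Var z ^ d"

definition divisor :: "('n, 'k::field_char_0) mpoly" where
  "divisor = hypersurface * boundary"

text \<open>The partial derivatives with index in \<open>S\<close>, together with \<open>h N\<close> and \<open>h z\<^sup>d\<^sup>-\<^sup>1\<close>. The last two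
  are the partial derivatives at \<open>m\<close> and \<open>z\<close> up to the factors \<open>s m\<close> and \<open>- d\<close>; the factor
  \<open>s m\<close> may be zero, so \<open>h N\<close> replaces the partial derivative.\<close>

definition gens :: "'n \<Rightarrow> ('n, 'k::field_char_0) mpoly" where
  "gens j = (if j = m then boundary * cofactor Var
             else if j = z then boundary * Var z ^ (d - 1) else partial_deriv j divisor)"

lemma partial_deriv_boundary:
  "i \<notin> S \<Longrightarrow> partial_deriv i boundary = 0"
  "i \<in> S \<Longrightarrow> Var i * partial_deriv i boundary = boundary"
  unfolding boundary_def
  using partial_deriv_monomial_other[of i S "\<lambda>_. 1"]
    Var_mult_partial_deriv_monomial[OF finite_S, of i "\<lambda>_. 1"] by simp_all

lemma partial_deriv_mon:
  "partial_deriv z (toric_mon Var) = 0" "partial_deriv m (toric_mon Var) = of_nat (s m) * cofactor Var"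
  unfolding mon_conv cofactor_def
  by (simp_all add: partial_deriv_mult partial_deriv_power partial_deriv_Var
      partial_deriv_monomial_other notin)

lemma partial_deriv_divisor_z: "partial_deriv z divisor = - of_nat d * (boundary * Var z ^ (d - 1))"
  by (simp add: divisor_def hypersurface_def partial_deriv_mult partial_deriv_diff partial_deriv_power
      partial_deriv_Var partial_deriv_boundary partial_deriv_mon notin mult_ac)

lemma partial_deriv_divisor_m: "partial_deriv m divisor = of_nat (s m) * (boundary * cofactor Var)"
  by (simp add: divisor_def hypersurface_def partial_deriv_mult partial_deriv_diff partial_deriv_power
      partial_deriv_Var partial_deriv_boundary partial_deriv_mon notin mult_ac)

lemma Var_mult_partial_deriv_divisor:
  assumes "j \<in> S"
  shows "Var j * partial_deriv j divisor = boundary * (of_nat (s j + 1) * toric_mon Var - Var z ^ d)"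
proof -
  have "Var j * partial_deriv j divisor = hypersurface * (Var j * partial_deriv j boundary)
      + boundary * (Var j * partial_deriv j hypersurface)"
    by (simp add: divisor_def partial_deriv_mult algebra_simps)
  also have "Var j * partial_deriv j hypersurface = of_nat (s j) * toric_mon Var"
    using Var_mult_partial_deriv_monomial[of UNIV j s] assms
    by (simp add: hypersurface_def toric_mon_def partial_deriv_diff partial_deriv_power partial_deriv_Var)
  finally show ?thesis
    using assms by (simp add: partial_deriv_boundary hypersurface_def algebra_simps)
qed

lemma line_gens:
  assumes "j \<in> S"
  shows "line Var gens j = 0"
proof -
  have "line Var gens j = boundary * (of_nat (s j + 1) * toric_mon Var - Var z ^ d)
      - (of_nat (s j + 1) * pivot Var * (boundary * cofactor Var)
         - Var z * (boundary * Var z ^ (d - 1)))"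
    using assms by (simp add: line_def gens_def Var_mult_partial_deriv_divisor del: of_nat_Suc)
  also have "\<dots> = 0"
    unfolding mult_power_pred pivot_cofactor[symmetric] by (simp add: algebra_simps)
  finally show ?thesis .
qed

lemma cross_gens: "cross Var gens = 0"
  by (simp add: cross_def gens_def)

lemma of_nat_inverse:
  assumes "k \<noteq> 0"
  obtains c :: "('n, 'k::field_char_0) mpoly" where "c * of_nat k = 1"
proof
  show "Const (inverse (of_nat k)) * of_nat k = (1 :: ('n, 'k) mpoly)"
    using assms by (simp add: of_nat_conv_Const ring_map_one[OF ring_map_Const]
        flip: ring_map_mult[OF ring_map_Const])
qed

text \<open>Only the membership of \<open>h N\<close> in the gradient ideal needs an argument when \<open>s m = 0\<close>. Then
  \<open>N = M\<close>, the set \<open>S\<close> is nonempty because \<open>d > 0\<close>, and for \<open>j \<in> S\<close> the element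
  \<open>x\<^sub>j \<partial>\<^sub>j f + z (h z\<^sup>d\<^sup>-\<^sup>1)\<close> equals \<open>(s j + 1) h M\<close>.\<close>

lemma gradient_ideal_divisor:
  "gradient_ideal divisor = (ideal_gen (range gens) :: ('n, 'k::field_char_0) mpoly set)"
proof
  let ?D = "\<lambda>j. partial_deriv j divisor :: ('n, 'k) mpoly"
  let ?J = "ideal_gen (range ?D)"
  have D: "?D j \<in> ?J" for j
    by (rule ideal_gen_base) simp
  obtain c :: "('n, 'k) mpoly" where c: "c * of_nat d = 1"
    using of_nat_inverse[of d] d_pos by blast
  have "boundary * Var z ^ (d - 1) = (c * of_nat d) * (boundary * Var z ^ (d - 1))"
    by (simp add: c)
  also have "\<dots> = - c * ?D z"
    by (simp add: partial_deriv_divisor_z mult_ac)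
  also have "\<dots> \<in> ?J"
    by (intro ideal_gen_mult_left D)
  finally have z: "boundary * Var z ^ (d - 1) \<in> ?J" .
  have m: "boundary * cofactor Var \<in> ?J"
  proof (cases "s m = 0")
    case False
    obtain c :: "('n, 'k) mpoly" where c: "c * of_nat (s m) = 1"
      using False by (rule of_nat_inverse)
    have "boundary * cofactor Var = (c * of_nat (s m)) * (boundary * cofactor Var)"
      by (simp add: c)
    also have "\<dots> = c * ?D m"
      by (simp add: partial_deriv_divisor_m mult_ac)
    also have "\<dots> \<in> ?J"
      by (intro ideal_gen_mult_left D)
    finally show ?thesis .
  next
    case True
    have "S \<noteq> {}"
    proof
      assume "S = {}"
      then have "sum s UNIV = 0"
        unfolding cover using True s_z by simp
      then show False
        using sum_s d_pos by simp
    qed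
    then obtain j where j: "j \<in> S"
      by blast
    obtain c :: "('n, 'k) mpoly" where c: "c * of_nat (s j + 1) = 1"
      by (rule of_nat_inverse[of "s j + 1"]) auto
    have "cofactor Var = (toric_mon Var :: ('n, 'k) mpoly)"
      using True by (simp add: pivot_def flip: pivot_cofactor)
    then have "boundary * cofactor Var = (c * of_nat (s j + 1)) * (boundary * toric_mon Var)"
      by (simp only: c mult_1)
    also have "\<dots> = c * (Var j * ?D j + Var z * (boundary * Var z ^ (d - 1)))"
      unfolding mult_power_pred by (simp add: Var_mult_partial_deriv_divisor[OF j] algebra_simps)
    also have "\<dots> \<in> ?J"
      by (intro ideal_gen_mult_left ideal_gen_add D z)
    finally show ?thesis .
  qed
  show "ideal_gen (range gens) \<subseteq> (gradient_ideal divisor :: ('n, 'k) mpoly set)"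
    unfolding gradient_ideal_def
  proof (rule ideal_gen_least, safe)
    fix j
    show "gens j \<in> ?J"
      using D z m by (auto simp: gens_def)
  qed
  have G: "gens j \<in> ideal_gen (range gens :: ('n, 'k) mpoly set)" for j
    by (rule ideal_gen_base) simp
  show "gradient_ideal divisor \<subseteq> ideal_gen (range gens :: ('n, 'k) mpoly set)"
    unfolding gradient_ideal_def
  proof (rule ideal_gen_least, safe)
    fix j
    consider "j = z" | "j = m" | "j \<in> S"
      using cover by auto
    then show "?D j \<in> ideal_gen (range gens)"
    proof cases
      case 1
      then show ?thesis
        using ideal_gen_mult_left[OF G[of z], of "- of_nat d"]
        by (simp add: partial_deriv_divisor_z gens_def)
    next
      case 2
      then show ?thesis
        using ideal_gen_mult_left[OF G[of m], of "of_nat (s m)"]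
        by (simp add: partial_deriv_divisor_m gens_def)
    next
      case 3
      then show ?thesis
        using G[of j] by (simp add: gens_def)
    qed
  qed
qed

theorem linear_type_divisor: "linear_type_divisor (divisor :: ('n, 'k::field_char_0) mpoly)"
  unfolding linear_type_divisor_def gradient_ideal_divisor
proof (rule linear_type_idealI)
  fix P :: "('n + 'n, 'k) mpoly"
  let ?R = "{linear_form a | a. (\<Sum>j\<in>UNIV. a j * gens j) = (0 :: ('n, 'k) mpoly)}"
  assume P: "blowup_map gens P = 0"
  have id: "ring_map (\<lambda>u :: ('n, 'k) mpoly. u)"
    by (simp add: ring_map_def)
  have "L j \<in> ?R" if "j \<in> S" for j
    by (rule CollectI, rule exI[of _ "line_coeff j"])
      (simp add: linear_form_def line_gens that sum_line_coeff[OF id that]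
        sum_line_coeff[OF ring_map_lift that])
  moreover have "cross X Y \<in> ?R"
    by (rule CollectI, rule exI[of _ cross_coeff])
      (simp add: linear_form_def cross_gens sum_cross_coeff[OF id]
        sum_cross_coeff[OF ring_map_lift])
  ultimately have "ideal_gen relations \<subseteq> ideal_gen ?R"
    by (intro ideal_gen_mono) auto
  moreover have "P \<in> ideal_gen relations"
    by (rule blowup_map_kernel[OF _ line_gens cross_gens P]) (simp_all add: gens_def boundary_def)
  ultimately show "P \<in> ideal_gen ?R"
    by blast
qed

end

section \<open>Prime indeterminates, squarefreeness and logarithmic derivations\<close>

lemma Var_dvd_iff: "Var i dvd p \<longleftrightarrow> coeff (in_var i p) 0 = 0"
proof
  assume "Var i dvd p"
  then obtain q where "p = Var i * q"
    by (elim dvdE)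
  then show "coeff (in_var i p) 0 = 0"
    by (simp add: in_var_Var coeff_monom_mult)
next
  assume 0: "coeff (in_var i p) 0 = 0"
  obtain a q where q: "in_var i p = pCons a q"
    by (rule pCons_cases)
  have "p = poly (in_var i p) (Var i)"
    by (simp add: poly_in_var)
  also have "\<dots> = Var i * poly q (Var i)"
    using 0 by (simp add: q)
  finally show "Var i dvd p"
    by (rule dvdI)
qed

lemma Var_not_dvd_free: "free_of i p \<Longrightarrow> p \<noteq> 0 \<Longrightarrow> \<not> Var i dvd p"
  by (simp add: Var_dvd_iff in_var_free)

lemma prime_elem_Var: "prime_elem (Var i :: ('i::linorder, 'a::idom) mpoly)"
  unfolding prime_elem_def
  by (auto simp: Var_dvd_iff coeff_mult_0)

lemma prime_power_dvd_mult_cancel: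
  fixes x :: "'a::idom"
  assumes x: "prime_elem x" "\<not> x dvd a" and "x ^ k dvd a * b"
  shows "x ^ k dvd b"
  using assms(3)
proof (induction k arbitrary: b)
  case (Suc k)
  then have "x dvd a * b"
    by (metis dvd_mult_left power_Suc)
  then obtain c where c: "b = x * c"
    using x prime_elem_dvd_multD by blast
  have "x * x ^ k dvd x * (a * c)"
    using Suc.prems by (simp add: c mult.left_commute)
  then have "x ^ k dvd a * c"
    using prime_elem_not_zeroI[OF x(1)] by simp
  then have "x ^ k dvd c"
    by (rule Suc.IH)
  then show ?case
    by (simp add: c)
qed simp

lemma squarefree_mult_prime:
  fixes x :: "'a::idom"
  assumes x: "prime_elem x" and f: "squarefree f" "\<not> x dvd f"
  shows "squarefree (x * f)"
  unfolding squarefree_def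
proof safe
  fix p
  assume p: "p ^ 2 dvd x * f"
  then obtain q where q: "x * f = p ^ 2 * q"
    by (elim dvdE)
  have x0: "x \<noteq> 0"
    by (rule prime_elem_not_zeroI[OF x])
  show "p dvd 1"
  proof (cases "x dvd p")
    case True
    then obtain r where r: "p = x * r"
      by (elim dvdE)
    have "x * f = x * (x * (r ^ 2 * q))"
      unfolding q r power2_eq_square by (simp only: mult_ac)
    then have "f = x * (r ^ 2 * q)"
      using x0 by simp
    then show ?thesis
      using f(2) by (simp add: dvd_def)
  next
    case False
    have "x dvd p ^ 2 * q"
      by (simp flip: q)
    then have "x dvd q"
      using prime_elem_dvd_multD[OF x] prime_elem_dvd_power[OF x] False by blast
    then obtain r where r: "q = x * r"
      by (elim dvdE)
    have "x * f = x * (p ^ 2 * r)"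
      unfolding q r by (simp only: mult_ac)
    then have "f = p ^ 2 * r"
      using x0 by simp
    then have "p ^ 2 dvd f"
      by (rule dvdI)
    then show ?thesis
      using f(1) by (simp add: squarefree_def)
  qed
qed

lemma log_derivations_iff: "\<theta> \<in> log_derivations F \<longleftrightarrow> \<theta> \<in> derivations \<and> F dvd \<theta> F"
  by (simp add: log_derivations_def ideal_gen_singleton)

text \<open>In \<open>\<theta>(x F) = x \<theta>(F) + F \<theta>(x)\<close> the prime \<open>x\<close> divides the second summand only if it divides
  \<open>\<theta>(x)\<close>; the rest is cancellation.\<close>

lemma log_derivations_mult_prime:
  fixes F :: "('i::linorder, 'a::idom) mpoly"
  assumes x: "prime_elem x" "\<not> x dvd F"
  shows "log_derivations (x * F) = log_derivations x \<inter> log_derivations F"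
proof (intro equalityI subsetI)
  fix \<theta>
  assume \<theta>: "\<theta> \<in> log_derivations (x * F)"
  then have der: "\<theta> \<in> derivations" and "x * F dvd x * \<theta> F + F * \<theta> x"
    by (auto simp: log_derivations_iff der_mult)
  then obtain q where q: "x * \<theta> F + F * \<theta> x = x * F * q"
    by (elim dvdE)
  have "F * \<theta> x = x * (F * q - \<theta> F)"
    using q by (simp add: algebra_simps)
  then have "x dvd F * \<theta> x"
    by (rule dvdI)
  then have "x dvd \<theta> x"
    using x prime_elem_dvd_multD by blast
  then obtain u where u: "\<theta> x = x * u"
    by (elim dvdE)
  have "x * \<theta> F = x * (F * (q - u))"
    using q by (simp add: u algebra_simps)
  then have "\<theta> F = F * (q - u)"
    using prime_elem_not_zeroI[OF x(1)] by simp
  then show "\<theta> \<in> log_derivations x \<inter> log_derivations F"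
    using der u by (simp add: log_derivations_iff)
next
  fix \<theta>
  assume "\<theta> \<in> log_derivations x \<inter> log_derivations F"
  then have der: "\<theta> \<in> derivations" and "x dvd \<theta> x" "F dvd \<theta> F"
    by (auto simp: log_derivations_iff)
  then show "\<theta> \<in> log_derivations (x * F)"
    by (simp add: log_derivations_iff der_mult mult.commute[of F] mult_dvd_mono)
qed

section \<open>Free modules of derivations\<close>

lemma free_moduleI:
  fixes b :: "'g::finite \<Rightarrow> 'm::ab_group_add" and scale :: "'r::comm_ring_1 \<Rightarrow> 'm \<Rightarrow> 'm"
  assumes mod: "module scale" and sub: "module.subspace scale M" and b: "\<And>i. b i \<in> M"
    and indep: "\<And>c. (\<Sum>i\<in>UNIV. scale (c i) (b i)) = 0 \<Longrightarrow> \<forall>i. c i = 0"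
    and gen: "\<And>x. x \<in> M \<Longrightarrow> \<exists>c. x = (\<Sum>i\<in>UNIV. scale (c i) (b i))"
  shows "free_module scale M"
proof -
  interpret module scale
    by (rule mod)
  have inj: "inj b"
  proof (rule injI, rule ccontr)
    fix i j
    assume ij: "b i = b j" "i \<noteq> j"
    let ?c = "\<lambda>k. (if k = i then 1 else 0) - (if k = j then 1 else 0) :: 'r"
    have "(\<Sum>k\<in>UNIV. scale (if k = l then 1 else 0) (b k)) = b l" for l
      by (simp add: if_distrib[of "\<lambda>c. scale c _"] cong: if_cong)
    then have "(\<Sum>k\<in>UNIV. scale (?c k) (b k)) = 0"
      by (simp add: scale_left_diff_distrib sum_subtractf ij(1))
    from indep[OF this] have "?c i = 0"
      by blast
    then show False
      using ij(2) by simp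
  qed
  have "\<not> dependent (range b)"
  proof
    assume "dependent (range b)"
    then obtain u where u: "\<exists>v\<in>range b. u v \<noteq> 0" "(\<Sum>v\<in>range b. scale (u v) v) = 0"
      by (auto simp: dependent_finite)
    have "(\<Sum>i\<in>UNIV. scale (u (b i)) (b i)) = 0"
      using u(2) inj by (simp add: sum.reindex)
    from indep[OF this] show False
      using u(1) by auto
  qed
  moreover have "span (range b) = M"
  proof
    show "span (range b) \<subseteq> M"
      by (rule span_minimal) (use b sub in auto)
    show "M \<subseteq> span (range b)"
      using gen by (force intro: span_sum span_scale span_base)
  qed
  ultimately show ?thesis
    unfolding free_module_def by blast
qed

lemma vector_field_conv: "\<theta> \<in> derivations \<Longrightarrow> \<theta> = vector_field (\<lambda>i. \<theta> (Var i))"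
  by (rule derivations_eqI) (simp_all add: vector_field_in_derivations vector_field_Var)

lemma der_combination_Var:
  "(\<Sum>i\<in>A. der_scale (c i) (vector_field (a i))) (Var k) = (\<Sum>i\<in>A. c i * a i k)"
  by (simp add: sum_apply der_scale_def vector_field_Var)

lemma der_combination_in_derivations:
  "(\<And>i. i \<in> A \<Longrightarrow> \<theta> i \<in> derivations) \<Longrightarrow> (\<Sum>i\<in>A. der_scale (c i) (\<theta> i)) \<in> derivations"
  by (intro der.subspace_sum der.subspace_scale subspace_derivations)

text \<open>A derivation is determined by its values on the indeterminates, so freeness is a statement
  about the coefficient matrix \<open>a\<close>.\<close>

lemma free_log_derivationsI:
  fixes F :: "('n::finite, 'a::comm_ring_1) mpoly" and a :: "'g::finite \<Rightarrow> 'n \<Rightarrow> ('n, 'a) mpoly"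
  assumes log: "\<And>i. vector_field (a i) \<in> log_derivations F"
    and indep: "\<And>c i. (\<And>k. (\<Sum>i\<in>UNIV. c i * a i k) = 0) \<Longrightarrow> c i = 0"
    and gen: "\<And>\<theta>. \<theta> \<in> log_derivations F \<Longrightarrow> \<exists>c. \<forall>k. \<theta> (Var k) = (\<Sum>i\<in>UNIV. c i * a i k)"
  shows "free_module der_scale (log_derivations F)"
proof (rule free_moduleI[OF module_der_scale subspace_log_derivations log])
  fix c :: "'g \<Rightarrow> ('n, 'a) mpoly"
  assume "(\<Sum>i\<in>UNIV. der_scale (c i) (vector_field (a i))) = 0"
  then have "(\<Sum>i\<in>UNIV. c i * a i k) = 0" for k
    using der_combination_Var[of c a UNIV k] by simp
  then show "\<forall>i. c i = 0"
    using indep by blast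
next
  fix \<theta> :: "('n, 'a) mpoly \<Rightarrow> ('n, 'a) mpoly"
  assume \<theta>: "\<theta> \<in> log_derivations F"
  then obtain c where c: "\<And>k. \<theta> (Var k) = (\<Sum>i\<in>UNIV. c i * a i k)"
    using gen by blast
  have "\<theta> = (\<Sum>i\<in>UNIV. der_scale (c i) (vector_field (a i)))"
    by (rule derivations_eqI)
      (use \<theta> in \<open>auto simp: log_derivations_iff der_combination_Var c
        intro!: der_combination_in_derivations vector_field_in_derivations\<close>)
  then show "\<exists>c. \<theta> = (\<Sum>i\<in>UNIV. der_scale (c i) (vector_field (a i)))"
    by blast
qed

context toric_data
begin

lemma sum_UNIV: "sum f UNIV = sum f S + f m + f z"
  unfolding cover by (simp add: notin add_ac)

lemma free_of_mon_Var [simp]: "free_of z (toric_mon Var)" "free_of z (cofactor Var)"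
  unfolding mon_conv cofactor_def by (auto intro!: free_of_simps(7,9) free_of_prod)

lemma free_of_mon_Var_exponent_zero: "s j = 0 \<Longrightarrow> free_of j (toric_mon Var)"
  unfolding toric_mon_def by (rule free_of_prod) (metis free_of_simps(3,4,9) power_0)

lemma mon_neq_zero [simp]: "toric_mon Var \<noteq> (0 :: ('n, 'k::field_char_0) mpoly)"
  and cofactor_neq_zero [simp]: "cofactor Var \<noteq> (0 :: ('n, 'k) mpoly)"
  and boundary_neq_zero [simp]: "boundary \<noteq> (0 :: ('n, 'k) mpoly)"
  by (simp_all add: toric_mon_def cofactor_def boundary_def)

lemma hypersurface_neq_zero [simp]: "hypersurface \<noteq> (0 :: ('n, 'k::field_char_0) mpoly)"
proof
  assume "hypersurface = (0 :: ('n, 'k) mpoly)"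
  then have "toric_mon Var = (Var z ^ d :: ('n, 'k) mpoly)"
    by (simp add: hypersurface_def)
  then have "Var z dvd (toric_mon Var :: ('n, 'k) mpoly)"
    using d_pos by simp
  then show False
    using Var_not_dvd_free[of z "toric_mon Var :: ('n, 'k) mpoly"] by simp
qed

lemma Var_not_dvd_hypersurface:
  assumes "j \<noteq> z"
  shows "\<not> Var j dvd (hypersurface :: ('n, 'k::field_char_0) mpoly)"
proof (cases "s j = 0")
  case True
  then have "free_of j (hypersurface :: ('n, 'k) mpoly)"
    unfolding hypersurface_def using assms
    by (intro free_of_simps(6,9) free_of_mon_Var_exponent_zero) auto
  then show ?thesis
    by (intro Var_not_dvd_free) auto
next
  case False
  have "Var j dvd (toric_mon Var :: ('n, 'k) mpoly)"
    unfolding toric_mon_def prod.remove[OF finite_UNIV UNIV_I, of _ j] using False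
    by (intro dvd_mult2 dvd_power) auto
  show ?thesis
  proof
    assume "Var j dvd (hypersurface :: ('n, 'k) mpoly)"
    then have "Var j dvd (toric_mon Var - hypersurface :: ('n, 'k) mpoly)"
      using \<open>Var j dvd toric_mon Var\<close> by (rule dvd_diff[rotated])
    then have "Var j dvd (Var z ^ d :: ('n, 'k) mpoly)"
      by (simp add: hypersurface_def)
    then have "Var j dvd (Var z :: ('n, 'k) mpoly)"
      by (rule prime_elem_dvd_power[OF prime_elem_Var])
    then show False
      using Var_not_dvd_free[of j "Var z :: ('n, 'k) mpoly"] assms by auto
  qed
qed

lemma dvd_of_nat_mult_cancel:
  fixes p q :: "('n, 'k::field_char_0) mpoly"
  assumes "k \<noteq> 0" "p dvd of_nat k * q"
  shows "p dvd q"
proof -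
  obtain c :: "('n, 'k) mpoly" where c: "c * of_nat k = 1"
    using assms(1) by (rule of_nat_inverse)
  have "p dvd c * (of_nat k * q)"
    using assms(2) by (rule dvd_mult)
  then show ?thesis
    by (simp only: c mult_1 flip: mult.assoc)
qed

text \<open>If \<open>p\<^sup>2\<close> divides \<open>g\<close>, then \<open>p\<close> divides both \<open>g\<close> and \<open>\<partial>\<^sub>z g = - d z\<^sup>d\<^sup>-\<^sup>1\<close>, hence the two coprime
  monomials \<open>z\<^sup>d\<^sup>-\<^sup>1\<close> and \<open>M\<close>.\<close>

lemma squarefree_hypersurface: "squarefree (hypersurface :: ('n, 'k::field_char_0) mpoly)"
  unfolding squarefree_def
proof safe
  fix p :: "('n, 'k) mpoly"
  let ?z = "Var z :: ('n, 'k) mpoly"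
  assume "p ^ 2 dvd hypersurface"
  then obtain q where "hypersurface = p ^ 2 * q"
    by (elim dvdE)
  then have q: "hypersurface = p * (p * q)"
    by (simp add: power2_eq_square mult.assoc)
  have "p dvd partial_deriv z hypersurface"
    unfolding q partial_deriv_mult by simp
  then have "p dvd of_nat d * ?z ^ (d - 1)"
    by (simp add: hypersurface_def partial_deriv_diff partial_deriv_mon partial_deriv_power
        partial_deriv_Var)
  then have p: "p dvd ?z ^ (d - 1)"
    by (rule dvd_of_nat_mult_cancel[rotated]) (use d_pos in simp)
  then have "p dvd ?z * ?z ^ (d - 1)"
    by (rule dvd_mult)
  then have "p dvd hypersurface + ?z ^ d"
    using mult_power_pred[of ?z 1] q by (intro dvd_add) auto
  then obtain b where b: "toric_mon Var = p * b"
    by (auto simp: hypersurface_def)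
  obtain a where a: "?z ^ (d - 1) = p * a"
    using p by (elim dvdE)
  have "toric_mon Var * a = ?z ^ (d - 1) * b"
    by (simp only: a b mult_ac)
  then have "?z ^ (d - 1) dvd toric_mon Var * a"
    by (rule dvdI)
  then have "?z ^ (d - 1) dvd a"
    by (rule prime_power_dvd_mult_cancel[OF prime_elem_Var, rotated])
      (simp add: Var_not_dvd_free)
  then obtain a' where a': "a = ?z ^ (d - 1) * a'"
    by (elim dvdE)
  have "?z ^ (d - 1) * (p * a') = p * (?z ^ (d - 1) * a')"
    by (simp only: mult_ac)
  also have "\<dots> = ?z ^ (d - 1) * 1"
    unfolding a'[symmetric] mult_1_right by (rule a[symmetric])
  finally have "1 = p * a'"
    by (simp only: mult_cancel_left) simp
  then show "p dvd 1"
    by (rule dvdI)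
qed

text \<open>Both claims follow by adjoining one prime factor at a time.\<close>

lemma hypersurface_mult_boundary_part:
  assumes "A \<subseteq> S"
  shows "squarefree (hypersurface * (\<Prod>j\<in>A. Var j) :: ('n, 'k::field_char_0) mpoly) \<and>
    log_derivations (hypersurface * (\<Prod>j\<in>A. Var j) :: ('n, 'k) mpoly) =
      log_derivations hypersurface \<inter> (\<Inter>j\<in>A. log_derivations (Var j))"
proof -
  have "finite A"
    by simp
  then show ?thesis
    using assms
  proof (induction A rule: finite_induct)
    case empty
    then show ?case
      by (simp add: squarefree_hypersurface)
  next
    case (insert j A)
    let ?F = "hypersurface * (\<Prod>j\<in>A. Var j) :: ('n, 'k) mpoly"
    have "free_of j (\<Prod>j\<in>A. Var j :: ('n, 'k) mpoly)"
      using insert by (intro free_of_prod) auto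
    then have "\<not> Var j dvd (\<Prod>j\<in>A. Var j :: ('n, 'k) mpoly)"
      by (rule Var_not_dvd_free) simp
    moreover have "\<not> Var j dvd (hypersurface :: ('n, 'k) mpoly)"
      using insert by (intro Var_not_dvd_hypersurface) auto
    ultimately have nd: "\<not> Var j dvd ?F"
      using prime_elem_dvd_multD[OF prime_elem_Var] by blast
    have eq: "hypersurface * (\<Prod>j\<in>insert j A. Var j) = Var j * ?F"
      using insert by (simp add: mult_ac)
    show ?case
      unfolding eq using insert.IH insert.prems
      by (auto simp: log_derivations_mult_prime[OF prime_elem_Var nd]
          intro: squarefree_mult_prime[OF prime_elem_Var _ nd])
  qed
qed

lemma squarefree_divisor: "squarefree (divisor :: ('n, 'k::field_char_0) mpoly)"
  unfolding divisor_def boundary_def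
  by (rule conjunct1[OF hypersurface_mult_boundary_part[OF order_refl]])

lemma log_derivations_divisor:
  "\<theta> \<in> log_derivations (divisor :: ('n, 'k::field_char_0) mpoly) \<longleftrightarrow>
     \<theta> \<in> derivations \<and> hypersurface dvd \<theta> hypersurface \<and> (\<forall>j\<in>S. Var j dvd \<theta> (Var j))"
proof -
  have "log_derivations (divisor :: ('n, 'k) mpoly) =
      log_derivations hypersurface \<inter> (\<Inter>j\<in>S. log_derivations (Var j))"
    unfolding divisor_def boundary_def
    by (rule conjunct2[OF hypersurface_mult_boundary_part[OF order_refl]])
  then show ?thesis
    by (auto simp: log_derivations_iff)
qed

lemma der_hypersurface:
  fixes \<theta> :: "('n, 'k::field_char_0) mpoly \<Rightarrow> ('n, 'k) mpoly"
  assumes \<theta>: "\<theta> \<in> derivations" and b: "\<And>j. j \<in> S \<Longrightarrow> \<theta> (Var j) = Var j * b j"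
  shows "\<theta> hypersurface = (\<Sum>j\<in>S. of_nat (s j) * b j) * toric_mon Var
    + of_nat (s m) * cofactor Var * \<theta> (Var m) - of_nat d * Var z ^ (d - 1) * \<theta> (Var z)"
proof -
  have S: "\<theta> (Var j) * partial_deriv j hypersurface = of_nat (s j) * b j * toric_mon Var" if "j \<in> S" for j
  proof -
    have "Var j * partial_deriv j hypersurface = (of_nat (s j) * toric_mon Var :: ('n, 'k) mpoly)"
      using Var_mult_partial_deriv_monomial[of UNIV j s] that
      by (simp add: hypersurface_def toric_mon_def partial_deriv_diff partial_deriv_power partial_deriv_Var)
    then have "b j * (Var j * partial_deriv j hypersurface) = b j * (of_nat (s j) * toric_mon Var)"
      by simp
    then show ?thesis
      by (simp add: b[OF that] mult_ac)
  qed
  have "\<theta> hypersurface = vector_field (\<lambda>i. \<theta> (Var i)) hypersurface"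
    by (simp flip: vector_field_conv[OF \<theta>])
  also have "\<dots> = (\<Sum>j\<in>S. of_nat (s j) * b j * toric_mon Var)
      + \<theta> (Var m) * partial_deriv m hypersurface + \<theta> (Var z) * partial_deriv z hypersurface"
    unfolding vector_field_def sum_UNIV by (simp add: S)
  also have "(\<Sum>j\<in>S. of_nat (s j) * b j * toric_mon Var) = (\<Sum>j\<in>S. of_nat (s j) * b j) * toric_mon Var"
    by (simp add: sum_distrib_right)
  also have "partial_deriv m hypersurface = of_nat (s m) * cofactor Var"
    by (simp add: hypersurface_def partial_deriv_diff partial_deriv_mon partial_deriv_power
        partial_deriv_Var)
  also have "partial_deriv z hypersurface = - (of_nat d * Var z ^ (d - 1))"
    by (simp add: hypersurface_def partial_deriv_diff partial_deriv_mon partial_deriv_power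
        partial_deriv_Var)
  finally show ?thesis
    by (simp add: mult_ac)
qed

definition inv_d :: "('n, 'k::field_char_0) mpoly" where
  "inv_d = Const (inverse (of_nat d))"

lemma inv_d: "inv_d * of_nat d = 1"
  unfolding inv_d_def using d_pos
  by (simp add: of_nat_conv_Const ring_map_one[OF ring_map_Const]
      flip: ring_map_mult[OF ring_map_Const])

text \<open>For \<open>i \<noteq> z\<close> these are the diagonal derivations. The last one annihilates \<open>g\<close> if \<open>m\<close> occurs in
  the monomial; otherwise that derivation would be a multiple of \<open>\<partial>\<^sub>m\<close>, which is then already
  in the list, and \<open>g \<partial>\<^sub>z\<close> takes its place.\<close>

definition basis :: "'n \<Rightarrow> 'n \<Rightarrow> ('n, 'k::field_char_0) mpoly" where
  "basis i = (if i = z then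
        if s m = 0 then (\<lambda>_. 0)(z := hypersurface)
        else (\<lambda>_. 0)(m := of_nat d * Var z ^ (d - 1), z := of_nat (s m) * cofactor Var)
      else (\<lambda>_. 0)(i := (if i = m then pivot Var else Var i), z := of_nat (s i) * inv_d * Var z))"

lemma basis_combination:
  "k \<in> S \<Longrightarrow> (\<Sum>i\<in>UNIV. c i * basis i k) = c k * Var k"
  "(\<Sum>i\<in>UNIV. c i * basis i m) = c m * pivot Var + c z * basis z m"
  "(\<Sum>i\<in>UNIV. c i * basis i z) =
     ((\<Sum>j\<in>S. of_nat (s j) * c j) + of_nat (s m) * c m) * inv_d * Var z + c z * basis z z"
proof -
  show "(\<Sum>i\<in>UNIV. c i * basis i k) = c k * Var k" if "k \<in> S"
  proof -
    have "(\<Sum>i\<in>S. c i * basis i k) = (\<Sum>i\<in>S. if i = k then c k * Var k else 0)"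
      by (rule sum.cong) (use that in \<open>auto simp: basis_def\<close>)
    then show ?thesis
      using that unfolding sum_UNIV by (simp add: basis_def)
  qed
  have "(\<Sum>i\<in>S. c i * basis i m) = 0"
    by (rule sum.neutral) (auto simp: basis_def)
  then show "(\<Sum>i\<in>UNIV. c i * basis i m) = c m * pivot Var + c z * basis z m"
    unfolding sum_UNIV by (simp add: basis_def)
  have "(\<Sum>i\<in>S. c i * basis i z) = (\<Sum>j\<in>S. of_nat (s j) * c j) * inv_d * Var z"
    unfolding sum_distrib_right by (rule sum.cong) (auto simp: basis_def mult_ac)
  then show "(\<Sum>i\<in>UNIV. c i * basis i z) =
     ((\<Sum>j\<in>S. of_nat (s j) * c j) + of_nat (s m) * c m) * inv_d * Var z + c z * basis z z"
    unfolding sum_UNIV by (simp add: basis_def algebra_simps)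
qed

text \<open>The normalisation of the diagonal derivations: the \<open>z\<close>-component \<open>(a/d) z\<close> acts on \<open>z\<^sup>d\<close> as
  multiplication by \<open>a\<close>.\<close>

lemma d_Var_z: "of_nat d * Var z ^ (d - 1) * (a * inv_d * Var z) = a * (Var z ^ d :: ('n, 'k::field_char_0) mpoly)"
proof -
  have "of_nat d * Var z ^ (d - 1) * (a * inv_d * Var z) =
      (inv_d * of_nat d) * (Var z * (a * Var z ^ (d - 1)))"
    by (simp only: mult_ac)
  then show ?thesis
    by (simp only: inv_d mult_power_pred mult_1)
qed

lemma basis_in_log_derivations:
  "vector_field (basis i) \<in> log_derivations (divisor :: ('n, 'k::field_char_0) mpoly)"
proof -
  let ?\<theta> = "vector_field (basis i) :: ('n, 'k) mpoly \<Rightarrow> ('n, 'k) mpoly"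
  have S: "\<And>j. j \<in> S \<Longrightarrow> ?\<theta> (Var j) = Var j * (if i = j then 1 else 0)"
    using notin by (auto simp: vector_field_Var basis_def)
  have "?\<theta> hypersurface = (\<Sum>j\<in>S. of_nat (s j) * (if i = j then 1 else 0)) * toric_mon Var
    + of_nat (s m) * cofactor Var * basis i m - of_nat d * Var z ^ (d - 1) * basis i z"
    using der_hypersurface[OF vector_field_in_derivations S] by (simp add: vector_field_Var)
  also have "hypersurface dvd \<dots>"
  proof -
    consider "i = z" "s m = 0" | "i = z" "s m \<noteq> 0" | "i = m" | "i \<in> S"
      using cover by auto
    then show ?thesis
    proof cases
      case 1
      have "(\<Sum>j\<in>S. of_nat (s j) * (if z = j then 1 else 0 :: ('n, 'k) mpoly)) = 0"
        by (rule sum.neutral) auto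
      then show ?thesis
        using 1 by (simp add: basis_def)
    next
      case 2
      have "(\<Sum>j\<in>S. of_nat (s j) * (if z = j then 1 else 0 :: ('n, 'k) mpoly)) = 0"
        by (rule sum.neutral) auto
      then show ?thesis
        using 2 by (simp add: basis_def mult_ac)
    next
      case 3
      have "(\<Sum>j\<in>S. of_nat (s j) * (if m = j then 1 else 0 :: ('n, 'k) mpoly)) = 0"
        by (rule sum.neutral) auto
      moreover have "of_nat (s m) * cofactor Var * basis m m - of_nat d * Var z ^ (d - 1) * basis m z
          = (hypersurface * of_nat (s m) :: ('n, 'k) mpoly)"
      proof -
        have e: "basis m m = (pivot Var :: ('n, 'k) mpoly)"
          "basis m z = (of_nat (s m) * inv_d * Var z :: ('n, 'k) mpoly)"
          by (simp_all add: basis_def)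
        show ?thesis
          unfolding e d_Var_z hypersurface_def pivot_cofactor[symmetric] by (simp add: algebra_simps)
      qed
      ultimately show ?thesis
        using 3 by simp
    next
      case 4
      have "(\<Sum>j\<in>S. of_nat (s j) * (if i = j then 1 else 0 :: ('n, 'k) mpoly)) = of_nat (s i)"
        using 4 by (simp add: if_distrib[of "\<lambda>t. _ * t"] cong: if_cong)
      moreover have "of_nat (s i) * toric_mon Var + of_nat (s m) * cofactor Var * basis i m
          - of_nat d * Var z ^ (d - 1) * basis i z = (hypersurface * of_nat (s i) :: ('n, 'k) mpoly)"
      proof -
        have e: "basis i m = (0 :: ('n, 'k) mpoly)"
          "basis i z = (of_nat (s i) * inv_d * Var z :: ('n, 'k) mpoly)"
          using 4 by (simp_all add: basis_def)
        show ?thesis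
          unfolding e d_Var_z hypersurface_def by (simp add: algebra_simps)
      qed
      ultimately show ?thesis
        by simp
    qed
  qed
  finally show ?thesis
    unfolding log_derivations_divisor using S by (auto simp: vector_field_in_derivations)
qed

text \<open>The coordinates in \<open>S\<close> give the vanishing of the coefficients with index in \<open>S\<close>. The
  remaining two-by-two matrix has determinant \<open>s m\<close> times \<open>g\<close>, or \<open>g\<close> if \<open>s m = 0\<close>.\<close>

lemma basis_independent:
  assumes c: "\<And>k. (\<Sum>i\<in>UNIV. c i * basis i k) = (0 :: ('n, 'k::field_char_0) mpoly)"
  shows "c i = 0"
proof -
  have S: "c k = 0" if "k \<in> S" for k
    using c[of k] by (simp add: basis_combination(1)[OF that])
  have m: "c m * pivot Var + c z * basis z m = 0"
    using c[of m] by (simp only: basis_combination)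
  have z: "of_nat (s m) * c m * inv_d * Var z + c z * basis z z = 0"
    using c[of z] S by (simp add: basis_combination)
  have "c m = 0 \<and> c z = 0"
  proof (cases "s m = 0")
    case True
    then show ?thesis
      using m z by (simp add: basis_def pivot_def)
  next
    case False
    have "c z * (of_nat (s m) * hypersurface) =
        (of_nat (s m) * c m * inv_d * Var z + c z * basis z z) * pivot Var
        - (c m * pivot Var + c z * basis z m) * (of_nat (s m) * inv_d * Var z)
        + c z * (of_nat d * Var z ^ (d - 1) * (of_nat (s m) * inv_d * Var z)
        - of_nat (s m) * Var z ^ d)"
      using False by (simp add: basis_def hypersurface_def algebra_simps flip: pivot_cofactor)
    also have "\<dots> = 0"
      unfolding m z d_Var_z by simp
    finally have "c z = 0"
      using False by simp
    then show ?thesis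
      using m by (simp add: pivot_def split: if_splits)
  qed
  then show ?thesis
    using S[of i] cover by (cases "i \<in> S") auto
qed

text \<open>Subtracting diagonal derivations with index in \<open>S\<close> leaves \<open>\<theta>(x\<^sub>m)\<close> and a modified
  \<open>z\<close>-component \<open>y\<close> with \<open>s\<^sub>m N \<theta>(x\<^sub>m) - d z\<^sup>d\<^sup>-\<^sup>1 y = g t\<close>. If \<open>s m = 0\<close>, then \<open>z\<^sup>d\<^sup>-\<^sup>1\<close> divides \<open>M t\<close>, hence
  \<open>t\<close>, and \<open>y\<close> is a multiple of \<open>g\<close>. Otherwise a multiple of the diagonal derivation at \<open>m\<close>
  reduces to \<open>t = 0\<close>, and then \<open>z\<^sup>d\<^sup>-\<^sup>1\<close>, being prime to \<open>N\<close>, divides the \<open>m\<close>-component.\<close>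

lemma basis_generates:
  fixes \<theta> :: "('n, 'k::field_char_0) mpoly \<Rightarrow> ('n, 'k) mpoly"
  assumes "\<theta> \<in> log_derivations divisor"
  shows "\<exists>c. \<forall>k. \<theta> (Var k) = (\<Sum>i\<in>UNIV. c i * basis i k)"
proof -
  let ?z = "Var z :: ('n, 'k) mpoly"
  have \<theta>: "\<theta> \<in> derivations" and g: "hypersurface dvd \<theta> hypersurface"
    and "\<forall>j\<in>S. \<exists>b. \<theta> (Var j) = Var j * b"
    using assms by (auto simp: log_derivations_divisor dvd_def)
  then obtain b where b: "\<And>j. j \<in> S \<Longrightarrow> \<theta> (Var j) = Var j * b j"
    by metis
  obtain u where u: "\<theta> hypersurface = hypersurface * u"
    using g by (elim dvdE)
  define \<sigma> where "\<sigma> = (\<Sum>j\<in>S. of_nat (s j) * b j)"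
  define t where "t = u - \<sigma>"
  define y where "y = \<theta> (Var z) - \<sigma> * inv_d * ?z"
  have eq: "of_nat (s m) * cofactor Var * \<theta> (Var m) - of_nat d * ?z ^ (d - 1) * y = hypersurface * t"
  proof -
    have "\<sigma> * toric_mon Var + of_nat (s m) * cofactor Var * \<theta> (Var m)
        - of_nat d * ?z ^ (d - 1) * \<theta> (Var z) = hypersurface * u"
      using der_hypersurface[OF \<theta> b] u by (simp add: \<sigma>_def)
    moreover have "of_nat d * ?z ^ (d - 1) * y
        = of_nat d * ?z ^ (d - 1) * \<theta> (Var z) - \<sigma> * ?z ^ d"
      unfolding y_def right_diff_distrib d_Var_z ..
    ultimately show ?thesis
      by (simp add: t_def hypersurface_def algebra_simps)
  qed
  have "\<exists>p q. \<theta> (Var m) = p * pivot Var + q * basis z m \<and>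
      y = of_nat (s m) * p * inv_d * ?z + q * basis z z"
  proof (cases "s m = 0")
    case True
    have "toric_mon Var * t = ?z ^ d * t - of_nat d * ?z ^ (d - 1) * y"
      using eq True by (simp add: hypersurface_def algebra_simps)
    also have "?z ^ d * t = ?z ^ (d - 1) * (?z * t)"
      using mult_power_pred[of ?z t] by (simp only: mult_ac)
    also have "?z ^ (d - 1) * (?z * t) - of_nat d * ?z ^ (d - 1) * y
        = ?z ^ (d - 1) * (?z * t - of_nat d * y)"
      unfolding right_diff_distrib by (simp only: mult_ac)
    finally have "?z ^ (d - 1) dvd toric_mon Var * t"
      by (rule dvdI)
    then have "?z ^ (d - 1) dvd t"
      by (rule prime_power_dvd_mult_cancel[OF prime_elem_Var, rotated])
        (simp add: Var_not_dvd_free)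
    then obtain t' where t': "t = ?z ^ (d - 1) * t'"
      by (elim dvdE)
    have "?z ^ (d - 1) * (- (of_nat d * y)) = ?z ^ (d - 1) * (hypersurface * t')"
      using eq True by (simp add: t' mult_ac)
    then have dy: "- (of_nat d * y) = hypersurface * t'"
      by (simp only: mult_cancel_left) simp
    have "y = (inv_d * of_nat d) * y"
      by (simp only: inv_d mult_1)
    also have "\<dots> = - inv_d * (- (of_nat d * y))"
      by (simp add: mult.assoc)
    also have "\<dots> = - (inv_d * t') * hypersurface"
      unfolding dy by (simp add: mult_ac)
    finally have "y = - (inv_d * t') * hypersurface" .
    then show ?thesis
      using True by (intro exI[of _ "\<theta> (Var m)"] exI[of _ "- (inv_d * t')"])
        (simp add: basis_def pivot_def)
  next
    case False
    obtain e :: "('n, 'k) mpoly" where e: "e * of_nat (s m) = 1"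
      using False by (rule of_nat_inverse)
    define x where "x = \<theta> (Var m) - t * e * pivot Var"
    define y' where "y' = y - t * inv_d * ?z"
    have "of_nat (s m) * cofactor Var * (t * e * pivot Var) = (e * of_nat (s m)) * (t * (pivot Var * cofactor Var))"
      by (simp only: mult_ac)
    also have "\<dots> = t * toric_mon Var"
      by (simp add: e pivot_cofactor)
    finally have me: "of_nat (s m) * cofactor Var * (t * e * pivot Var) = t * toric_mon Var" .
    have "of_nat (s m) * cofactor Var * x - of_nat d * ?z ^ (d - 1) * y' = 0"
      unfolding x_def y'_def right_diff_distrib d_Var_z me using eq
      by (simp add: hypersurface_def algebra_simps)
    then have xy: "of_nat (s m) * cofactor Var * x = ?z ^ (d - 1) * (of_nat d * y')"
      by (simp add: mult_ac)
    then have "?z ^ (d - 1) dvd of_nat (s m) * cofactor Var * x"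
      by (rule dvdI)
    then have "?z ^ (d - 1) dvd x"
      by (rule prime_power_dvd_mult_cancel[OF prime_elem_Var, rotated])
        (use False in \<open>simp add: Var_not_dvd_free\<close>)
    then obtain w where w: "x = ?z ^ (d - 1) * w"
      by (elim dvdE)
    have "?z ^ (d - 1) * (of_nat (s m) * cofactor Var * w) = ?z ^ (d - 1) * (of_nat d * y')"
      unfolding xy[symmetric] w by (simp only: mult_ac)
    then have dy': "of_nat (s m) * cofactor Var * w = of_nat d * y'"
      by (simp only: mult_cancel_left) simp
    have "y' = (inv_d * of_nat d) * y'"
      by (simp only: inv_d mult_1)
    also have "\<dots> = inv_d * (of_nat (s m) * cofactor Var * w)"
      unfolding dy' by (simp only: mult.assoc)
    finally have y': "y' = inv_d * w * (of_nat (s m) * cofactor Var)"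
      by (simp only: mult_ac)
    have "x = (inv_d * of_nat d) * x"
      by (simp only: inv_d mult_1)
    then have x: "x = inv_d * w * (of_nat d * ?z ^ (d - 1))"
      unfolding w by (simp only: mult_ac)
    have "of_nat (s m) * (t * e) * inv_d * ?z = (e * of_nat (s m)) * (t * inv_d * ?z)"
      by (simp only: mult_ac)
    then have "of_nat (s m) * (t * e) * inv_d * ?z = t * inv_d * ?z"
      by (simp only: e mult_1)
    then show ?thesis
      using x y' False by (intro exI[of _ "t * e"] exI[of _ "inv_d * w"])
        (simp add: basis_def x_def y'_def algebra_simps)
  qed
  then obtain p q where p: "\<theta> (Var m) = p * pivot Var + q * basis z m"
    and q: "y = of_nat (s m) * p * inv_d * ?z + q * basis z z"
    by blast
  define c where "c = b(m := p, z := q)"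
  have cS: "(\<Sum>j\<in>S. of_nat (s j) * c j) = \<sigma>"
    unfolding \<sigma>_def by (rule sum.cong) (auto simp: c_def)
  have "\<theta> (Var k) = (\<Sum>i\<in>UNIV. c i * basis i k)" for k
  proof -
    consider "k \<in> S" | "k = m" | "k = z"
      using cover by auto
    then show ?thesis
    proof cases
      case 1
      then show ?thesis
        unfolding basis_combination(1)[OF 1] by (simp add: b c_def mult.commute)
    next
      case 2
      then show ?thesis
        unfolding 2 basis_combination(2) by (simp add: p c_def)
    next
      case 3
      have "\<theta> (Var z) = \<sigma> * inv_d * ?z + y"
        by (simp add: y_def)
      then show ?thesis
        unfolding 3 basis_combination(3) cS by (simp add: q c_def algebra_simps)
    qed
  qed
  then show ?thesis
    by blast
qed

theorem free_divisor: "free_divisor (divisor :: ('n, 'k::field_char_0) mpoly)"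
  unfolding free_divisor_def
proof (intro conjI squarefree_divisor free_log_derivationsI)
  show "vector_field (basis i) \<in> log_derivations (divisor :: ('n, 'k) mpoly)" for i
    by (rule basis_in_log_derivations)
qed (rule basis_independent basis_generates, assumption)+

end

section \<open>The hypersurface hypersurface is not free\<close>

text \<open>Elimination without division, so that it works over any domain: a pivot \<open>A i k\<close> is cleared
  by cross multiplication, and the solution of the smaller system is scaled by the pivot.\<close>

lemma homogeneous_system_solvable:
  fixes A :: "'i \<Rightarrow> 'j \<Rightarrow> 'a::idom"
  assumes "finite I" "finite J" "card I < card J"
  shows "\<exists>c. (\<exists>j\<in>J. c j \<noteq> 0) \<and> (\<forall>i\<in>I. (\<Sum>j\<in>J. A i j * c j) = 0)"
  using assms
proof (induction I arbitrary: J A rule: finite_induct)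
  case empty
  then have "J \<noteq> {}"
    by auto
  then show ?case
    by (intro exI[of _ "\<lambda>_. 1"]) auto
next
  case (insert i I)
  show ?case
  proof (cases "\<forall>j\<in>J. A i j = 0")
    case True
    have "card I < card J"
      using insert by simp
    then obtain c where "\<exists>j\<in>J. c j \<noteq> 0" "\<forall>i\<in>I. (\<Sum>j\<in>J. A i j * c j) = 0"
      using insert.IH[OF insert.prems(1), of A] by blast
    then show ?thesis
      using True by (intro exI[of _ c]) simp
  next
    case False
    then obtain k where k: "k \<in> J" "A i k \<noteq> 0"
      by blast
    let ?K = "J - {k}"
    have "card I < card ?K"
      using insert k by simp
    then obtain c where c: "\<exists>j\<in>?K. c j \<noteq> 0"
        "\<forall>l\<in>I. (\<Sum>j\<in>?K. (A i k * A l j - A l k * A i j) * c j) = 0"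
      using insert.IH[of ?K "\<lambda>l j. A i k * A l j - A l k * A i j"] insert.prems(1) by blast
    define e where "e j = (if j = k then - (\<Sum>j\<in>?K. A i j * c j) else A i k * c j)" for j
    have split: "(\<Sum>j\<in>J. A l j * e j)
        = A i k * (\<Sum>j\<in>?K. A l j * c j) - A l k * (\<Sum>j\<in>?K. A i j * c j)" for l
    proof -
      have "(\<Sum>j\<in>?K. A l j * e j) = A i k * (\<Sum>j\<in>?K. A l j * c j)"
        unfolding sum_distrib_left by (rule sum.cong) (auto simp: e_def mult_ac)
      then show ?thesis
        unfolding sum.remove[OF insert.prems(1) k(1)] by (simp add: e_def)
    qed
    have "\<exists>j\<in>J. e j \<noteq> 0"
      using c(1) k by (auto simp: e_def)
    moreover have "(\<Sum>j\<in>J. A l j * e j) = 0" if "l \<in> insert i I" for l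
    proof (cases "l = i")
      case False
      then have "(\<Sum>j\<in>?K. (A i k * A l j - A l k * A i j) * c j) = 0"
        using c(2) that by blast
      then show ?thesis
        unfolding split
        by (simp add: left_diff_distrib sum_subtractf sum_distrib_left mult.assoc)
    qed (simp add: split)
    ultimately show ?thesis
      by blast
  qed
qed

lemma independent_derivations_card:
  fixes B :: "(('n::{finite,linorder}, 'a::idom) mpoly \<Rightarrow> ('n, 'a) mpoly) set"
  assumes B: "B \<subseteq> derivations" and indep: "\<not> der.dependent B"
  shows "finite B \<and> card B \<le> card (UNIV :: 'n set)"
proof (rule ccontr)
  assume big: "\<not> (finite B \<and> card B \<le> card (UNIV :: 'n set))"
  have "\<exists>C. finite C \<and> C \<subseteq> B \<and> card C = Suc (card (UNIV :: 'n set))"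
  proof (cases "finite B")
    case True
    then have "Suc (card (UNIV :: 'n set)) \<le> card B"
      using big by simp
    then show ?thesis
      by (rule obtain_subset_with_card_n) blast
  next
    case False
    then show ?thesis
      using infinite_arbitrarily_large[of B "Suc (card (UNIV :: 'n set))"] by blast
  qed
  then obtain C where C: "finite C" "C \<subseteq> B" "card C = Suc (card (UNIV :: 'n set))"
    by blast
  have "\<exists>u. (\<exists>b\<in>C. u b \<noteq> 0) \<and> (\<forall>i\<in>UNIV. (\<Sum>b\<in>C. b (Var i) * u b) = 0)"
    by (rule homogeneous_system_solvable[where A = "\<lambda>i b. b (Var i)"]) (simp_all add: C)
  then obtain u where
    u: "(\<exists>b\<in>C. u b \<noteq> 0) \<and> (\<forall>i\<in>UNIV. (\<Sum>b\<in>C. b (Var i) * u b) = 0)" ..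
  have "(\<Sum>b\<in>C. der_scale (u b) b) = 0"
  proof (rule derivations_eqI)
    show "(\<Sum>b\<in>C. der_scale (u b) b) \<in> derivations"
      using C(2) B by (intro der_combination_in_derivations) auto
    show "0 \<in> derivations"
      by (rule der.subspace_0[OF subspace_derivations])
    show "(\<Sum>b\<in>C. der_scale (u b) b) (Var i) = 0 (Var i)" for i
      using bspec[OF conjunct2[OF u] UNIV_I, of i]
      by (simp add: sum_apply der_scale_def mult.commute)
  qed
  then show False
    using indep C(1,2) conjunct1[OF u] unfolding der.dependent_explicit by blast
qed

lemma lookup_single_mult:
  "Poly_Mapping.lookup (Poly_Mapping.single \<alpha> c * p) (\<alpha> + \<beta>) = c * Poly_Mapping.lookup p \<beta>"
  for p :: "('i, 'a::comm_ring_1) mpoly"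
proof -
  let ?s = "\<lambda>\<mu>. Poly_Mapping.single \<mu> (Poly_Mapping.lookup p \<mu>)"
  have "Poly_Mapping.single \<alpha> c * p = Poly_Mapping.single \<alpha> c * (\<Sum>\<mu>\<in>Poly_Mapping.keys p. ?s \<mu>)"
    by (simp flip: mpoly_eq_sum_single)
  then show ?thesis
    by (simp add: sum_distrib_left mult_single lookup_sum lookup_single when_def
        not_in_keys_iff_lookup_eq_zero)
qed

lemma lookup_single_mult_eq_zero:
  fixes \<alpha> \<nu> :: "'i \<Rightarrow>\<^sub>0 nat"
  assumes "Poly_Mapping.lookup \<nu> i < Poly_Mapping.lookup \<alpha> i"
  shows "Poly_Mapping.lookup (Poly_Mapping.single \<alpha> c * p) \<nu> = (0 :: 'a::comm_ring_1)"
proof -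
  let ?s = "\<lambda>\<mu>. Poly_Mapping.single \<mu> (Poly_Mapping.lookup p \<mu>)"
  have "Poly_Mapping.single \<alpha> c * p = Poly_Mapping.single \<alpha> c * (\<Sum>\<mu>\<in>Poly_Mapping.keys p. ?s \<mu>)"
    by (simp flip: mpoly_eq_sum_single)
  moreover have "\<alpha> + \<mu> \<noteq> \<nu>" for \<mu>
    using assms by (auto simp: lookup_add)
  ultimately show ?thesis
    by (simp add: sum_distrib_left mult_single lookup_sum lookup_single when_def)
qed

text \<open>If \<open>\<tau>\<close> is minimal for divisibility among the monomials that can occur in \<open>a\<close>, then only the
  constant term of \<open>p\<close> contributes to the coefficient of \<open>p a\<close> at \<open>\<tau>\<close>.\<close>

lemma lookup_mult_least:
  fixes a p :: "('i, 'a::comm_ring_1) mpoly"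
  assumes "\<And>\<beta> \<gamma>. \<tau> = \<gamma> + \<beta> \<Longrightarrow> \<beta> \<noteq> \<tau> \<Longrightarrow> Poly_Mapping.lookup a \<beta> = 0"
  shows "Poly_Mapping.lookup (p * a) \<tau> = Poly_Mapping.lookup p 0 * Poly_Mapping.lookup a \<tau>"
proof -
  let ?s = "\<lambda>\<mu>. Poly_Mapping.single \<mu> (Poly_Mapping.lookup p \<mu>)"
  have summand: "Poly_Mapping.lookup (?s \<mu> * a) \<tau>
      = (if \<mu> = 0 then Poly_Mapping.lookup p 0 * Poly_Mapping.lookup a \<tau> else 0)" for \<mu>
  proof (cases "\<exists>\<beta>. \<tau> = \<mu> + \<beta>")
    case True
    then obtain \<beta> where \<beta>: "\<tau> = \<mu> + \<beta>"
      by blast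
    then have "Poly_Mapping.lookup (?s \<mu> * a) \<tau> = Poly_Mapping.lookup p \<mu> * Poly_Mapping.lookup a \<beta>"
      by (simp add: lookup_single_mult)
    then show ?thesis
      using assms[OF \<beta>] \<beta> by (cases "\<mu> = 0") auto
  next
    case False
    have "\<exists>i. Poly_Mapping.lookup \<tau> i < Poly_Mapping.lookup \<mu> i"
    proof (rule ccontr)
      assume "\<not> ?thesis"
      then have "\<tau> = \<mu> + (\<tau> - \<mu>)"
        by (intro poly_mapping_eqI) (simp add: lookup_add lookup_minus not_less)
      then show False
        using False by blast
    qed
    then show ?thesis
      using False by (auto simp: lookup_single_mult_eq_zero)
  qed
  have "p * a = (\<Sum>\<mu>\<in>Poly_Mapping.keys p. ?s \<mu>) * a"
    by (simp flip: mpoly_eq_sum_single)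
  then show ?thesis
    by (simp add: sum_distrib_right lookup_sum summand in_keys_iff)
qed

context toric_data
begin

definition exponent :: "'n \<Rightarrow>\<^sub>0 nat" where
  "exponent = Abs_poly_mapping s"

definition exponent_minus :: "'n \<Rightarrow> 'n \<Rightarrow>\<^sub>0 nat" where
  "exponent_minus k = exponent - Poly_Mapping.single k 1"

lemma lookup_exponent [simp]: "Poly_Mapping.lookup exponent i = s i"
  by (simp add: exponent_def)

lemma lookup_exponent_minus [simp]:
  "Poly_Mapping.lookup (exponent_minus k) i = (if i = k then s i - 1 else s i)"
  by (auto simp: exponent_minus_def lookup_minus lookup_single)

lemma mon_conv_single: "toric_mon Var = (Poly_Mapping.single exponent 1 :: ('n, 'k::field_char_0) mpoly)"
  by (simp add: single_conv_monomial_value monomial_value_superset[of UNIV] toric_mon_def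
      ring_map_one[OF ring_map_Const])

lemma partial_deriv_mon_single:
  "partial_deriv k (toric_mon Var) = (Poly_Mapping.single (exponent_minus k) (of_nat (s k)) :: ('n, 'k::field_char_0) mpoly)"
  by (simp add: mon_conv_single partial_deriv_single exponent_minus_def)

lemma Var_power_conv_single:
  "Var i ^ k = (Poly_Mapping.single (Poly_Mapping.single i k) 1 :: ('n, 'k::field_char_0) mpoly)"
  by (simp add: single_conv_monomial_value monomial_value_single ring_map_one[OF ring_map_Const])

lemma der_hypersurface_conv:
  fixes \<theta> :: "('n, 'k::field_char_0) mpoly \<Rightarrow> ('n, 'k) mpoly"
  assumes "\<theta> \<in> derivations"
  shows "\<theta> hypersurface =
    (\<Sum>k\<in>UNIV - {z}. Poly_Mapping.single (exponent_minus k) (of_nat (s k)) * \<theta> (Var k))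
    - Poly_Mapping.single (Poly_Mapping.single z (d - 1)) (of_nat d) * \<theta> (Var z)"
proof -
  have k: "partial_deriv k hypersurface = (Poly_Mapping.single (exponent_minus k) (of_nat (s k)) :: ('n, 'k) mpoly)"
    if "k \<noteq> z" for k
    using that by (simp add: hypersurface_def partial_deriv_diff partial_deriv_mon_single
        partial_deriv_power partial_deriv_Var)
  have "of_nat d * Var z ^ (d - 1) =
      (Poly_Mapping.single (Poly_Mapping.single z (d - 1)) (of_nat d) :: ('n, 'k) mpoly)"
    by (simp only: Var_power_conv_single of_nat_conv_Const Const_def mult_single) simp
  then have z: "partial_deriv z hypersurface =
      - (Poly_Mapping.single (Poly_Mapping.single z (d - 1)) (of_nat d) :: ('n, 'k) mpoly)"
    by (simp add: hypersurface_def partial_deriv_diff partial_deriv_mon partial_deriv_power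
        partial_deriv_Var)
  have "\<theta> hypersurface = vector_field (\<lambda>i. \<theta> (Var i)) hypersurface"
    by (simp flip: vector_field_conv[OF assms])
  also have "\<dots> = \<theta> (Var z) * partial_deriv z hypersurface
      + (\<Sum>k\<in>UNIV - {z}. \<theta> (Var k) * partial_deriv k hypersurface)"
    unfolding vector_field_def by (rule sum.remove) auto
  also have "(\<Sum>k\<in>UNIV - {z}. \<theta> (Var k) * partial_deriv k hypersurface) =
      (\<Sum>k\<in>UNIV - {z}. Poly_Mapping.single (exponent_minus k) (of_nat (s k)) * \<theta> (Var k))"
    by (rule sum.cong) (simp_all add: k mult.commute)
  finally show ?thesis
    by (simp add: z mult.commute)
qed

context
  fixes \<theta> :: "('n, 'k::field_char_0) mpoly \<Rightarrow> ('n, 'k) mpoly"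
  assumes \<theta>: "\<theta> \<in> log_derivations hypersurface" and d2: "d \<ge> 2"
begin

text \<open>The coefficients of both sides of \<open>\<theta>(g) = c g\<close>.\<close>

lemma lookup_log_derivation:
  obtains c where "\<And>\<nu>. (\<Sum>k\<in>UNIV - {z}. Poly_Mapping.lookup
        (Poly_Mapping.single (exponent_minus k) (of_nat (s k)) * \<theta> (Var k)) \<nu>)
      - Poly_Mapping.lookup (Poly_Mapping.single (Poly_Mapping.single z (d - 1)) (of_nat d) * \<theta> (Var z)) \<nu>
      = Poly_Mapping.lookup (Poly_Mapping.single exponent 1 * c) \<nu>
        - Poly_Mapping.lookup (Poly_Mapping.single (Poly_Mapping.single z d) 1 * c) \<nu>"
proof -
  obtain c where c: "\<theta> hypersurface = hypersurface * c"
    using \<theta> by (auto simp: log_derivations_iff)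
  have der: "\<theta> \<in> derivations"
    using \<theta> by (simp add: log_derivations_iff)
  have "hypersurface * c = Poly_Mapping.single exponent 1 * c - Poly_Mapping.single (Poly_Mapping.single z d) 1 * c"
    by (simp add: hypersurface_def mon_conv_single Var_power_conv_single left_diff_distrib)
  then have "Poly_Mapping.lookup (\<theta> hypersurface) \<nu> = Poly_Mapping.lookup (Poly_Mapping.single exponent 1 * c) \<nu>
        - Poly_Mapping.lookup (Poly_Mapping.single (Poly_Mapping.single z d) 1 * c) \<nu>" for \<nu>
    by (simp add: c lookup_minus)
  then show ?thesis
    using that unfolding der_hypersurface_conv[OF der] lookup_minus lookup_sum by blast
qed

text \<open>Compare coefficients at \<open>M/x\<^sub>k\<close>. This monomial is divisible neither by \<open>M/x\<^sub>l\<close> with \<open>l \<noteq> k\<close>, nor by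
  \<open>M\<close>, nor, as \<open>d \<ge> 2\<close>, by \<open>z\<^sup>d\<^sup>-\<^sup>1\<close>, so that only the constant term of \<open>\<theta>(x\<^sub>k)\<close> remains.\<close>

lemma log_derivation_no_constant:
  assumes k: "k \<noteq> z" "s k > 0"
  shows "Poly_Mapping.lookup (\<theta> (Var k)) 0 = 0"
proof -
  let ?\<nu> = "exponent_minus k"
  obtain c where c: "\<And>\<nu>. (\<Sum>k\<in>UNIV - {z}. Poly_Mapping.lookup
        (Poly_Mapping.single (exponent_minus k) (of_nat (s k)) * \<theta> (Var k)) \<nu>)
      - Poly_Mapping.lookup (Poly_Mapping.single (Poly_Mapping.single z (d - 1)) (of_nat d) * \<theta> (Var z)) \<nu>
      = Poly_Mapping.lookup (Poly_Mapping.single exponent 1 * c) \<nu>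
        - Poly_Mapping.lookup (Poly_Mapping.single (Poly_Mapping.single z d) 1 * c) \<nu>"
    by (rule lookup_log_derivation) blast
  have "Poly_Mapping.lookup (Poly_Mapping.single (exponent_minus l) (of_nat (s l)) * \<theta> (Var l)) ?\<nu>
      = (if l = k then of_nat (s k) * Poly_Mapping.lookup (\<theta> (Var k)) 0 else 0)" for l
    using lookup_single_mult[of "exponent_minus k" "of_nat (s k)" "\<theta> (Var k)" 0] k
    by (auto intro!: lookup_single_mult_eq_zero[of _ k])
  then have "(\<Sum>l\<in>UNIV - {z}. Poly_Mapping.lookup
        (Poly_Mapping.single (exponent_minus l) (of_nat (s l)) * \<theta> (Var l)) ?\<nu>)
      = of_nat (s k) * Poly_Mapping.lookup (\<theta> (Var k)) 0"
    using k by simp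
  moreover have "Poly_Mapping.lookup (Poly_Mapping.single (Poly_Mapping.single z (d - 1)) (of_nat d) * \<theta> (Var z)) ?\<nu> = 0"
    using d2 k s_z by (intro lookup_single_mult_eq_zero[of _ z]) simp
  moreover have "Poly_Mapping.lookup (Poly_Mapping.single exponent 1 * c) ?\<nu> = 0"
    using k by (intro lookup_single_mult_eq_zero[of _ k]) simp
  moreover have "Poly_Mapping.lookup (Poly_Mapping.single (Poly_Mapping.single z d) 1 * c) ?\<nu> = 0"
    using d2 k s_z by (intro lookup_single_mult_eq_zero[of _ z]) simp
  ultimately show ?thesis
    using c[of ?\<nu>] k by simp
qed

text \<open>Compare coefficients at \<open>\<nu> z\<^sup>d\<^sup>-\<^sup>1\<close>, which is divisible by none of the monomials \<open>M/x\<^sub>k\<close> with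
  \<open>s k > 0\<close>, nor by \<open>z\<^sup>d\<close>.\<close>

lemma log_derivation_last_coeff:
  assumes \<nu>: "Poly_Mapping.lookup \<nu> z = 0"
    and small: "\<And>k. k \<noteq> z \<Longrightarrow> s k > 0 \<Longrightarrow>
      \<exists>i. Poly_Mapping.lookup \<nu> i < Poly_Mapping.lookup (exponent_minus k) i"
  shows "Poly_Mapping.lookup (\<theta> (Var z)) \<nu> = 0"
proof -
  let ?\<nu> = "Poly_Mapping.single z (d - 1) + \<nu>"
  obtain c where c: "\<And>\<nu>. (\<Sum>k\<in>UNIV - {z}. Poly_Mapping.lookup
        (Poly_Mapping.single (exponent_minus k) (of_nat (s k)) * \<theta> (Var k)) \<nu>)
      - Poly_Mapping.lookup (Poly_Mapping.single (Poly_Mapping.single z (d - 1)) (of_nat d) * \<theta> (Var z)) \<nu>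
      = Poly_Mapping.lookup (Poly_Mapping.single exponent 1 * c) \<nu>
        - Poly_Mapping.lookup (Poly_Mapping.single (Poly_Mapping.single z d) 1 * c) \<nu>"
    by (rule lookup_log_derivation) blast
  have below: "\<exists>i. Poly_Mapping.lookup ?\<nu> i < Poly_Mapping.lookup (exponent_minus k) i"
    if k: "k \<noteq> z" "s k > 0" for k
  proof -
    obtain i where i: "Poly_Mapping.lookup \<nu> i < Poly_Mapping.lookup (exponent_minus k) i"
      using small[OF k] by blast
    then have "i \<noteq> z"
      using s_z by (auto split: if_splits)
    then have "Poly_Mapping.lookup ?\<nu> i < Poly_Mapping.lookup (exponent_minus k) i"
      using i by (simp add: lookup_add lookup_single_not_eq)
    then show ?thesis
      by blast
  qed
  have "Poly_Mapping.lookup (Poly_Mapping.single (exponent_minus k) (of_nat (s k)) * \<theta> (Var k)) ?\<nu> = 0"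
    if kz: "k \<noteq> z" for k
  proof (cases "s k = 0")
    case False
    then obtain i where "Poly_Mapping.lookup ?\<nu> i < Poly_Mapping.lookup (exponent_minus k) i"
      using below[OF kz] by blast
    then show ?thesis
      by (rule lookup_single_mult_eq_zero)
  qed simp
  then have "(\<Sum>k\<in>UNIV - {z}. Poly_Mapping.lookup
        (Poly_Mapping.single (exponent_minus k) (of_nat (s k)) * \<theta> (Var k)) ?\<nu>) = 0"
    by (intro sum.neutral) auto
  moreover have "Poly_Mapping.lookup (Poly_Mapping.single exponent 1 * c) ?\<nu> = 0"
  proof -
    obtain k where k: "s k \<noteq> 0"
      using sum_s d_pos by (metis less_numeral_extra(3) sum.neutral)
    then have "k \<noteq> z"
      using s_z by auto
    then obtain i where "Poly_Mapping.lookup ?\<nu> i < Poly_Mapping.lookup (exponent_minus k) i"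
      using below k by blast
    then have "Poly_Mapping.lookup ?\<nu> i < Poly_Mapping.lookup exponent i"
      by (auto split: if_splits)
    then show ?thesis
      by (rule lookup_single_mult_eq_zero)
  qed
  moreover have "Poly_Mapping.lookup (Poly_Mapping.single (Poly_Mapping.single z d) 1 * c) ?\<nu> = 0"
    using d2 \<nu> by (intro lookup_single_mult_eq_zero[of _ z]) (simp add: lookup_add)
  ultimately show ?thesis
    using c[of ?\<nu>] d_pos by (simp add: lookup_single_mult del: One_nat_def)
qed

end

lemma vector_field_two:
  assumes "k \<noteq> z"
  shows "vector_field ((\<lambda>_. 0)(k := u, z := v)) F = u * partial_deriv k F + v * partial_deriv z F"
proof -
  have "vector_field ((\<lambda>_. 0)(k := u, z := v)) F =
      (\<Sum>i\<in>{k, z}. ((\<lambda>_. 0)(k := u, z := v)) i * partial_deriv i F)"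
    unfolding vector_field_def by (rule sum.mono_neutral_right) auto
  then show ?thesis
    using assms by simp
qed

context
  fixes p q :: 'n
  assumes pq: "p \<noteq> q" "p \<noteq> z" "q \<noteq> z" "s p > 0" "s q > 0"
begin

text \<open>The \<open>n + 1\<close> functionals are indexed by \<open>'n option\<close>: an index \<open>Some k\<close> with \<open>k \<noteq> z\<close> detects the
  diagonal derivation at \<open>k\<close>, while \<open>Some z\<close> and \<open>None\<close> detect the derivations
  \<open>d z\<^sup>d\<^sup>-\<^sup>1 \<partial>\<^sub>k + (\<partial>\<^sub>k M) \<partial>\<^sub>z\<close> for \<open>k = p\<close> and \<open>k = q\<close>. If \<open>k\<close> does not occur in \<open>M\<close>, then
  \<open>\<partial>\<^sub>k\<close> is logarithmic and the constant term of \<open>\<theta>(x\<^sub>k)\<close> is read off instead of the linear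
  one.\<close>

definition probe_exp :: "'n option \<Rightarrow> 'n \<Rightarrow>\<^sub>0 nat" where
  "probe_exp t = (case t of None \<Rightarrow> exponent_minus q
     | Some k \<Rightarrow> if k = z then exponent_minus p
                else if s k = 0 then 0 else Poly_Mapping.single k 1)"

definition probe :: "'n option \<Rightarrow> (('n, 'k::field_char_0) mpoly \<Rightarrow> ('n, 'k) mpoly) \<Rightarrow> 'k" where
  "probe t \<theta> = Poly_Mapping.lookup (\<theta> (Var (case t of None \<Rightarrow> z | Some k \<Rightarrow> k))) (probe_exp t)"

definition twist :: "'n \<Rightarrow> 'n \<Rightarrow> ('n, 'k::field_char_0) mpoly" where
  "twist k = (\<lambda>_. 0)(k := of_nat d * Var z ^ (d - 1), z := partial_deriv k (toric_mon Var))"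

definition dual :: "'n option \<Rightarrow> 'n \<Rightarrow> ('n, 'k::field_char_0) mpoly" where
  "dual t = (case t of None \<Rightarrow> twist q
     | Some k \<Rightarrow> if k = z then twist p
         else (\<lambda>_. 0)(k := Poly_Mapping.single (probe_exp t) 1, z := of_nat (s k) * inv_d * Var z))"

lemma d_ge_2: "d \<ge> 2"
proof -
  have "s p + s q = sum s {p, q}"
    using pq by simp
  also have "\<dots> \<le> d"
    unfolding sum_s[symmetric] by (rule sum_mono2) auto
  finally show ?thesis
    using pq by simp
qed

lemma dual_in_log_derivations:
  "vector_field (dual t) \<in> log_derivations (hypersurface :: ('n, 'k::field_char_0) mpoly)"
proof -
  have k: "partial_deriv k hypersurface = (partial_deriv k (toric_mon Var) :: ('n, 'k) mpoly)" if "k \<noteq> z" for k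
    using that by (simp add: hypersurface_def partial_deriv_diff partial_deriv_power partial_deriv_Var)
  have z: "partial_deriv z hypersurface = - (of_nat d * Var z ^ (d - 1) :: ('n, 'k) mpoly)"
    by (simp add: hypersurface_def partial_deriv_diff partial_deriv_mon partial_deriv_power
        partial_deriv_Var)
  have twist: "vector_field (twist k) hypersurface = (0 :: ('n, 'k) mpoly)" if "k \<noteq> z" for k
    unfolding twist_def vector_field_two[OF that] k[OF that] z by (simp add: mult_ac)
  have "hypersurface dvd (vector_field (dual t) hypersurface :: ('n, 'k) mpoly)"
  proof (cases t)
    case None
    then show ?thesis
      using pq by (simp add: dual_def twist)
  next
    case (Some k)
    show ?thesis
    proof (cases "k = z")
      case True
      then show ?thesis
        using pq Some by (simp add: dual_def twist)
    next
      case False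
      have euler: "Poly_Mapping.single (probe_exp t) 1 * partial_deriv k (toric_mon Var)
          = (of_nat (s k) * toric_mon Var :: ('n, 'k) mpoly)"
      proof (cases "s k = 0")
        case True
        then show ?thesis
          by (simp add: partial_deriv_mon_single)
      next
        case sk: False
        have "Poly_Mapping.single (probe_exp t) 1 = (Var k :: ('n, 'k) mpoly)"
          using Some False sk by (simp add: probe_exp_def Var_def)
        then show ?thesis
          using Var_mult_partial_deriv_monomial[of UNIV k s] by (simp add: toric_mon_def)
      qed
      have last: "of_nat (s k) * inv_d * Var z * - (of_nat d * Var z ^ (d - 1))
          = - (of_nat (s k) * Var z ^ d :: ('n, 'k) mpoly)"
        unfolding d_Var_z[symmetric] by (simp add: mult_ac)
      have "dual t = (\<lambda>_. 0)(k := Poly_Mapping.single (probe_exp t) 1,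
          z := of_nat (s k) * inv_d * Var z :: ('n, 'k) mpoly)"
        using Some False by (simp add: dual_def)
      then have "vector_field (dual t) hypersurface = (of_nat (s k) * hypersurface :: ('n, 'k) mpoly)"
        by (simp only: vector_field_two[OF False] k[OF False] z euler last)
          (simp add: hypersurface_def right_diff_distrib)
      then show ?thesis
        by simp
    qed
  qed
  then show ?thesis
    by (simp add: log_derivations_iff vector_field_in_derivations)
qed

lemma probe_dual: "(probe t (vector_field (dual u)) :: 'k::field_char_0) = 0 \<longleftrightarrow> t \<noteq> u"
proof -
  have exp: "exponent_minus p \<noteq> exponent_minus q"
  proof
    assume "exponent_minus p = exponent_minus q"
    then have "Poly_Mapping.lookup (exponent_minus p) p = Poly_Mapping.lookup (exponent_minus q) p"
      by simp
    then show False
      using pq by simp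
  qed
  have z_mult: "Poly_Mapping.lookup (a * Var z) (exponent_minus k) = (0 :: 'k)" for a k
  proof -
    have "Poly_Mapping.lookup (Poly_Mapping.single (Poly_Mapping.single z 1) 1 * a) (exponent_minus k) = (0 :: 'k)"
      using s_z by (intro lookup_single_mult_eq_zero[of _ z]) auto
    then show ?thesis
      by (simp add: Var_def mult.commute)
  qed
  have power: "Poly_Mapping.lookup (of_nat d * Var z ^ (d - Suc 0)) (probe_exp (Some k)) = (0 :: 'k)"
    if "k \<noteq> z" for k
  proof -
    have "Poly_Mapping.lookup (Poly_Mapping.single (Poly_Mapping.single z (d - 1)) 1 * of_nat d)
        (probe_exp (Some k)) = (0 :: 'k)"
      using d_ge_2 that by (intro lookup_single_mult_eq_zero[of _ z]) (simp add: probe_exp_def lookup_single)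
    then show ?thesis
      by (simp add: Var_power_conv_single mult.commute)
  qed
  show ?thesis
    using pq s_z exp exp[symmetric]
    by (auto simp: probe_def dual_def twist_def vector_field_Var partial_deriv_mon_single z_mult power
        probe_exp_def[of None] probe_exp_def[of "Some z"] lookup_single_not_eq
        split: option.splits if_splits)
qed

lemma probe_add: "probe t (\<theta> + \<eta>) = probe t \<theta> + probe t \<eta>"
  by (simp add: probe_def lookup_add)

text \<open>So a probe vanishes on multiples of \<open>\<theta>\<close> by polynomials without constant term: by the two
  coefficient comparisons above, no proper divisor of the probed monomial occurs in the
  probed component of \<open>\<theta>\<close>.\<close>

lemma probe_scale:
  fixes \<theta> :: "('n, 'k::field_char_0) mpoly \<Rightarrow> ('n, 'k) mpoly"
  assumes \<theta>: "\<theta> \<in> log_derivations hypersurface"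
  shows "probe t (der_scale a \<theta>) = Poly_Mapping.lookup a 0 * probe t \<theta>"
proof -
  have last: "Poly_Mapping.lookup (\<theta> (Var z)) \<beta> = 0"
    if l: "l = p \<or> l = q" and eq: "exponent_minus l = \<gamma> + \<beta>" and ne: "\<beta> \<noteq> exponent_minus l" for l \<beta> \<gamma>
  proof (rule log_derivation_last_coeff[OF \<theta> d_ge_2])
    have le: "Poly_Mapping.lookup \<beta> i \<le> Poly_Mapping.lookup (exponent_minus l) i" for i
      by (simp add: eq lookup_add)
    have lz: "l \<noteq> z" "s l > 0"
      using l pq by auto
    show "Poly_Mapping.lookup \<beta> z = 0"
      using le[of z] s_z by (simp split: if_splits)
    show "\<exists>i. Poly_Mapping.lookup \<beta> i < Poly_Mapping.lookup (exponent_minus k) i"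
      if k: "k \<noteq> z" "s k > 0" for k
    proof (cases "k = l")
      case True
      show ?thesis
      proof (rule ccontr)
        assume "\<not> ?thesis"
        then have "\<beta> = exponent_minus l"
          using le True by (intro poly_mapping_eqI) (metis le_antisym not_less)
        then show False
          using ne by simp
      qed
    next
      case False
      then have "Poly_Mapping.lookup \<beta> l < Poly_Mapping.lookup (exponent_minus k) l"
        using le[of l] lz by simp
      then show ?thesis
        by blast
    qed
  qed
  have "Poly_Mapping.lookup (\<theta> (Var (case t of None \<Rightarrow> z | Some k \<Rightarrow> k))) \<beta> = 0"
    if eq: "probe_exp t = \<gamma> + \<beta>" and ne: "\<beta> \<noteq> probe_exp t" for \<beta> \<gamma>
  proof (cases t)
    case None
    then show ?thesis
      using last[of q \<gamma> \<beta>] eq ne by (simp add: probe_exp_def)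
  next
    case (Some k)
    show ?thesis
    proof (cases "k = z")
      case True
      then show ?thesis
        using last[of p \<gamma> \<beta>] eq ne Some by (simp add: probe_exp_def)
    next
      case False
      have le: "Poly_Mapping.lookup \<beta> i \<le> Poly_Mapping.lookup (probe_exp t) i" for i
        by (simp add: eq lookup_add)
      have \<beta>: "\<beta> = 0 \<and> s k > 0"
      proof (cases "s k = 0")
        case True
        then have "\<beta> = probe_exp t"
          using le Some False by (intro poly_mapping_eqI) (simp add: probe_exp_def)
        then show ?thesis
          using ne by simp
      next
        case sk: False
        then have t: "probe_exp t = Poly_Mapping.single k 1"
          using Some False by (simp add: probe_exp_def)
        have other: "Poly_Mapping.lookup \<beta> i = 0" if "i \<noteq> k" for i
          using le[of i] that by (simp add: t lookup_single_not_eq)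
        have "Poly_Mapping.lookup \<beta> k \<noteq> 1"
        proof
          assume "Poly_Mapping.lookup \<beta> k = 1"
          then have "\<beta> = probe_exp t"
            using other by (intro poly_mapping_eqI) (auto simp: t lookup_single when_def)
          then show False
            using ne by simp
        qed
        then have "Poly_Mapping.lookup \<beta> k = 0"
          using le[of k] by (simp add: t)
        then have "\<beta> = 0"
          using other by (intro poly_mapping_eqI) (metis lookup_zero)
        then show ?thesis
          using sk by simp
      qed
      then show ?thesis
        using log_derivation_no_constant[OF \<theta> d_ge_2 False] Some by simp
    qed
  qed
  then show ?thesis
    unfolding probe_def der_scale_def by (rule lookup_mult_least)
qed

text \<open>If a basis \<open>B\<close> had at most \<open>n\<close> elements, then some nontrivial combination of the \<open>n + 1\<close>
  probes would vanish on \<open>B\<close>, hence on all logarithmic derivations, in particular on the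
  derivations dual to the probes.\<close>

theorem nonfree_divisor_hypersurface: "nonfree_divisor (hypersurface :: ('n, 'k::field_char_0) mpoly)"
  unfolding nonfree_divisor_def free_module_def
proof (intro conjI squarefree_hypersurface notI)
  assume "\<exists>B. \<not> der.dependent B \<and> der.span B = log_derivations (hypersurface :: ('n, 'k) mpoly)"
  then obtain B where indep: "\<not> der.dependent B"
    and span: "der.span B = log_derivations (hypersurface :: ('n, 'k) mpoly)"
    by blast
  have B_log: "B \<subseteq> log_derivations hypersurface"
    using der.span_superset[of B] span by simp
  then have "B \<subseteq> derivations"
    by (auto simp: log_derivations_iff)
  from independent_derivations_card[OF this indep]
  have B: "finite B" "card B \<le> card (UNIV :: 'n set)"
    by auto
  have "card B < card (UNIV :: 'n option set)"
    using B(2) by (simp add: UNIV_option_conv card_image)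
  then obtain c :: "'n option \<Rightarrow> 'k" where c: "\<exists>t\<in>UNIV. c t \<noteq> 0"
      "\<forall>b\<in>B. (\<Sum>t\<in>UNIV. probe t b * c t) = 0"
    using homogeneous_system_solvable[of B UNIV "\<lambda>b t. probe t b"] B(1) by auto
  have zero: "(\<Sum>t\<in>UNIV. probe t \<theta> * c t) = 0" if "\<theta> \<in> log_derivations hypersurface" for \<theta>
    using that unfolding span[symmetric]
  proof (induction rule: der.span_induct_alt)
    case base
    then show ?case
      by (simp add: probe_def)
  next
    case (step a b \<theta>)
    have "(\<Sum>t\<in>UNIV. probe t (der_scale a b + \<theta>) * c t)
        = Poly_Mapping.lookup a 0 * (\<Sum>t\<in>UNIV. probe t b * c t) + (\<Sum>t\<in>UNIV. probe t \<theta> * c t)"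
      using B_log step(1)
      by (simp add: probe_add probe_scale subset_iff distrib_right sum.distrib sum_distrib_left
          mult.assoc)
    also have "\<dots> = 0"
      using c(2) step by simp
    finally show ?case .
  qed
  obtain t where t: "c t \<noteq> 0"
    using c(1) by blast
  have "(\<Sum>u\<in>UNIV. probe u (vector_field (dual t)) * c u) = probe t (vector_field (dual t)) * c t"
    by (subst sum.remove[of _ t]) (auto simp: probe_dual intro!: sum.neutral)
  then show False
    using zero[OF dual_in_log_derivations, of t] t by (simp add: probe_dual)
qed

end

end

section \<open>Numbered indeterminates\<close>

theorem proposition2p11:
  fixes n d :: nat
    and v :: "nat \<Rightarrow> 'n::{finite,linorder}"
    and r i :: "nat \<Rightarrow> nat"
    and x :: "nat \<Rightarrow> ('n, 'k::{alg_closed_field,field_char_0}) mpoly"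
    and f g h :: "('n, 'k) mpoly"
  assumes "n \<ge> 3"
    and "bij_betw v {1..n} (UNIV :: 'n set)"
    and "\<And>j. x j = Var (v j)"
    and "(\<Sum>j = 1..n - 1. r j) = d"
    and "\<And>j. j \<in> {2..n - 1} \<Longrightarrow> r j \<noteq> 0"
    and "g = (\<Prod>j = 1..n - 1. x j ^ r j) - x n ^ d"
    and "inj_on i {1..n - 2}"
    and "i ` {1..n - 2} \<subseteq> {1..n - 1}"
    and "h = (\<Prod>k = 1..n - 2. x (i k))"
    and "f = g * h"
  shows "((n = 3 \<longrightarrow> r 1 \<noteq> 0) \<longrightarrow> nonfree_divisor g) \<and>
         (free_divisor f \<and> linear_type_divisor f)"
proof -
  note n3 = assms(1) and x = assms(3) and i_inj = assms(7) and i_sub = assms(8)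
  have v_inj: "inj_on v {1..n}" and v_surj: "v ` {1..n} = UNIV"
    using assms(2) by (auto simp: bij_betw_def)
  have v_eq: "v a = v b \<longleftrightarrow> a = b" if "a \<in> {1..n}" "b \<in> {1..n}" for a b
    using inj_on_eq_iff[OF v_inj that] .
  have split_n: "{1..n} = insert n {1..n - 1}"
    using n3 by auto
  let ?I = "i ` {1..n - 2}"
  \<comment> \<open>The index \<open>l\<close> of the indeterminate other than \<open>x\<^sub>n\<close> that is missing from \<open>h\<close>.\<close>
  have "card ({1..n - 1} - ?I) = 1"
  proof -
    have "card ?I = n - 2"
      using card_image[OF i_inj] by simp
    then show ?thesis
      using n3 i_sub by (subst card_Diff_subset) simp_all
  qed
  then obtain l where l: "{1..n - 1} - ?I = {l}"
    by (rule card_1_singletonE)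
  define s where "s k = (let j = inv_into {1..n} v k in if j = n then 0 else r j)" for k
  have s_v: "s (v j) = (if j = n then 0 else r j)" if "j \<in> {1..n}" for j
    using inv_into_f_f[OF v_inj that] by (simp add: s_def)
  define S where "S = v ` ?I"
  have l_in: "l \<in> {1..n - 1}" "l \<notin> ?I" and I_l: "{1..n - 1} = insert l ?I"
    using l i_sub by blast+
  have parts: "{1..n} = insert n (insert l ?I)" "l \<notin> ?I" "n \<notin> ?I" "n \<noteq> l"
    using l_in i_sub n3 unfolding split_n I_l[symmetric] by auto
  have mem: "n \<in> {1..n}" "l \<in> {1..n}" "j \<in> ?I \<Longrightarrow> j \<in> {1..n}" for j
    using parts(1) by auto
  interpret toric_data "v n" "v l" S s d
  proof
    show "v n \<notin> S" "v l \<notin> S"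
      using parts mem v_eq unfolding S_def by (metis imageE)+
    show "v n \<noteq> v l"
      using parts mem v_eq by metis
    show "UNIV = insert (v n) (insert (v l) S)"
      unfolding v_surj[symmetric] parts(1) S_def by simp
    show "s (v n) = 0"
      using s_v[OF mem(1)] by simp
    have "sum s UNIV = (\<Sum>j\<in>{1..n}. s (v j))"
      unfolding v_surj[symmetric] by (subst sum.reindex[OF v_inj]) simp
    also have "\<dots> = (\<Sum>j = 1..n - 1. r j)"
      unfolding split_n using n3 s_v[OF mem(1)]
      by (subst sum.insert) (auto intro!: sum.cong simp: s_v)
    finally show "sum s UNIV = d"
      using assms(4) by simp
    have "r 2 \<noteq> 0" "2 \<in> {1..n - 1}"
      using assms(5)[of 2] n3 by auto
    then show "d > 0"
      unfolding assms(4)[symmetric] by (metis bot_nat_0.not_eq_extremum finite_atLeastAtMost sum_eq_0_iff)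
  qed
  have "toric_mon Var = (\<Prod>j\<in>{1..n}. x j ^ s (v j))"
    unfolding toric_mon_def v_surj[symmetric] by (subst prod.reindex[OF v_inj]) (simp add: x)
  also have "\<dots> = (\<Prod>j = 1..n - 1. x j ^ r j)"
    unfolding split_n using n3 s_v[OF mem(1)]
    by (subst prod.insert) (auto intro!: prod.cong simp: s_v)
  finally have g: "g = hypersurface"
    by (simp add: hypersurface_def assms(6) x)
  have "inj_on v ?I"
    using parts(1) by (intro inj_on_subset[OF v_inj]) blast
  then have "boundary = (\<Prod>j\<in>?I. Var (v j) :: ('n, 'k) mpoly)"
    unfolding boundary_def unfolding S_def by (subst prod.reindex) simp_all
  also have "\<dots> = h"
    unfolding assms(9) x by (subst prod.reindex[OF i_inj]) simp
  finally have h: "h = boundary" ..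
  have f: "f = divisor"
    by (simp add: divisor_def assms(10) g h)
  have "nonfree_divisor g" if r1: "n = 3 \<longrightarrow> r 1 \<noteq> 0"
  proof -
    \<comment> \<open>If \<open>r\<^sub>1 = 0\<close>, then \<open>n \<ge> 4\<close>, so that \<open>r\<^sub>2\<close> and \<open>r\<^sub>3\<close> are available.\<close>
    obtain a b where ab: "a \<noteq> b" "a \<in> {1..n - 1}" "b \<in> {1..n - 1}" "r a > 0" "r b > 0"
    proof (cases "r 1 = 0")
      case True
      then have "n \<noteq> 3"
        using r1 by simp
      then show ?thesis
        using that[of 2 3] assms(5)[of 2] assms(5)[of 3] n3 by auto
    next
      case False
      then show ?thesis
        using that[of 1 2] assms(5)[of 2] n3 by auto
    qed
    have a: "a \<in> {1..n}" "a \<noteq> n" and b: "b \<in> {1..n}" "b \<noteq> n"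
      using ab n3 by auto
    show ?thesis
      unfolding g
    proof (rule nonfree_divisor_hypersurface)
      show "v a \<noteq> v b" "v a \<noteq> v n" "v b \<noteq> v n"
        using v_eq a b mem(1) ab(1) by blast+
      show "0 < s (v a)" "0 < s (v b)"
        using a b ab(4,5) by (simp_all add: s_v)
    qed
  qed
  then show ?thesis
    using free_divisor linear_type_divisor by (simp add: f)
qed

end
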